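(* Let $n,d\in\mathbb{N}$, $\delta\in(0,1/4]$, $\sigma>0$, $r\in[1,\min(n,d)]$, $$\Theta:=\bigl\{\Sigma\in\mathcal{S}_+^{d\times d}:\|\Sigma\|_{\mathrm{op}}\le\sigma^2,\ \mathbf{r}(\Sigma)\le r\bigr\},$$ and for $\Sigma\in\Theta$, define $\mathcal{P}_\Sigma:=\{\mathsf{N}_d(0,\Sigma)^{\otimes n}\}$. Then, for the loss $L(\Sigma,\Sigma')=\|\Sigma-\Sigma'\|_{\mathrm{op}}$, $$\mathcal{M}(\delta,\mathcal{P}_\Theta,\|\cdot\|_{\mathrm{op}})\asymp\min\biggl\{\sigma^2\sqrt{\frac{r+\log(1/\delta)}{n}},\ \sigma^2\biggr\}.$$
   Context: $\mathcal{S}_+^{d\times d}$ is the set of symmetric positive semi-definite $d\times d$ real matrices; $\|\cdot\|_{\mathrm{op}}$ is the operator (spectral) norm; the effective rank of $\Sigma\in\mathcal{S}_+^{d\times d}$ is $\mathbf{r}(\Sigma):=\mathrm{tr}(\Sigma)/\|\Sigma\|_{\mathrm{op}}$, with the convention $0/0:=0$. For a pseudo-metric space $\Theta$ of parameters (with its Borel $\sigma$-algebra), a family $\mathcal{P}_\Theta=\{\mathcal{P}_\theta:\theta\in\Theta\}$ where each $\mathcal{P}_\theta$ is a set of probability measures on a measurable space $\mathcal{X}$, and a loss $L:\Theta\times\Theta\to[0,\infty)$, the minimax $(1-\delta)$th quantile is $$\mathcal{M}(\delta,\mathcal{P}_\Theta,L):=\inf_{\hat\theta}\sup_{\theta\in\Theta}\sup_{P_\theta\in\mathcal{P}_\theta}\inf\{t\in[0,\infty):P_\theta\{L(\hat\theta,\theta)\le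 t\}\ge1-\delta\},$$ where the first infimum is over all measurable functions $\hat\theta:\mathcal{X}\to\Theta$ (which may depend on $\delta$). Here $\mathcal{X}=(\mathbb{R}^d)^n$. The notation $\mathcal{M}(\delta,\mathcal{P}_\Theta,\|\cdot\|_{\mathrm{op}})$ refers to the loss $L(\Sigma,\Sigma')=\|\Sigma-\Sigma'\|_{\mathrm{op}}$. $a\asymp b$ means that there are universal constants $c,C>0$ (not depending on any of the parameters, here $n,d,\delta,\sigma,r$) with $cb\le a\le Cb$. *)

theory Defs
  imports "HOL-Probability.Probability" "Jordan_Normal_Form.Matrix"
begin

text \<open>
  The dimension \<open>d\<close> and the sample size \<open>n\<close> are quantified inside the statement (the constants must
  not depend on them), so they are natural numbers rather than types. Matrices are
  those of Jordan_Normal_Form. Points of \<open>\<real>\<^sup>d\<close> in the sample space are extensional functions on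
  \<open>{..<d}\<close>, so that the product \<open>\<sigma>\<close>-algebra can be used.
\<close>

definition op_norm :: "real mat \<Rightarrow> real" where
  "op_norm A =
     (SUP x \<in> {x \<in> carrier_vec (dim_col A). sqrt (scalar_prod x x) \<le> 1}.
        sqrt (scalar_prod (A *\<^sub>v x) (A *\<^sub>v x)))"

definition tr :: "real mat \<Rightarrow> real" where
  "tr A = (\<Sum>i<dim_row A. A $$ (i, i))"

definition psd_mats :: "nat \<Rightarrow> real mat set" where
  "psd_mats d = {A \<in> carrier_mat d d. transpose_mat A = A \<and>
                   (\<forall>x \<in> carrier_vec d. 0 \<le> scalar_prod x (A *\<^sub>v x))}"

text \<open>Division by zero in HOL yields zero, so the zero matrix has effective rank \<open>0\<close>.\<close>

definition effective_rank :: "real mat \<Rightarrow> real" where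
  "effective_rank A = tr A / op_norm A"

text \<open>
  The open sets are written out, since the library's metric locale does not cover pseudo-metrics.
\<close>

definition pseudometric_borel :: "'p set \<Rightarrow> ('p \<Rightarrow> 'p \<Rightarrow> real) \<Rightarrow> 'p measure" where
  "pseudometric_borel \<Theta> \<rho> =
     sigma \<Theta> {U. U \<subseteq> \<Theta> \<and> (\<forall>x\<in>U. \<exists>e>0. \<forall>y\<in>\<Theta>. \<rho> x y < e \<longrightarrow> y \<in> U)}"

text \<open>
  \<open>X\<close> is the sample space and \<open>T\<close> the parameter space; of both, only the underlying set and the
  \<open>\<sigma>\<close>-algebra matter. Values lie in \<open>[0,\<infty>]\<close>, where the infimum of the empty set is \<open>\<infty>\<close>.
\<close>

definition minimax_quantile ::
  "real \<Rightarrow> 'x measure \<Rightarrow> 'p measure \<Rightarrow> ('p \<Rightarrow> 'x measure set) \<Rightarrow> ('p \<Rightarrow> 'p \<Rightarrow> real) \<Rightarrow> ennreal"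
where
  "minimax_quantile \<delta> X T \<P> L =
     (INF est \<in> measurable X T. SUP \<theta> \<in> space T. SUP P \<in> \<P> \<theta>.
        INF t \<in> {t. 0 \<le> t \<and> 1 - \<delta> \<le> measure P {x \<in> space X. L (est x) \<theta> \<le> t}}. ennreal t)"

text \<open>A positive semi-definite matrix has exactly one positive semi-definite square root.\<close>

definition psd_sqrt :: "nat \<Rightarrow> real mat \<Rightarrow> real mat" where
  "psd_sqrt d \<Sigma> = (SOME S. S \<in> psd_mats d \<and> S * S = \<Sigma>)"

text \<open>
  \<open>\<Sigma>\<close> may be singular, so the normal law is the law of \<open>\<Sigma>\<^sup>1\<^sup>/\<^sup>2 Z\<close> with \<open>Z\<close> standard normal.
\<close>

definition centred_normal :: "nat \<Rightarrow> real mat \<Rightarrow> (nat \<Rightarrow> real) measure" where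
  "centred_normal d \<Sigma> =
     distr (\<Pi>\<^sub>M i\<in>{..<d}. density lborel (\<lambda>x. ennreal (std_normal_density x)))
           (\<Pi>\<^sub>M i\<in>{..<d}. borel)
           (\<lambda>z. \<lambda>i\<in>{..<d}. \<Sum>j<d. psd_sqrt d \<Sigma> $$ (i, j) * z j)"

definition sample_space :: "nat \<Rightarrow> nat \<Rightarrow> (nat \<Rightarrow> nat \<Rightarrow> real) measure" where
  "sample_space n d = (\<Pi>\<^sub>M k\<in>{..<n}. \<Pi>\<^sub>M i\<in>{..<d}. borel)"

definition normal_family :: "nat \<Rightarrow> nat \<Rightarrow> real mat \<Rightarrow> (nat \<Rightarrow> nat \<Rightarrow> real) measure set" where
  "normal_family n d \<Sigma> = {\<Pi>\<^sub>M k\<in>{..<n}. centred_normal d \<Sigma>}"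

definition cov_class :: "nat \<Rightarrow> real \<Rightarrow> real \<Rightarrow> real mat set" where
  "cov_class d \<sigma> r = {\<Sigma> \<in> psd_mats d. op_norm \<Sigma> \<le> \<sigma>\<^sup>2 \<and> effective_rank \<Sigma> \<le> r}"

definition op_loss :: "real mat \<Rightarrow> real mat \<Rightarrow> real" where
  "op_loss A B = op_norm (A - B)"

end

theory Submission
  imports Defs
begin

text \<open>
  For the upper bound, take the sample covariance, rounded to a nearby element of the parameter
  space. Its operator-norm error is the supremum of a bilinear form over pairs of unit vectors. The
  exponential moment of that form is averaged over a Gaussian prior \<open>N(0, I / (2 r))\<close> for each
  argument, truncated where the quadratic form of \<open>\<Sigma>\<close> is of order \<open>\<sigma>\<^sup>2\<close>; the average has expectation
  at most one after normalisation, and shifting the prior to any pair of unit vectors costs only a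
  factor \<open>exp (2 r)\<close>. The dimension enters through \<open>tr \<Sigma> \<le> r \<sigma>\<^sup>2\<close> alone.

  For the lower bound, the term \<open>ln (1 / \<delta>)\<close> comes from testing two rank-one covariances, and the
  term \<open>r\<close> from Assouad's lemma for covariances in which one coordinate is correlated with about
  \<open>r\<close> others, the signs of the correlations ranging over a hypercube.
\<close>

text \<open>A net over the unit sphere would cost a factor exponential in \<open>d\<close>, whereas
  only one exponential in \<open>r\<close> is affordable; hence the prior average. With variance
  \<open>1 / (2 r)\<close> the prior mean of the quadratic form is at most
  \<open>\<sigma>\<^sup>2 / 2\<close>, so Markov's inequality keeps half of the prior mass. The
  truncation is forced: a product of two Gaussians has exponential moments only near zero, in a
  range set by the two quadratic forms. Covariances in the class may be singular, and their normal
  laws then have no Lebesgue density. Hypotheses are therefore compared on a common reference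
  measure, from which one common map produces both laws. The square root defining a normal law is a
  choice; by Cramer--Wold the law depends on the covariance only, so any explicit factor may replace
  it. In the hypercube a flipped sign of size \<open>1 / sqrt n\<close> is barely visible in
  \<open>n\<close> samples, yet \<open>m\<close> wrong signs add up in the Euclidean norm of one
  column to order \<open>sqrt (m / n)\<close>. The bound \<open>\<delta> \<le> 1/4\<close> limits
  what a failing estimator contributes to the count of wrong signs: \<open>1/8 + 1/4\<close> stays
  below \<open>2/5\<close>.\<close>

section \<open>Linear algebra on the first \<open>d\<close> coordinates of total functions\<close>

definition ip :: "nat \<Rightarrow> (nat \<Rightarrow> real) \<Rightarrow> (nat \<Rightarrow> real) \<Rightarrow> real" where
  "ip d x y = (\<Sum>i<d. x i * y i)"

definition mv :: "nat \<Rightarrow> (nat \<Rightarrow> nat \<Rightarrow> real) \<Rightarrow> (nat \<Rightarrow> real) \<Rightarrow> nat \<Rightarrow> real" where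
  "mv d A x i = (\<Sum>j<d. A i j * x j)"

abbreviation nrm :: "nat \<Rightarrow> (nat \<Rightarrow> real) \<Rightarrow> real" where
  "nrm d x \<equiv> L2_set x {..<d}"

abbreviation entries :: "real mat \<Rightarrow> nat \<Rightarrow> nat \<Rightarrow> real" where
  "entries A \<equiv> \<lambda>i j. A $$ (i, j)"

text \<open>An upper bound rather than a norm, so that sums and products are handled without
  suprema. For nonnegative \<open>a\<close> and a \<open>d\<close> by \<open>d\<close> matrix it
  amounts to \<open>op_norm A \<le> a\<close>, by \<open>op_norm_le\<close> and
  \<open>op_bound_op_norm\<close>.\<close>

definition op_bound :: "nat \<Rightarrow> (nat \<Rightarrow> nat \<Rightarrow> real) \<Rightarrow> real \<Rightarrow> bool" where
  "op_bound d A a \<longleftrightarrow> (\<forall>x. nrm d (mv d A x) \<le> a * nrm d x)"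

definition sym_entries :: "nat \<Rightarrow> (nat \<Rightarrow> nat \<Rightarrow> real) \<Rightarrow> bool" where
  "sym_entries d A \<longleftrightarrow> (\<forall>i<d. \<forall>j<d. A i j = A j i)"

lemma ip_nrm: "ip d x x = (nrm d x)\<^sup>2"
  by (simp add: ip_def L2_set_def sum_nonneg power2_eq_square)

lemma ip_commute: "ip d x y = ip d y x"
  by (simp add: ip_def mult.commute)

lemma ip_add_left: "ip d (\<lambda>i. x i + y i) z = ip d x z + ip d y z"
  by (simp add: ip_def sum.distrib algebra_simps)

lemma ip_add_right: "ip d z (\<lambda>i. x i + y i) = ip d z x + ip d z y"
  by (simp add: ip_def sum.distrib algebra_simps)

lemma ip_scale_left: "ip d (\<lambda>i. c * x i) z = c * ip d x z"
  by (simp add: ip_def sum_distrib_left algebra_simps)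

lemma ip_scale_right: "ip d z (\<lambda>i. c * x i) = c * ip d z x"
  by (simp add: ip_def sum_distrib_left algebra_simps)

lemma ip_le_nrm: "\<bar>ip d x y\<bar> \<le> nrm d x * nrm d y"
proof -
  have "\<bar>ip d x y\<bar> \<le> (\<Sum>i<d. \<bar>x i\<bar> * \<bar>y i\<bar>)"
    unfolding ip_def by (rule order.trans[OF sum_abs]) (simp add: abs_mult)
  also have "\<dots> \<le> nrm d x * nrm d y" by (rule L2_set_mult_ineq)
  finally show ?thesis .
qed

lemma nrm_scale: "nrm d (\<lambda>i. c * x i) = \<bar>c\<bar> * nrm d x"
proof -
  have "(\<Sum>i<d. (c * x i)\<^sup>2) = c\<^sup>2 * (\<Sum>i<d. (x i)\<^sup>2)"
    by (simp add: power_mult_distrib sum_distrib_left)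
  then show ?thesis by (simp add: L2_set_def real_sqrt_mult)
qed

lemma nrm_add: "nrm d (\<lambda>i. x i + y i) \<le> nrm d x + nrm d y"
  by (rule L2_set_triangle_ineq)

lemma mv_add_vec: "mv d A (\<lambda>i. x i + y i) = (\<lambda>i. mv d A x i + mv d A y i)"
  by (rule ext) (simp add: mv_def sum.distrib algebra_simps)

lemma mv_scale_vec: "mv d A (\<lambda>i. c * x i) = (\<lambda>i. c * mv d A x i)"
  by (rule ext) (simp add: mv_def sum_distrib_left algebra_simps)

lemma mv_add: "mv d (\<lambda>i j. A i j + B i j) x = (\<lambda>i. mv d A x i + mv d B x i)"
  by (rule ext) (simp add: mv_def sum.distrib algebra_simps)

lemma mv_scale: "mv d (\<lambda>i j. c * A i j) x = (\<lambda>i. c * mv d A x i)"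
  by (rule ext) (simp add: mv_def sum_distrib_left algebra_simps)

lemma mv_mult: "mv d (\<lambda>i j. \<Sum>k<d. A i k * B k j) x = mv d A (mv d B x)"
proof (rule ext)
  fix i
  have "mv d (\<lambda>i j. \<Sum>k<d. A i k * B k j) x i = (\<Sum>j<d. \<Sum>k<d. A i k * B k j * x j)"
    by (simp add: mv_def sum_distrib_right)
  also have "\<dots> = (\<Sum>k<d. \<Sum>j<d. A i k * B k j * x j)" by (rule sum.swap)
  also have "\<dots> = mv d A (mv d B x) i"
    by (simp add: mv_def sum_distrib_left mult.assoc)
  finally show "mv d (\<lambda>i j. \<Sum>k<d. A i k * B k j) x i = mv d A (mv d B x) i" .
qed

lemma mv_cong: "(\<And>i j. i < d \<Longrightarrow> j < d \<Longrightarrow> A i j = B i j) \<Longrightarrow> i < d \<Longrightarrow> mv d A x i = mv d B x i"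
  by (simp add: mv_def)

lemma mv_unit: "j < d \<Longrightarrow> mv d A (\<lambda>k. if k = j then 1 else 0) i = A i j"
  by (simp add: mv_def if_distrib cong: if_cong)

lemma ip_mv_ident: "ip d x (mv d (\<lambda>i j. if i = j then 1 else 0) x) = (nrm d x)\<^sup>2"
proof -
  have "mv d (\<lambda>i j. if i = j then 1 else 0) x i = x i" if "i < d" for i
    using that by (simp add: mv_def if_distrib[of "\<lambda>c. c * _"] cong: if_cong)
  then show ?thesis by (simp add: ip_nrm[symmetric]) (simp add: ip_def)
qed

lemma nrm_unit: "j < d \<Longrightarrow> nrm d (\<lambda>k. if k = j then 1 else 0) = 1"
proof -
  assume "j < d"
  moreover have "(if k = j then 1 else 0 :: real)\<^sup>2 = (if k = j then 1 else 0)" for k by simp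
  ultimately show ?thesis by (simp add: L2_set_def)
qed

lemma ip_mv_sym: "sym_entries d A \<Longrightarrow> ip d x (mv d A y) = ip d (mv d A x) y"
proof -
  assume s: "sym_entries d A"
  have "ip d x (mv d A y) = (\<Sum>i<d. \<Sum>j<d. x i * (A i j * y j))"
    by (simp add: ip_def mv_def sum_distrib_left)
  also have "\<dots> = (\<Sum>j<d. \<Sum>i<d. x i * (A i j * y j))" by (rule sum.swap)
  also have "\<dots> = (\<Sum>j<d. \<Sum>i<d. A j i * x i * y j)"
    using s by (intro sum.cong refl) (simp add: sym_entries_def)
  also have "\<dots> = ip d (mv d A x) y" by (simp add: ip_def mv_def sum_distrib_right)
  finally show ?thesis .
qed

lemma op_bound_cong:
  "(\<And>i j. i < d \<Longrightarrow> j < d \<Longrightarrow> A i j = B i j) \<Longrightarrow> op_bound d A a \<longleftrightarrow> op_bound d B a"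
proof -
  assume eq: "\<And>i j. i < d \<Longrightarrow> j < d \<Longrightarrow> A i j = B i j"
  have "nrm d (mv d A x) = nrm d (mv d B x)" for x
    by (rule L2_set_cong) (use eq in \<open>auto intro: mv_cong\<close>)
  then show ?thesis by (simp add: op_bound_def)
qed

lemma op_bound_add: "op_bound d A a \<Longrightarrow> op_bound d B b \<Longrightarrow> op_bound d (\<lambda>i j. A i j + B i j) (a + b)"
  unfolding op_bound_def mv_add
proof
  fix x
  assume *: "\<forall>x. nrm d (mv d A x) \<le> a * nrm d x" "\<forall>x. nrm d (mv d B x) \<le> b * nrm d x"
  have "nrm d (\<lambda>i. mv d A x i + mv d B x i) \<le> nrm d (mv d A x) + nrm d (mv d B x)" by (rule nrm_add)
  also have "\<dots> \<le> (a + b) * nrm d x" using *[THEN spec[of _ x]] by (simp add: distrib_right)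
  finally show "nrm d (\<lambda>i. mv d A x i + mv d B x i) \<le> (a + b) * nrm d x" .
qed

lemma op_bound_scale: "op_bound d A a \<Longrightarrow> op_bound d (\<lambda>i j. c * A i j) (\<bar>c\<bar> * a)"
  unfolding op_bound_def mv_scale nrm_scale by (simp add: mult.assoc mult_left_mono)

lemma op_bound_mult:
  assumes "op_bound d A a" "op_bound d B b" "0 \<le> a"
  shows "op_bound d (\<lambda>i j. \<Sum>k<d. A i k * B k j) (a * b)"
  unfolding op_bound_def mv_mult
proof
  fix x
  have "nrm d (mv d A (mv d B x)) \<le> a * nrm d (mv d B x)" using assms by (simp add: op_bound_def)
  also have "\<dots> \<le> a * (b * nrm d x)" using assms by (intro mult_left_mono) (simp_all add: op_bound_def)
  finally show "nrm d (mv d A (mv d B x)) \<le> a * b * nrm d x" by simp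
qed

lemma op_bound_entry: "op_bound d A a \<Longrightarrow> i < d \<Longrightarrow> j < d \<Longrightarrow> \<bar>A i j\<bar> \<le> a"
proof -
  assume a: "op_bound d A a" "i < d" "j < d"
  have "\<bar>A i j\<bar> = \<bar>mv d A (\<lambda>k. if k = j then 1 else 0) i\<bar>" using a by (simp add: mv_unit)
  also have "\<dots> \<le> nrm d (\<lambda>i. \<bar>mv d A (\<lambda>k. if k = j then 1 else 0) i\<bar>)"
    using a by (intro member_le_L2_set) auto
  also have "\<dots> = nrm d (mv d A (\<lambda>k. if k = j then 1 else 0))" by (simp add: L2_set_def)
  also have "\<dots> \<le> a"
    using a(1)[unfolded op_bound_def, rule_format, of "\<lambda>k. if k = j then 1 else 0"] nrm_unit[OF a(3)] by simp
  finally show ?thesis .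
qed

text \<open>A crude bound that supplies finiteness: it bounds the supremum in
  \<open>op_norm\<close>, gives a scale for \<open>psd_sqrt_ex\<close>, and turns entrywise rounding
  errors into an operator bound.\<close>

lemma op_bound_sum_entries: "op_bound d A (\<Sum>i<d. \<Sum>j<d. \<bar>A i j\<bar>)"
  unfolding op_bound_def
proof
  fix x
  have "nrm d (mv d A x) \<le> (\<Sum>i<d. \<bar>mv d A x i\<bar>)" by (rule L2_set_le_sum_abs)
  also have "\<dots> \<le> (\<Sum>i<d. \<Sum>j<d. \<bar>A i j\<bar> * nrm d x)"
  proof (rule sum_mono)
    fix i
    have "\<bar>mv d A x i\<bar> \<le> (\<Sum>j<d. \<bar>A i j * x j\<bar>)" unfolding mv_def by (rule sum_abs)
    also have "\<dots> \<le> (\<Sum>j<d. \<bar>A i j\<bar> * nrm d x)"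
    proof (rule sum_mono)
      fix j assume "j \<in> {..<d}"
      then have "\<bar>x j\<bar> \<le> nrm d (\<lambda>j. \<bar>x j\<bar>)" by (intro member_le_L2_set) auto
      then show "\<bar>A i j * x j\<bar> \<le> \<bar>A i j\<bar> * nrm d x"
        by (simp add: abs_mult mult_left_mono L2_set_def)
    qed
    finally show "\<bar>mv d A x i\<bar> \<le> (\<Sum>j<d. \<bar>A i j\<bar> * nrm d x)" .
  qed
  also have "\<dots> = (\<Sum>i<d. \<Sum>j<d. \<bar>A i j\<bar>) * nrm d x" by (simp add: sum_distrib_right)
  finally show "nrm d (mv d A x) \<le> (\<Sum>i<d. \<Sum>j<d. \<bar>A i j\<bar>) * nrm d x" .
qed

text \<open>Testing positivity at \<open>x - A x / \<kappa>\<close> replaces the Cauchy--Schwarz inequality for \<open>A\<close>.\<close>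

lemma op_bound_psd:
  assumes s: "sym_entries d A" and k: "0 < \<kappa>"
    and psd: "\<And>x. 0 \<le> ip d x (mv d A x)" and le: "\<And>x. ip d x (mv d A x) \<le> \<kappa> * (nrm d x)\<^sup>2"
  shows "op_bound d A \<kappa>"
  unfolding op_bound_def
proof
  fix x
  define z where "z = mv d A x"
  define q where "q u = ip d u (mv d A u)" for u
  have xz: "ip d x (mv d A z) = (nrm d z)\<^sup>2"
    using ip_mv_sym[OF s, of x z] by (simp add: z_def ip_nrm)
  have "0 \<le> q (\<lambda>i. x i + (- 1 / \<kappa>) * z i)" unfolding q_def by (rule psd)
  also have "\<dots> = q x - (2 / \<kappa>) * (nrm d z)\<^sup>2 + (1 / \<kappa>)\<^sup>2 * q z"
    unfolding q_def mv_add_vec mv_scale_vec ip_add_left ip_add_right ip_scale_left ip_scale_right xz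
    by (simp add: z_def[symmetric] ip_nrm power2_eq_square field_simps)
  also have "\<dots> \<le> \<kappa> * (nrm d x)\<^sup>2 - (2 / \<kappa>) * (nrm d z)\<^sup>2 + (1 / \<kappa>)\<^sup>2 * (\<kappa> * (nrm d z)\<^sup>2)"
    unfolding q_def using k by (intro add_mono diff_mono le mult_left_mono) auto
  also have "\<dots> = \<kappa> * (nrm d x)\<^sup>2 - (nrm d z)\<^sup>2 / \<kappa>"
    using k by (simp add: field_simps power2_eq_square)
  finally have "(nrm d z)\<^sup>2 \<le> (\<kappa> * nrm d x)\<^sup>2"
    using k by (simp add: field_simps power2_eq_square)
  then show "nrm d (mv d A x) \<le> \<kappa> * nrm d x"
    unfolding z_def using k by (meson L2_set_nonneg less_imp_le mult_nonneg_nonneg power2_le_imp_le)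
qed

subsection \<open>Square roots of positive semi-definite matrices\<close>

text \<open>The limit \<open>Y\<close> satisfies \<open>2 Y = C + Y\<^sup>2\<close>, so \<open>I - Y\<close> is a square root of \<open>I - C\<close>.\<close>

primrec sqrt_iter :: "nat \<Rightarrow> (nat \<Rightarrow> nat \<Rightarrow> real) \<Rightarrow> nat \<Rightarrow> nat \<Rightarrow> nat \<Rightarrow> real" where
  "sqrt_iter d C 0 = (\<lambda>i j. 0)"
| "sqrt_iter d C (Suc k) =
     (\<lambda>i j. (1/2) * (C i j + (\<Sum>l<d. sqrt_iter d C k i l * sqrt_iter d C k l j)))"

text \<open>The same iteration run on the scalar 1. It dominates the matrix iterates, and its
  increments dominate theirs, so its bounded monotone growth forces the matrices to
  converge.\<close>

primrec sqrt_iter_bound :: "nat \<Rightarrow> real" where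
  "sqrt_iter_bound 0 = 0"
| "sqrt_iter_bound (Suc k) = (1 + (sqrt_iter_bound k)\<^sup>2) / 2"

lemma sqrt_iter_bound_range: "0 \<le> sqrt_iter_bound k \<and> sqrt_iter_bound k \<le> 1"
  by (induction k) (auto simp: power_le_one)

lemma sqrt_iter_bound_mono: "sqrt_iter_bound k \<le> sqrt_iter_bound (Suc k)"
proof -
  have "0 \<le> (sqrt_iter_bound k - 1)\<^sup>2" by simp
  then show ?thesis by (simp add: power2_eq_square algebra_simps)
qed

lemma sqrt_iter_sym: "sym_entries d C \<Longrightarrow> sym_entries d (sqrt_iter d C k)"
proof (induction k)
  case (Suc k)
  then show ?case by (auto simp: sym_entries_def mult.commute intro!: sum.cong)
qed (simp add: sym_entries_def)

lemma sqrt_iter_op_bound: "op_bound d C 1 \<Longrightarrow> op_bound d (sqrt_iter d C k) (sqrt_iter_bound k)"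
proof (induction k)
  case (Suc k)
  have "op_bound d (sqrt_iter d C (Suc k)) (\<bar>1/2\<bar> * (1 + sqrt_iter_bound k * sqrt_iter_bound k))"
    unfolding sqrt_iter.simps
    using Suc sqrt_iter_bound_range[of k] by (intro op_bound_scale op_bound_add op_bound_mult) auto
  then show ?case by (simp add: power2_eq_square)
next
  case 0
  show ?case by (simp add: op_bound_def mv_def L2_set_def)
qed

text \<open>The splitting \<open>Y'Y' - YY = Y'(Y' - Y) + (Y' - Y)Y\<close> needs no commutativity,
  and the scalar bounds satisfy the same identity, so the estimate reproduces itself
  exactly.\<close>

lemma sqrt_iter_diff:
  assumes "op_bound d C 1"
  shows "op_bound d (\<lambda>i j. sqrt_iter d C (Suc k) i j - sqrt_iter d C k i j)
           (sqrt_iter_bound (Suc k) - sqrt_iter_bound k)"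
proof (induction k)
  case 0
  show ?case using op_bound_scale[OF assms, of "1/2"] by simp
next
  case (Suc k)
  let ?Y = "sqrt_iter d C" and ?y = sqrt_iter_bound
  let ?D = "\<lambda>i j. ?Y (Suc k) i j - ?Y k i j"
  note Yb = sqrt_iter_op_bound[OF assms]
  have y: "0 \<le> ?y (Suc k)" "0 \<le> ?y (Suc k) - ?y k"
    using sqrt_iter_bound_range sqrt_iter_bound_mono[of k] by auto
  have "op_bound d (\<lambda>i j. (1/2) * ((\<Sum>l<d. ?Y (Suc k) i l * ?D l j) + (\<Sum>l<d. ?D i l * ?Y k l j)))
          (\<bar>1/2\<bar> * (?y (Suc k) * (?y (Suc k) - ?y k) + (?y (Suc k) - ?y k) * ?y k))"
    by (intro op_bound_scale op_bound_add op_bound_mult Yb Suc y)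
  moreover have "(1/2) * ((\<Sum>l<d. ?Y (Suc k) i l * ?D l j) + (\<Sum>l<d. ?D i l * ?Y k l j))
      = ?Y (Suc (Suc k)) i j - ?Y (Suc k) i j" for i j
  proof -
    have "(\<Sum>l<d. ?Y (Suc k) i l * ?D l j) + (\<Sum>l<d. ?D i l * ?Y k l j)
      = (\<Sum>l<d. ?Y (Suc k) i l * ?Y (Suc k) l j) - (\<Sum>l<d. ?Y k i l * ?Y k l j)"
      by (simp only: sum.distrib[symmetric] sum_subtractf[symmetric])
         (intro sum.cong refl, simp only: algebra_simps)
    moreover have "?Y (Suc (Suc k)) i j = (1/2) * (C i j + (\<Sum>l<d. ?Y (Suc k) i l * ?Y (Suc k) l j))"
      "?Y (Suc k) i j = (1/2) * (C i j + (\<Sum>l<d. ?Y k i l * ?Y k l j))"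
      by (rule sqrt_iter.simps(2)[THEN fun_cong, THEN fun_cong])+
    ultimately show ?thesis by (simp only: algebra_simps)
  qed
  moreover have "\<bar>1/2\<bar> * (?y (Suc k) * (?y (Suc k) - ?y k) + (?y (Suc k) - ?y k) * ?y k)
      = ?y (Suc (Suc k)) - ?y (Suc k)"
  proof -
    have "\<bar>1/2\<bar> * (b * (b - c) + (b - c) * c) = a - b" if "a = (1 + b\<^sup>2) / 2" "b = (1 + c\<^sup>2) / 2" for a b c :: real
    proof -
      have "b * (b - c) + (b - c) * c = b\<^sup>2 - c\<^sup>2" by (simp add: power2_eq_square algebra_simps)
      moreover have "a - b = (b\<^sup>2 - c\<^sup>2) / 2"
        using arg_cong2[where f = "(-)", OF that] by (simp add: field_simps)
      ultimately show ?thesis by simp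
    qed
    from this[OF sqrt_iter_bound.simps(2) sqrt_iter_bound.simps(2)] show ?thesis .
  qed
  ultimately show ?case by (simp only:)
qed

text \<open>The scalar increments telescope and sum to at most 1, so every entry of the iterates
  converges by comparison. Symmetry and the fixed-point equation pass to the limit; the iterates
  have norm at most 1, which makes \<open>I - Y\<close> positive semi-definite.\<close>

lemma psd_sqrt_ex_unit:
  assumes s: "sym_entries d C" and b: "op_bound d C 1"
  obtains S where "sym_entries d S" "\<And>x. 0 \<le> ip d x (mv d S x)"
    "\<And>i j. i < d \<Longrightarrow> j < d \<Longrightarrow> (\<Sum>k<d. S i k * S k j) = (if i = j then 1 else 0) - C i j"
proof -
  let ?Y = "sqrt_iter d C" and ?y = sqrt_iter_bound
  have sy: "summable (\<lambda>k. ?y (Suc k) - ?y k)"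
  proof (rule summableI_nonneg_bounded)
    show "0 \<le> ?y (Suc k) - ?y k" for k using sqrt_iter_bound_mono[of k] by simp
    show "(\<Sum>k<n. ?y (Suc k) - ?y k) \<le> 1" for n
      by (subst sum_lessThan_telescope) (use sqrt_iter_bound_range[of n] in simp)
  qed
  have conv: "convergent (\<lambda>k. ?Y k i j)" if "i < d" "j < d" for i j
  proof -
    have "summable (\<lambda>k. ?Y (Suc k) i j - ?Y k i j)"
      by (rule summable_comparison_test'[OF sy, of 0])
         (use op_bound_entry[OF sqrt_iter_diff[OF b] that] in \<open>simp del: sqrt_iter.simps sqrt_iter_bound.simps\<close>)
    then have "convergent (\<lambda>n. \<Sum>k<n. ?Y (Suc k) i j - ?Y k i j)" by (simp add: summable_iff_convergent)
    moreover have "(\<Sum>k<n. ?Y (Suc k) i j - ?Y k i j) = ?Y n i j" for n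
      by (subst sum_lessThan_telescope) simp
    ultimately show ?thesis by simp
  qed
  define Y where "Y i j = lim (\<lambda>k. ?Y k i j)" for i j
  have lim: "(\<lambda>k. ?Y k i j) \<longlonglongrightarrow> Y i j" if "i < d" "j < d" for i j
    using conv[OF that] by (simp add: Y_def convergent_LIMSEQ_iff)
  have symY: "sym_entries d Y"
    using sqrt_iter_sym[OF s] unfolding sym_entries_def Y_def by simp
  have fix_pt: "Y i j = (1/2) * (C i j + (\<Sum>l<d. Y i l * Y l j))" if "i < d" "j < d" for i j
  proof (rule LIMSEQ_unique)
    show "(\<lambda>k. ?Y (Suc k) i j) \<longlonglongrightarrow> Y i j" using lim[OF that] by (rule LIMSEQ_Suc)
    show "(\<lambda>k. ?Y (Suc k) i j) \<longlonglongrightarrow> (1/2) * (C i j + (\<Sum>l<d. Y i l * Y l j))"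
      unfolding sqrt_iter.simps using that by (intro tendsto_intros lim) auto
  qed
  have ipY: "ip d x (mv d Y x) \<le> (nrm d x)\<^sup>2" for x
  proof (rule LIMSEQ_le_const2)
    show "(\<lambda>k. ip d x (mv d (?Y k) x)) \<longlonglongrightarrow> ip d x (mv d Y x)"
      unfolding ip_def mv_def by (intro tendsto_intros lim) auto
    have "ip d x (mv d (?Y k) x) \<le> (nrm d x)\<^sup>2" for k
    proof -
      have "ip d x (mv d (?Y k) x) \<le> nrm d x * nrm d (mv d (?Y k) x)" using ip_le_nrm by (meson abs_le_D1)
      also have "\<dots> \<le> nrm d x * (?y k * nrm d x)"
        using sqrt_iter_op_bound[OF b, of k] by (intro mult_left_mono) (auto simp: op_bound_def)
      also have "\<dots> \<le> nrm d x * (1 * nrm d x)"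
        using sqrt_iter_bound_range[of k] by (intro mult_left_mono mult_right_mono) auto
      finally show ?thesis by (simp add: power2_eq_square)
    qed
    then show "\<exists>N. \<forall>n\<ge>N. ip d x (mv d (?Y n) x) \<le> (nrm d x)\<^sup>2" by blast
  qed
  define E where "E i j = (if i = j then 1 else 0 :: real)" for i j :: nat
  define S where "S i j = E i j + (- 1) * Y i j" for i j
  have mvE: "ip d x (mv d E x) = (nrm d x)\<^sup>2" for x
    unfolding E_def by (rule ip_mv_ident)
  show ?thesis
  proof
    show "sym_entries d S" using symY by (auto simp: S_def E_def sym_entries_def)
    show "0 \<le> ip d x (mv d S x)" for x
    proof -
      have "ip d x (mv d S x) = ip d x (mv d E x) - ip d x (mv d Y x)"
        unfolding S_def mv_add mv_scale ip_add_right ip_scale_right by simp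
      then show ?thesis using ipY[of x] mvE[of x] by simp
    qed
    fix i j assume ij: "i < d" "j < d"
    have "(\<Sum>k<d. S i k * S k j)
        = (\<Sum>k<d. E i k * E k j) - (\<Sum>k<d. E i k * Y k j) - (\<Sum>k<d. Y i k * E k j) + (\<Sum>k<d. Y i k * Y k j)"
      by (simp add: S_def sum.distrib sum_subtractf algebra_simps sum_negf)
    also have "\<dots> = E i j - 2 * Y i j + (\<Sum>k<d. Y i k * Y k j)"
    proof -
      have "(\<Sum>k<d. E i k * f k) = f i" for f
        using ij by (simp add: E_def if_distrib[of "\<lambda>c. c * _"] cong: if_cong)
      moreover have "(\<Sum>k<d. f k * E k j) = f j" for f
        using ij by (simp add: E_def if_distrib[of "\<lambda>c. _ * c"] cong: if_cong)
      ultimately show ?thesis by simp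
    qed
    also have "\<dots> = E i j - C i j" using fix_pt[OF ij] by simp
    finally show "(\<Sum>k<d. S i k * S k j) = (if i = j then 1 else 0) - C i j" by (simp add: E_def)
  qed
qed

text \<open>Rescaling: if \<open>A\<close> is at most \<open>\<kappa>\<close> times the identity,
  then \<open>C = I - A / \<kappa>\<close> lies between 0 and the identity and has norm at most 1,
  and \<open>sqrt \<kappa>\<close> times a root of \<open>I - C\<close> is a root of
  \<open>A\<close>.\<close>

lemma psd_sqrt_ex:
  assumes s: "sym_entries d A" and psd: "\<And>x. 0 \<le> ip d x (mv d A x)"
  obtains S where "sym_entries d S" "\<And>x. 0 \<le> ip d x (mv d S x)"
    "\<And>i j. i < d \<Longrightarrow> j < d \<Longrightarrow> (\<Sum>k<d. S i k * S k j) = A i j"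
proof -
  \<comment> \<open>The summand 1 keeps \<open>\<kappa>\<close> positive even for the zero
    matrix.\<close>
  define \<kappa> where "\<kappa> = (\<Sum>i<d. \<Sum>j<d. \<bar>A i j\<bar>) + 1"
  have k: "0 < \<kappa>" unfolding \<kappa>_def by (smt (verit) sum_nonneg abs_ge_zero)
  have le: "ip d x (mv d A x) \<le> \<kappa> * (nrm d x)\<^sup>2" for x
  proof -
    have "ip d x (mv d A x) \<le> nrm d x * nrm d (mv d A x)" using ip_le_nrm by (meson abs_le_D1)
    also have "\<dots> \<le> nrm d x * (\<kappa> * nrm d x)"
    proof (rule mult_left_mono)
      have "nrm d (mv d A x) \<le> (\<Sum>i<d. \<Sum>j<d. \<bar>A i j\<bar>) * nrm d x"
        using op_bound_sum_entries[of d A] by (simp add: op_bound_def)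
      then show "nrm d (mv d A x) \<le> \<kappa> * nrm d x" by (simp add: \<kappa>_def algebra_simps add_increasing)
    qed simp
    finally show ?thesis by (simp add: power2_eq_square algebra_simps)
  qed
  define E where "E i j = (if i = j then 1 else 0 :: real)" for i j :: nat
  define C where "C i j = E i j + (- 1 / \<kappa>) * A i j" for i j
  have mvE: "ip d x (mv d E x) = (nrm d x)\<^sup>2" for x
    unfolding E_def by (rule ip_mv_ident)
  have ipC: "ip d x (mv d C x) = (nrm d x)\<^sup>2 - ip d x (mv d A x) / \<kappa>" for x
    unfolding C_def mv_add mv_scale ip_add_right ip_scale_right mvE by simp
  have symC: "sym_entries d C" using s by (auto simp: C_def E_def sym_entries_def)
  have "op_bound d C 1"
  proof (rule op_bound_psd[OF symC])
    show "0 \<le> ip d x (mv d C x)" for x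
      using le[of x] k unfolding ipC by (simp add: field_simps)
    show "ip d x (mv d C x) \<le> 1 * (nrm d x)\<^sup>2" for x
      using psd[of x] k unfolding ipC by (simp add: field_simps)
  qed simp
  from psd_sqrt_ex_unit[OF symC this] obtain T where T: "sym_entries d T" "\<And>x. 0 \<le> ip d x (mv d T x)"
    "\<And>i j. i < d \<Longrightarrow> j < d \<Longrightarrow> (\<Sum>k<d. T i k * T k j) = (if i = j then 1 else 0) - C i j"
    by blast
  show ?thesis
  proof
    show "sym_entries d (\<lambda>i j. sqrt \<kappa> * T i j)" using T(1) by (simp add: sym_entries_def)
    show "0 \<le> ip d x (mv d (\<lambda>i j. sqrt \<kappa> * T i j) x)" for x
      unfolding mv_scale ip_scale_right using T(2) k by simp
    fix i j assume ij: "i < d" "j < d"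
    have "(\<Sum>k<d. (sqrt \<kappa> * T i k) * (sqrt \<kappa> * T k j)) = \<kappa> * (\<Sum>k<d. T i k * T k j)"
      using k by (simp add: sum_distrib_left algebra_simps) (simp add: mult.assoc[symmetric])
    also have "\<dots> = A i j" using T(3)[OF ij] k by (simp add: C_def E_def)
    finally show "(\<Sum>k<d. (sqrt \<kappa> * T i k) * (sqrt \<kappa> * T k j)) = A i j" .
  qed
qed

subsection \<open>The operator norm\<close>

lemma sqrt_scalar_prod_self:
  "x \<in> carrier_vec d \<Longrightarrow> sqrt (scalar_prod x x) = nrm d (\<lambda>i. x $ i)"
  by (auto simp: scalar_prod_def L2_set_def power2_eq_square atLeast0LessThan)

lemma mult_mat_vec_entries:
  "A \<in> carrier_mat d d \<Longrightarrow> x \<in> carrier_vec d \<Longrightarrow> i < d \<Longrightarrow> (A *\<^sub>v x) $ i = mv d (entries A) (\<lambda>i. x $ i) i"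
  by (auto simp: mv_def scalar_prod_def atLeast0LessThan intro!: sum.cong)

lemma sqrt_scalar_prod_mult_mat_vec:
  assumes "A \<in> carrier_mat d d" "x \<in> carrier_vec d"
  shows "sqrt (scalar_prod (A *\<^sub>v x) (A *\<^sub>v x)) = nrm d (mv d (entries A) (\<lambda>i. x $ i))"
proof -
  have "A *\<^sub>v x \<in> carrier_vec d" using assms by simp
  then have "sqrt (scalar_prod (A *\<^sub>v x) (A *\<^sub>v x)) = nrm d (\<lambda>i. (A *\<^sub>v x) $ i)"
    by (rule sqrt_scalar_prod_self)
  also have "\<dots> = nrm d (mv d (entries A) (\<lambda>i. x $ i))"
    by (rule L2_set_cong) (use mult_mat_vec_entries[OF assms] in auto)
  finally show ?thesis .
qed

lemma op_norm_le:
  assumes A: "A \<in> carrier_mat d d" and b: "op_bound d (entries A) a" and a: "0 \<le> a"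
  shows "op_norm A \<le> a"
  unfolding op_norm_def
proof (rule cSUP_least)
  have "0\<^sub>v d \<in> carrier_vec d" by simp
  then show "{x \<in> carrier_vec (dim_col A). sqrt (scalar_prod x x) \<le> 1} \<noteq> {}"
    using A by (auto intro!: exI[of _ "0\<^sub>v d"])
next
  fix x assume "x \<in> {x \<in> carrier_vec (dim_col A). sqrt (scalar_prod x x) \<le> 1}"
  then have x: "x \<in> carrier_vec d" "nrm d (\<lambda>i. x $ i) \<le> 1"
    using A sqrt_scalar_prod_self[of x d] by (auto simp del: real_sqrt_le_1_iff)
  have "nrm d (mv d (entries A) (\<lambda>i. x $ i)) \<le> a * nrm d (\<lambda>i. x $ i)"
    using b by (simp add: op_bound_def)
  also have "\<dots> \<le> a" using x a by (simp add: mult_left_le)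
  finally show "sqrt (scalar_prod (A *\<^sub>v x) (A *\<^sub>v x)) \<le> a"
    using sqrt_scalar_prod_mult_mat_vec[OF A x(1)] by simp
qed

text \<open>A real supremum is an upper bound only once the set is known to be bounded; the sum of
  the absolute entries provides the bound.\<close>

lemma nrm_mv_le_op_norm:
  assumes A: "A \<in> carrier_mat d d" and x: "nrm d x \<le> 1"
  shows "nrm d (mv d (entries A) x) \<le> op_norm A"
proof -
  let ?K = "\<Sum>i<d. \<Sum>j<d. \<bar>A $$ (i, j)\<bar>"
  let ?S = "{x \<in> carrier_vec (dim_col A). sqrt (scalar_prod x x) \<le> 1}"
  have K: "nrm d (mv d (entries A) x) \<le> ?K" if "nrm d x \<le> 1" for x
  proof -
    have "nrm d (mv d (entries A) x) \<le> ?K * nrm d x"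
      using op_bound_sum_entries[of d "entries A"] by (simp add: op_bound_def)
    also have "\<dots> \<le> ?K" using that by (intro mult_left_le) (auto intro!: sum_nonneg)
    finally show ?thesis .
  qed
  have bdd: "bdd_above ((\<lambda>x. sqrt (scalar_prod (A *\<^sub>v x) (A *\<^sub>v x))) ` ?S)"
  proof (rule bdd_aboveI2)
    fix x assume "x \<in> ?S"
    then have x: "x \<in> carrier_vec d" "nrm d (\<lambda>i. x $ i) \<le> 1"
      using A sqrt_scalar_prod_self[of x d] by (auto simp del: real_sqrt_le_1_iff)
    show "sqrt (scalar_prod (A *\<^sub>v x) (A *\<^sub>v x)) \<le> ?K"
      using K[OF x(2)] sqrt_scalar_prod_mult_mat_vec[OF A x(1)] by simp
  qed
  define v where "v = vec d x"
  have v: "v \<in> carrier_vec d" by (simp add: v_def)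
  have eq: "nrm d (\<lambda>i. v $ i) = nrm d x" by (rule L2_set_cong) (auto simp: v_def)
  have "mv d (entries A) (\<lambda>i. v $ i) = mv d (entries A) x" by (rule ext) (simp add: mv_def v_def)
  then have "nrm d (mv d (entries A) x) = sqrt (scalar_prod (A *\<^sub>v v) (A *\<^sub>v v))"
    using sqrt_scalar_prod_mult_mat_vec[OF A v] by simp
  also have "\<dots> \<le> op_norm A" unfolding op_norm_def
    by (rule cSUP_upper[OF _ bdd]) (use v eq x A sqrt_scalar_prod_self[OF v] in \<open>auto simp del: real_sqrt_le_1_iff\<close>)
  finally show ?thesis .
qed

lemma op_norm_nonneg: "A \<in> carrier_mat d d \<Longrightarrow> 0 \<le> op_norm A"
  by (rule order.trans[OF L2_set_nonneg nrm_mv_le_op_norm[of A d "\<lambda>_. 0"]]) (simp_all add: L2_set_def)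

lemma op_bound_op_norm:
  assumes A: "A \<in> carrier_mat d d"
  shows "op_bound d (entries A) (op_norm A)"
  unfolding op_bound_def
proof
  fix x
  show "nrm d (mv d (entries A) x) \<le> op_norm A * nrm d x"
  proof (cases "nrm d x = 0")
    case True
    then have "mv d (entries A) x = (\<lambda>_. 0)" by (simp add: L2_set_eq_0_iff mv_def fun_eq_iff)
    then show ?thesis using True by (simp add: L2_set_def)
  next
    case False
    then have p: "0 < nrm d x" by (simp add: less_le)
    have "nrm d (mv d (entries A) (\<lambda>i. (1 / nrm d x) * x i)) \<le> op_norm A"
      by (rule nrm_mv_le_op_norm[OF A]) (subst nrm_scale, use p in simp)
    then show ?thesis unfolding mv_scale_vec nrm_scale using p by (simp add: field_simps)
  qed
qed

lemma op_bound_mono: "op_bound d A a \<Longrightarrow> a \<le> b \<Longrightarrow> op_bound d A b"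
  unfolding op_bound_def by (meson L2_set_nonneg mult_right_mono order.trans)

lemma op_loss_triangle:
  assumes "A \<in> carrier_mat d d" "B \<in> carrier_mat d d" "C \<in> carrier_mat d d"
  shows "op_loss A C \<le> op_loss A B + op_loss B C"
  unfolding op_loss_def
proof (rule op_norm_le)
  show "A - C \<in> carrier_mat d d" using assms by (intro minus_carrier_mat)
  have "op_bound d (\<lambda>i j. entries (A - B) i j + entries (B - C) i j) (op_norm (A - B) + op_norm (B - C))"
    using assms by (intro op_bound_add op_bound_op_norm minus_carrier_mat)
  then show "op_bound d (entries (A - C)) (op_norm (A - B) + op_norm (B - C))"
    by (subst op_bound_cong[where B = "\<lambda>i j. entries (A - B) i j + entries (B - C) i j"]) (use assms in auto)
  show "0 \<le> op_norm (A - B) + op_norm (B - C)" using assms by (intro add_nonneg_nonneg op_norm_nonneg[of _ d] minus_carrier_mat)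
qed

lemma op_loss_commute:
  assumes "A \<in> carrier_mat d d" "B \<in> carrier_mat d d"
  shows "op_loss A B = op_loss B A"
proof -
  have *: "op_loss A B \<le> op_loss B A" if "A \<in> carrier_mat d d" "B \<in> carrier_mat d d" for A B
    unfolding op_loss_def
  proof (rule op_norm_le)
    have "op_bound d (\<lambda>i j. (- 1) * entries (B - A) i j) (\<bar>- 1\<bar> * op_norm (B - A))"
      using that by (intro op_bound_scale op_bound_op_norm minus_carrier_mat)
    then show "op_bound d (entries (A - B)) (op_norm (B - A))"
      by (subst op_bound_cong[where B = "\<lambda>i j. (- 1) * entries (B - A) i j"]) (use that in auto)
  qed (use that in \<open>auto intro: op_norm_nonneg minus_carrier_mat\<close>)
  show ?thesis using *[OF assms] *[OF assms(2,1)] by simp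
qed

lemma op_loss_entry:
  assumes "A \<in> carrier_mat d d" "B \<in> carrier_mat d d" "i < d" "j < d"
  shows "\<bar>A $$ (i, j) - B $$ (i, j)\<bar> \<le> op_loss A B"
  using op_bound_entry[OF op_bound_op_norm[OF minus_carrier_mat[OF assms(2)]], of i j A] assms by (simp add: op_loss_def)

lemma psd_mats_iff:
  "A \<in> psd_mats d \<longleftrightarrow> A \<in> carrier_mat d d \<and> sym_entries d (entries A) \<and> (\<forall>x. 0 \<le> ip d x (mv d (entries A) x))"
proof (cases "A \<in> carrier_mat d d")
  case A: True
  have 1: "transpose_mat A = A \<longleftrightarrow> sym_entries d (entries A)"
    using A by (auto simp: sym_entries_def mat_eq_iff)
  have 2: "scalar_prod x (A *\<^sub>v x) = ip d (\<lambda>i. x $ i) (mv d (entries A) (\<lambda>i. x $ i))"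
    if "x \<in> carrier_vec d" for x
    using A that mult_mat_vec_entries[OF A that]
    by (auto simp: scalar_prod_def[of _ "A *\<^sub>v x"] ip_def atLeast0LessThan intro!: sum.cong)
  have 3: "ip d (\<lambda>i. vec d x $ i) (mv d (entries A) (\<lambda>i. vec d x $ i)) = ip d x (mv d (entries A) x)" for x
    by (simp add: ip_def mv_def)
  show ?thesis unfolding psd_mats_def using A 1 2 3 by (auto) (metis vec_carrier)
qed (simp add: psd_mats_def)

text \<open>Existence of a root makes the choice in \<open>psd_sqrt\<close> meaningful. Symmetry and
  the squaring identity are what the computations with normal laws rest on.\<close>

lemma psd_sqrt:
  assumes "\<Sigma> \<in> psd_mats d"
  shows "sym_entries d (entries (psd_sqrt d \<Sigma>))"
    and "i < d \<Longrightarrow> j < d \<Longrightarrow> (\<Sum>k<d. psd_sqrt d \<Sigma> $$ (i, k) * psd_sqrt d \<Sigma> $$ (k, j)) = \<Sigma> $$ (i, j)"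
proof -
  have \<Sigma>: "\<Sigma> \<in> carrier_mat d d" "sym_entries d (entries \<Sigma>)" "\<And>x. 0 \<le> ip d x (mv d (entries \<Sigma>) x)"
    using assms by (auto simp: psd_mats_iff)
  obtain S where S: "sym_entries d S" "\<And>x. 0 \<le> ip d x (mv d S x)"
    "\<And>i j. i < d \<Longrightarrow> j < d \<Longrightarrow> (\<Sum>k<d. S i k * S k j) = \<Sigma> $$ (i, j)"
    using psd_sqrt_ex[OF \<Sigma>(2,3)] by blast
  define R where "R = mat d d (\<lambda>(i, j). S i j)"
  have "R \<in> psd_mats d"
    using S by (auto simp: psd_mats_iff R_def sym_entries_def ip_def mv_def)
  moreover have "R * R = \<Sigma>"
    using S \<Sigma>(1) by (intro eq_matI) (auto simp: R_def scalar_prod_def atLeast0LessThan)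
  ultimately have *: "psd_sqrt d \<Sigma> \<in> psd_mats d \<and> psd_sqrt d \<Sigma> * psd_sqrt d \<Sigma> = \<Sigma>"
    unfolding psd_sqrt_def by (intro someI[of "\<lambda>S. S \<in> psd_mats d \<and> S * S = \<Sigma>"]) auto
  then show "sym_entries d (entries (psd_sqrt d \<Sigma>))" by (simp add: psd_mats_iff)
  assume ij: "i < d" "j < d"
  have c: "psd_sqrt d \<Sigma> \<in> carrier_mat d d" using * by (simp add: psd_mats_iff)
  have "\<Sigma> $$ (i, j) = (psd_sqrt d \<Sigma> * psd_sqrt d \<Sigma>) $$ (i, j)" using * by simp
  also have "\<dots> = (\<Sum>k<d. psd_sqrt d \<Sigma> $$ (i, k) * psd_sqrt d \<Sigma> $$ (k, j))"
    using c ij by (auto simp: scalar_prod_def atLeast0LessThan)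
  finally show "(\<Sum>k<d. psd_sqrt d \<Sigma> $$ (i, k) * psd_sqrt d \<Sigma> $$ (k, j)) = \<Sigma> $$ (i, j)" ..
qed

section \<open>Product measures under coordinatewise densities and maps\<close>

abbreviation borel_vec :: "nat \<Rightarrow> (nat \<Rightarrow> real) measure" where
  "borel_vec d \<equiv> PiM {..<d} (\<lambda>_. borel)"

abbreviation borel_sample :: "nat \<Rightarrow> nat \<Rightarrow> (nat \<Rightarrow> nat \<Rightarrow> real) measure" where
  "borel_sample n d \<equiv> PiM {..<n} (\<lambda>_. borel_vec d)"

abbreviation normal_sample :: "nat \<Rightarrow> nat \<Rightarrow> real mat \<Rightarrow> (nat \<Rightarrow> nat \<Rightarrow> real) measure" where
  "normal_sample n d \<Sigma> \<equiv> PiM {..<n} (\<lambda>_. centred_normal d \<Sigma>)"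

text \<open>On boxes the density, the indicator and hence the integral factor over the coordinates,
  and boxes determine a finite product. It serves the shift and the reflection of Gaussian vectors
  as well as the passage from one observation to a sample.\<close>

lemma PiM_transform:
  assumes I: "finite I" and M: "product_sigma_finite M" and M': "product_sigma_finite M'"
    and h: "\<And>i. i \<in> I \<Longrightarrow> h i \<in> borel_measurable (M i)"
    and f: "\<And>i. i \<in> I \<Longrightarrow> f i \<in> measurable (M i) (M' i)"
    and eq: "\<And>i. i \<in> I \<Longrightarrow> distr (density (M i) (h i)) (M' i) (f i) = M' i"
  shows "distr (density (PiM I M) (\<lambda>x. \<Prod>i\<in>I. h i (x i))) (PiM I M') (\<lambda>x. \<lambda>i\<in>I. f i (x i)) = PiM I M'"
proof (rule product_sigma_finite.PiM_eqI[OF M' I])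
  show "sets (distr (density (PiM I M) (\<lambda>x. \<Prod>i\<in>I. h i (x i))) (PiM I M') (\<lambda>x. \<lambda>i\<in>I. f i (x i))) = sets (PiM I M')"
    by simp
  fix A assume A: "\<And>i. i \<in> I \<Longrightarrow> A i \<in> sets (M' i)"
  note [measurable] = h f A
  let ?F = "\<lambda>x. \<lambda>i\<in>I. f i (x i)" and ?H = "\<lambda>x. \<Prod>i\<in>I. h i (x i)"
  have F[measurable]: "?F \<in> measurable (PiM I M) (PiM I M')"
    by (rule measurable_restrict) measurable
  have H[measurable]: "?H \<in> borel_measurable (PiM I M)"
    by (rule borel_measurable_prod_ennreal) measurable
  have PA[measurable]: "Pi\<^sub>E I A \<in> sets (PiM I M')" using I A by (intro sets_PiM_I_finite) auto
  have "emeasure (distr (density (PiM I M) ?H) (PiM I M') ?F) (Pi\<^sub>E I A)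
      = (\<integral>\<^sup>+ x. indicator (Pi\<^sub>E I A) (?F x) * ?H x \<partial>PiM I M)"
    by (simp add: emeasure_distr emeasure_density)
       (auto intro!: nn_integral_cong simp: indicator_def)
  also have "\<dots> = (\<integral>\<^sup>+ x. (\<Prod>i\<in>I. h i (x i) * indicator (A i) (f i (x i))) \<partial>PiM I M)"
  proof (rule nn_integral_cong)
    fix x assume x: "x \<in> space (PiM I M)"
    have "indicator (Pi\<^sub>E I A) (?F x) = (\<Prod>i\<in>I. indicator (A i) (f i (x i)) :: ennreal)"
    proof (cases "\<forall>i\<in>I. f i (x i) \<in> A i")
      case True then show ?thesis by (simp add: PiE_iff)
    next
      case False
      then obtain i where i: "i \<in> I" "f i (x i) \<notin> A i" by auto
      then have "(\<Prod>i\<in>I. indicator (A i) (f i (x i)) :: ennreal) = 0"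
        using I by (intro prod_zero bexI[of _ i]) auto
      moreover have "?F x \<notin> Pi\<^sub>E I A" using i by (auto simp: PiE_iff)
      ultimately show ?thesis by simp
    qed
    then show "indicator (Pi\<^sub>E I A) (?F x) * ?H x = (\<Prod>i\<in>I. h i (x i) * indicator (A i) (f i (x i)))"
      by (simp add: prod.distrib mult.commute)
  qed
  also have "\<dots> = (\<Prod>i\<in>I. \<integral>\<^sup>+ x. h i x * indicator (A i) (f i x) \<partial>M i)"
    by (rule product_sigma_finite.product_nn_integral_prod[OF M I]) measurable
  also have "\<dots> = (\<Prod>i\<in>I. emeasure (M' i) (A i))"
  proof (rule prod.cong[OF refl])
    fix i assume i: "i \<in> I"
    note [measurable] = h[OF i] f[OF i] A[OF i]
    have "emeasure (M' i) (A i) = emeasure (distr (density (M i) (h i)) (M' i) (f i)) (A i)"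
      using eq[OF i] by simp
    also have "\<dots> = (\<integral>\<^sup>+ x. h i x * indicator (A i) (f i x) \<partial>M i)"
      by (simp add: emeasure_distr emeasure_density)
         (auto intro!: nn_integral_cong simp: indicator_def)
    finally show "(\<integral>\<^sup>+ x. h i x * indicator (A i) (f i x) \<partial>M i) = emeasure (M' i) (A i)" ..
  qed
  finally show "emeasure (distr (density (PiM I M) ?H) (PiM I M') ?F) (Pi\<^sub>E I A) = (\<Prod>i\<in>I. emeasure (M' i) (A i))" .
qed

subsection \<open>Laws determined by one-dimensional projections\<close>

text \<open>After division by its total mass \<open>m\<close> the weighted law of \<open>X\<close>
  is a probability law, to which Levy's uniqueness theorem applies. The case \<open>t = 0\<close>,
  \<open>\<phi> = 0\<close> of the hypothesis shows that \<open>m\<close> is the same under both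
  measures; if \<open>m = 0\<close>, both sides vanish.\<close>

lemma weighted_law_unique:
  fixes w X :: "'a \<Rightarrow> real"
  assumes P: "prob_space P" and Q: "prob_space Q" and sets: "sets Q = sets P"
    and w: "w \<in> borel_measurable P" and X: "X \<in> borel_measurable P"
    and w0: "\<And>x. 0 \<le> w x" and wK: "\<And>x. w x \<le> K"
    and eq: "\<And>t \<phi>. (\<integral>x. w x * cos (t * X x + \<phi>) \<partial>P) = (\<integral>x. w x * cos (t * X x + \<phi>) \<partial>Q)"
    and B: "B \<in> sets borel"
  shows "(\<integral>x. w x * indicator B (X x) \<partial>P) = (\<integral>x. w x * indicator B (X x) \<partial>Q)"
proof -
  define m where "m = (\<integral>x. w x \<partial>P)"
  have mQ: "m = (\<integral>x. w x \<partial>Q)" using eq[of 0 0] by (simp add: m_def)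
  define law where "law R = distr (density R (\<lambda>x. ennreal (w x / m))) borel X" for R :: "'a measure"
  have int: "integrable R (\<lambda>x. w x *\<^sub>R g x)"
    if "prob_space R" "sets R = sets P" "g \<in> borel_measurable R" "\<And>x. norm (g x) \<le> 1"
    for R and g :: "'a \<Rightarrow> 'b :: {banach, second_countable_topology}"
  proof -
    interpret prob_space R by fact
    have [measurable]: "w \<in> borel_measurable R" using w that(2) measurable_cong_sets by blast
    note [measurable] = that(3)
    have "norm (w x *\<^sub>R g x) \<le> K" for x
      using mult_mono[OF wK[of x] that(4)[of x]] w0[of x] wK[of x] by (simp add: order.trans[OF w0 wK])
    then show ?thesis by (intro integrable_const_bound[where B = K]) auto
  qed
  \<comment> \<open>The phases 0 and \<open>- pi / 2\<close> turn the cosine into cosine and sine,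
    the real and imaginary parts of the characteristic function.\<close>
  have main: "real_distribution (law R) \<and>
      (\<forall>t. char (law R) t = Complex ((\<integral>x. w x * cos (t * X x + 0) \<partial>R) / m) ((\<integral>x. w x * cos (t * X x + - pi / 2) \<partial>R) / m))
      \<and> measure (law R) B = (\<integral>x. w x * indicator B (X x) \<partial>R) / m"
    if R: "prob_space R" "sets R = sets P" and mR: "m = (\<integral>x. w x \<partial>R)" and m: "0 < m" for R
  proof -
    interpret prob_space R by fact
    have [measurable]: "w \<in> borel_measurable R" "X \<in> borel_measurable R"
      using w X R(2) measurable_cong_sets by blast+
    have iw: "integrable R w" using int[OF R, of "\<lambda>_. 1 :: real"] by simp
    have "emeasure (density R (\<lambda>x. ennreal (w x / m))) (space R) = (\<integral>\<^sup>+x. ennreal (w x / m) \<partial>R)"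
      by (subst emeasure_density) (auto intro!: nn_integral_cong)
    also have "\<dots> = ennreal (\<integral>x. w x / m \<partial>R)"
      by (rule nn_integral_eq_integral) (use iw w0 m in auto)
    also have "\<dots> = 1" using mR m by simp
    finally have "prob_space (density R (\<lambda>x. ennreal (w x / m)))" by (intro prob_spaceI) simp
    then interpret D: prob_space "density R (\<lambda>x. ennreal (w x / m))" .
    have 1: "real_distribution (law R)"
      unfolding law_def real_distribution_def real_distribution_axioms_def
      by (auto intro!: D.prob_space_distr)
    have 2: "(\<integral>y. g y \<partial>law R) = (\<integral>x. (w x / m) *\<^sub>R g (X x) \<partial>R)"
      if [measurable]: "g \<in> borel_measurable borel" for g :: "real \<Rightarrow> 'b :: {banach, second_countable_topology}"
      unfolding law_def using w0 m
      by (subst integral_distr) (auto simp: integral_density)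
    have 3: "char (law R) t = Complex ((\<integral>x. w x * cos (t * X x + 0) \<partial>R) / m) ((\<integral>x. w x * cos (t * X x + - pi / 2) \<partial>R) / m)" for t
    proof -
      have i: "integrable R (\<lambda>x. w x *\<^sub>R iexp (t * X x))" by (rule int[OF R]) auto
      have "char (law R) t = (\<integral>x. (w x / m) *\<^sub>R iexp (t * X x) \<partial>R)"
        unfolding char_def by (rule 2) simp
      also have "\<dots> = (\<integral>x. (1 / m) *\<^sub>R (w x *\<^sub>R iexp (t * X x)) \<partial>R)" by (simp add: divide_inverse mult.commute)
      also have "\<dots> = (1 / m) *\<^sub>R (\<integral>x. w x *\<^sub>R iexp (t * X x) \<partial>R)" by (rule integral_scaleR_right)
      finally have c: "char (law R) t = (1 / m) *\<^sub>R (\<integral>x. w x *\<^sub>R iexp (t * X x) \<partial>R)" .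
      have re: "Re (\<integral>x. w x *\<^sub>R iexp (t * X x) \<partial>R) = (\<integral>x. w x * cos (t * X x + 0) \<partial>R)"
        by (subst integral_Re[OF i, symmetric]) (simp add: Re_exp)
      have im: "Im (\<integral>x. w x *\<^sub>R iexp (t * X x) \<partial>R) = (\<integral>x. w x * cos (t * X x + - pi / 2) \<partial>R)"
        by (subst integral_Im[OF i, symmetric]) (simp add: Im_exp cos_diff)
      show ?thesis unfolding c using re im by (simp add: complex_eq_iff)
    qed
    have "measure (law R) B = (\<integral>y. indicator B y \<partial>law R)"
      using B by (simp add: law_def)
    also have "\<dots> = (\<integral>x. (w x / m) *\<^sub>R indicator B (X x) \<partial>R)"
      by (rule 2) (use B in measurable)
    also have "\<dots> = (\<integral>x. (w x * indicator B (X x)) / m \<partial>R)" by simp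
    also have "\<dots> = (\<integral>x. w x * indicator B (X x) \<partial>R) / m" by simp
    finally show ?thesis using 1 3 by blast
  qed
  have "0 \<le> m" unfolding m_def using w0 by (intro integral_nonneg_AE) auto
  then consider "m = 0" | "0 < m" by linarith
  then show ?thesis
  proof cases
    case 1
    have "(\<integral>x. w x * indicator B (X x) \<partial>R) = 0"
      if R: "prob_space R" "sets R = sets P" and mR: "m = (\<integral>x. w x \<partial>R)" for R
    proof -
      have "AE x in R. w x = 0"
        using mR 1 w0 int[OF R, of "\<lambda>_. 1 :: real"] by (subst integral_nonneg_eq_0_iff_AE[symmetric]) auto
      then have "AE x in R. w x * indicator B (X x) = 0" by eventually_elim simp
      then show ?thesis by (rule integral_eq_zero_AE)
    qed
    then show ?thesis using P Q sets m_def mQ by simp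
  next
    case 2
    have "law P = law Q"
    proof (rule Levy_uniqueness)
      show "real_distribution (law P)" "real_distribution (law Q)"
        using main[OF P refl m_def 2] main[OF Q sets mQ 2] by auto
      show "char (law P) = char (law Q)"
        using main[OF P refl m_def 2] main[OF Q sets mQ 2] eq[of _ 0] eq[of _ "- pi / 2"] by (simp add: fun_eq_iff)
    qed
    then show ?thesis using main[OF P refl m_def 2] main[OF Q sets mQ 2] 2 by simp
  qed
qed

text \<open>
  Induction on the number of coordinates on which the two laws are tested by indicator functions;
  the remaining ones are tested by cosines.
\<close>

lemma cramer_wold:
  fixes P Q :: "(nat \<Rightarrow> real) measure"
  assumes P: "prob_space P" and Q: "prob_space Q"
    and sP: "sets P = sets (borel_vec d)" and sQ: "sets Q = sets (borel_vec d)"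
    and eq: "\<And>a \<phi>. (\<integral>x. cos ((\<Sum>i<d. a i * x i) + \<phi>) \<partial>P) = (\<integral>x. cos ((\<Sum>i<d. a i * x i) + \<phi>) \<partial>Q)"
  shows "P = Q"
proof -
  interpret P: prob_space P by fact
  interpret Q: prob_space Q by fact
  define ind where "ind k B x = (\<Prod>i<k. indicator (B i) (x i) :: real)" for k :: nat and B and x :: "nat \<Rightarrow> real"
  have ind01: "0 \<le> ind k B x" "ind k B x \<le> 1" for k B x
    unfolding ind_def by (auto intro!: prod_nonneg prod_le_1)
  define lin where "lin k a x = (\<Sum>i\<in>{k..<d}. a i * x i)" for k and a x :: "nat \<Rightarrow> real"
  have comp: "(\<lambda>x. x i) \<in> borel_measurable R" if "i < d" "sets R = sets (borel_vec d)"
    for i and R :: "(nat \<Rightarrow> real) measure"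
    using measurable_component_singleton[of i "{..<d}" "\<lambda>_. borel :: real measure"] that measurable_cong_sets
    by blast
  have indm: "ind k B \<in> borel_measurable R"
    if "k \<le> d" "\<And>i. B i \<in> sets borel" "sets R = sets (borel_vec d)" for k B and R :: "(nat \<Rightarrow> real) measure"
    unfolding ind_def
  proof (rule borel_measurable_prod)
    fix i assume "i \<in> {..<k}"
    then have [measurable]: "(\<lambda>x. x i) \<in> borel_measurable R" using comp[of i R] that by auto
    have [measurable]: "B i \<in> sets borel" using that by simp
    show "(\<lambda>x. indicator (B i) (x i) :: real) \<in> borel_measurable R" by measurable
  qed
  have linm: "lin k a \<in> borel_measurable R"
    if "sets R = sets (borel_vec d)" for k a and R :: "(nat \<Rightarrow> real) measure"
    unfolding lin_def by (intro borel_measurable_sum borel_measurable_times borel_measurable_const comp) (use that in auto)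
  have claim: "(\<integral>x. ind k B x * cos (lin k a x + \<phi>) \<partial>P) = (\<integral>x. ind k B x * cos (lin k a x + \<phi>) \<partial>Q)"
    if "k \<le> d" "\<And>i. B i \<in> sets borel" for k B a \<phi>
    using that
  proof (induction k arbitrary: a \<phi>)
    case 0
    have "lin 0 a x = (\<Sum>i<d. a i * x i)" for x by (simp add: lin_def atLeast0LessThan)
    then show ?case using eq[of a \<phi>] by (simp add: ind_def)
  next
    case (Suc k)
    then have k: "k < d" and IH: "\<And>a \<phi>. (\<integral>x. ind k B x * cos (lin k a x + \<phi>) \<partial>P) = (\<integral>x. ind k B x * cos (lin k a x + \<phi>) \<partial>Q)"
      by auto
    have lin_upd: "lin k (a(k := t)) x = t * x k + lin (Suc k) a x" for a t x
      using k by (simp add: lin_def sum.atLeast_Suc_lessThan)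
    have lin_upd': "lin k ((\<lambda>i. - a i)(k := t)) x = t * x k - lin (Suc k) a x" for a t x
      using k by (simp add: lin_def sum.atLeast_Suc_lessThan sum_negf)
    have intg: "integrable R (\<lambda>x. ind k B x * cos (g x))"
      if "prob_space R" "sets R = sets (borel_vec d)" "g \<in> borel_measurable R"
      for R g
    proof -
      interpret prob_space R by fact
      have [measurable]: "ind k B \<in> borel_measurable R" using Suc.prems k that by (intro indm) auto
      note that(3)[measurable]
      have "\<bar>ind k B x * cos (g x)\<bar> \<le> 1" for x
        using mult_mono[OF ind01(2)[of k B x] abs_cos_le_one[of "g x"]] ind01[of k B x] by (simp add: abs_mult)
      then show ?thesis by (intro integrable_const_bound[where B = 1]) auto
    qed
    \<comment> \<open>A weight has to be nonnegative, which a cosine is not; adding 1 repairs this,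
      and \<open>split\<close> below removes the extra term again.\<close>
    have stp: "(\<integral>x. ind k B x * (1 + cos (lin (Suc k) a x + \<phi>)) * indicator (B k) (x k) \<partial>P)
             = (\<integral>x. ind k B x * (1 + cos (lin (Suc k) a x + \<phi>)) * indicator (B k) (x k) \<partial>Q)" for a \<phi>
    proof (rule weighted_law_unique[OF P Q])
      show "sets Q = sets P" by (simp add: sP sQ)
      have [measurable]: "ind k B \<in> borel_measurable P" "lin (Suc k) a \<in> borel_measurable P"
        using Suc.prems k sP by (auto intro!: indm linm)
      show "(\<lambda>x. ind k B x * (1 + cos (lin (Suc k) a x + \<phi>))) \<in> borel_measurable P" by measurable
      show "(\<lambda>x. x k) \<in> borel_measurable P" using comp[OF k sP] .
      have c0: "0 \<le> 1 + cos (u :: real)" for u using cos_ge_minus_one[of u] by linarith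
      show "0 \<le> ind k B x * (1 + cos (lin (Suc k) a x + \<phi>))" for x
        by (rule mult_nonneg_nonneg[OF ind01(1) c0])
      show "ind k B x * (1 + cos (lin (Suc k) a x + \<phi>)) \<le> 1 * 2" for x
      proof (rule mult_mono)
        show "1 + cos (lin (Suc k) a x + \<phi>) \<le> 2" using cos_le_one[of "lin (Suc k) a x + \<phi>"] by linarith
      qed (use ind01 c0 in auto)
      show "B k \<in> sets borel" using Suc.prems by simp
      fix t \<psi>
      \<comment> \<open>The product of the two cosines is half the sum of the cosines of the sum and
        of the difference of their arguments. Each of these is one cosine of a linear form starting
        at coordinate \<open>k\<close>, to which the induction hypothesis applies.\<close>
      have expand: "(\<integral>x. ind k B x * (1 + cos (lin (Suc k) a x + \<phi>)) * cos (t * x k + \<psi>) \<partial>R)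
          = (\<integral>x. ind k B x * cos (lin k ((\<lambda>_. 0)(k := t)) x + \<psi>) \<partial>R)
            + ((\<integral>x. ind k B x * cos (lin k (a(k := t)) x + (\<psi> + \<phi>)) \<partial>R)
            + (\<integral>x. ind k B x * cos (lin k ((\<lambda>i. - a i)(k := t)) x + (\<psi> - \<phi>)) \<partial>R)) / 2"
        if R: "prob_space R" "sets R = sets (borel_vec d)" for R
      proof -
        note [measurable] = linm[OF R(2)]
        have "ind k B x * (1 + cos (lin (Suc k) a x + \<phi>)) * cos (t * x k + \<psi>)
          = ind k B x * cos (lin k ((\<lambda>_. 0)(k := t)) x + \<psi>)
            + (ind k B x * cos (lin k (a(k := t)) x + (\<psi> + \<phi>))
            + ind k B x * cos (lin k ((\<lambda>i. - a i)(k := t)) x + (\<psi> - \<phi>))) / 2" for x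
        proof -
          have z: "lin (Suc k) (\<lambda>_. 0) x = 0" by (simp add: lin_def)
          have 1: "lin k (a(k := t)) x + (\<psi> + \<phi>) = (t * x k + \<psi>) + (lin (Suc k) a x + \<phi>)"
            by (simp add: lin_upd)
          have 2: "lin k ((\<lambda>i. - a i)(k := t)) x + (\<psi> - \<phi>) = (t * x k + \<psi>) - (lin (Suc k) a x + \<phi>)"
            by (simp add: lin_upd')
          show ?thesis unfolding 1 2 cos_add[of "t * x k + \<psi>" "lin (Suc k) a x + \<phi>"] cos_diff[of "t * x k + \<psi>" "lin (Suc k) a x + \<phi>"]
            unfolding lin_upd z by (simp add: algebra_simps)
        qed
        then show ?thesis using R by (simp add: intg)
      qed
      show "(\<integral>x. ind k B x * (1 + cos (lin (Suc k) a x + \<phi>)) * cos (t * x k + \<psi>) \<partial>P)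
          = (\<integral>x. ind k B x * (1 + cos (lin (Suc k) a x + \<phi>)) * cos (t * x k + \<psi>) \<partial>Q)"
        unfolding expand[OF P sP] expand[OF Q sQ] IH ..
    qed
    \<comment> \<open>With zero coefficients and phase the factor \<open>1 + cos\<close> equals 2,
      so half of that integral is the contribution of the added 1.\<close>
    have split: "(\<integral>x. ind (Suc k) B x * cos (lin (Suc k) a x + \<phi>) \<partial>R)
       = (\<integral>x. ind k B x * (1 + cos (lin (Suc k) a x + \<phi>)) * indicator (B k) (x k) \<partial>R)
       - (\<integral>x. ind k B x * (1 + cos (lin (Suc k) (\<lambda>_. 0) x + 0)) * indicator (B k) (x k) \<partial>R) / 2"
      if R: "prob_space R" "sets R = sets (borel_vec d)" for R
    proof -
      interpret prob_space R by fact
      have [measurable]: "lin (Suc k) a \<in> borel_measurable R" "ind (Suc k) B \<in> borel_measurable R"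
        using R Suc.prems by (auto intro!: linm indm)
      have i1: "integrable R (\<lambda>x. ind (Suc k) B x * cos (lin (Suc k) a x + \<phi>))"
      proof (rule integrable_const_bound[where B = 1])
        have "\<bar>ind (Suc k) B x * cos (lin (Suc k) a x + \<phi>)\<bar> \<le> 1" for x
          using mult_mono[OF ind01(2)[of "Suc k" B x] abs_cos_le_one[of "lin (Suc k) a x + \<phi>"]] ind01[of "Suc k" B x]
          by (simp add: abs_mult)
        then show "AE x in R. norm (ind (Suc k) B x * cos (lin (Suc k) a x + \<phi>)) \<le> 1" by simp
      qed measurable
      have i2: "integrable R (\<lambda>x. ind (Suc k) B x)"
        using ind01[of "Suc k" B] by (intro integrable_const_bound[where B = 1]) auto
      have e: "ind k B x * (1 + cos (lin (Suc k) a x + \<phi>)) * indicator (B k) (x k)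
          = ind (Suc k) B x + ind (Suc k) B x * cos (lin (Suc k) a x + \<phi>)"
        "ind k B x * (1 + cos (lin (Suc k) (\<lambda>_. 0) x + 0)) * indicator (B k) (x k) = 2 * ind (Suc k) B x" for x
        by (simp_all add: ind_def lin_def algebra_simps)
      show ?thesis unfolding e using i1 i2 by simp
    qed
    show ?case unfolding split[OF P sP] split[OF Q sQ] stp ..
  qed
  show ?thesis
  proof (rule measure_eqI_PiM_finite[of "{..<d}" P "\<lambda>_. borel" Q "\<lambda>_. space (borel_vec d)"])
    fix A :: "nat \<Rightarrow> real set" assume A: "\<And>i. i \<in> {..<d} \<Longrightarrow> A i \<in> sets borel"
    define B where "B i = (if i < d then A i else UNIV)" for i
    have B: "B i \<in> sets borel" for i using A by (auto simp: B_def)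
    have eqI: "ind d B x * cos (lin d (\<lambda>_. 0) x + 0) = indicator (Pi\<^sub>E {..<d} A) x" if "x \<in> space (PiM {..<d} (\<lambda>_. borel :: real measure))" for x
    proof (cases "x \<in> Pi\<^sub>E {..<d} A")
      case True
      then show ?thesis by (auto simp: ind_def lin_def B_def PiE_iff)
    next
      case False
      moreover have "x \<in> extensional {..<d}" using that by (simp add: space_PiM PiE_def)
      ultimately obtain i where "i < d" "x i \<notin> A i" by (auto simp: PiE_iff)
      then have "(\<Prod>i<d. indicator (B i) (x i) :: real) = 0"
        by (intro prod_zero bexI[of _ i]) (auto simp: B_def)
      then show ?thesis using False by (simp add: ind_def)
    qed
    have m: "(\<integral>x. ind d B x * cos (lin d (\<lambda>_. 0) x + 0) \<partial>R) = measure R (Pi\<^sub>E {..<d} A)"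
      if R: "prob_space R" "sets R = sets (borel_vec d)" for R
    proof -
      have "(\<integral>x. ind d B x * cos (lin d (\<lambda>_. 0) x + 0) \<partial>R) = (\<integral>x. indicator (Pi\<^sub>E {..<d} A) x \<partial>R)"
        by (rule Bochner_Integration.integral_cong[OF refl]) (use R eqI sets_eq_imp_space_eq[OF R(2)] in auto)
      moreover have "Pi\<^sub>E {..<d} A \<in> sets R" using A R by (simp add: sets_PiM_I_finite)
      ultimately show ?thesis by simp
    qed
    show "emeasure P (Pi\<^sub>E {..<d} A) = emeasure Q (Pi\<^sub>E {..<d} A)"
      using claim[of d B "\<lambda>_. 0" 0] B m[OF P sP] m[OF Q sQ] by (simp add: P.emeasure_eq_measure Q.emeasure_eq_measure)
  next
    show "range (\<lambda>_::nat. space (PiM {..<d} (\<lambda>_. borel :: real measure))) \<subseteq> prod_algebra {..<d} (\<lambda>_. borel)"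
      by (auto simp: space_PiM intro!: prod_algebraI_finite)
  qed (use sP sQ in auto)
qed

subsection \<open>Standard Gaussian vectors\<close>

abbreviation gauss :: "'i set \<Rightarrow> ('i \<Rightarrow> real) measure" where
  "gauss I \<equiv> PiM I (\<lambda>_. std_normal_distribution)"

lemma prob_space_std_normal: "prob_space std_normal_distribution"
  by (rule prob_space_normal_density) simp

lemma product_sigma_finite_std_normal: "product_sigma_finite (\<lambda>_. std_normal_distribution)"
  by (intro product_sigma_finite.intro prob_space_imp_sigma_finite prob_space_std_normal)

lemma prob_space_gauss: "prob_space (gauss I)"
  by (intro prob_space_PiM prob_space_std_normal)

lemma borel_measurable_gauss_coord: "i \<in> I \<Longrightarrow> (\<lambda>z. z i) \<in> borel_measurable (gauss I)"
  using measurable_component_singleton[of i I "\<lambda>_. std_normal_distribution"] by simp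

lemma std_normal_iexp:
  "(\<integral>z. iexp (t * z) \<partial>std_normal_distribution) = complex_of_real (exp (- (t\<^sup>2) / 2))"
  using fun_cong[OF char_std_normal_distribution, of t] by (simp only: char_def)

text \<open>The characteristic function factors over the independent coordinates, and the quadratic
  exponents add up to the squared norm of \<open>c\<close>. This reduces every linear functional of
  a Gaussian vector to one dimension.\<close>

lemma gauss_lin_law:
  assumes I: "finite I"
  shows "distr (gauss I) borel (\<lambda>z. \<Sum>i\<in>I. c i * z i)
       = distr std_normal_distribution borel (\<lambda>z. L2_set c I * z)"
    (is "?P = ?Q")
proof (rule Levy_uniqueness)
  interpret G: prob_space "gauss I" by (rule prob_space_gauss)
  interpret S: prob_space std_normal_distribution by (rule prob_space_std_normal)
  show "real_distribution ?P"
    unfolding real_distribution_def real_distribution_axioms_def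
    by (auto intro!: G.prob_space_distr)
  show "real_distribution ?Q"
    unfolding real_distribution_def real_distribution_axioms_def
    by (auto intro!: S.prob_space_distr)
  show "char ?P
      = char ?Q"
  proof
    fix t
    have "char ?P t
        = (\<integral>z. iexp (t * (\<Sum>i\<in>I. c i * z i)) \<partial>gauss I)"
      by (simp add: char_def integral_distr)
    also have "\<dots> = (\<integral>z. (\<Prod>i\<in>I. iexp ((t * c i) * z i)) \<partial>gauss I)"
      by (intro Bochner_Integration.integral_cong refl)
         (simp add: exp_sum[OF I, symmetric] sum_distrib_left mult.assoc)
    also have "\<dots> = (\<Prod>i\<in>I. \<integral>z. iexp ((t * c i) * z) \<partial>std_normal_distribution)"
      by (rule product_sigma_finite.product_integral_prod[OF product_sigma_finite_std_normal I])
         (auto intro!: S.integrable_const_bound[where B = 1])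
    also have "\<dots> = (\<Prod>i\<in>I. complex_of_real (exp (- ((t * c i)\<^sup>2) / 2)))"
      by (simp only: std_normal_iexp)
    also have "\<dots> = complex_of_real (exp (\<Sum>i\<in>I. - ((t * c i)\<^sup>2) / 2))"
      by (simp add: exp_sum[OF I])
    also have "(\<Sum>i\<in>I. - ((t * c i)\<^sup>2) / 2) = - ((t * L2_set c I)\<^sup>2) / 2"
      by (simp add: L2_set_def power_mult_distrib sum_nonneg sum_distrib_left sum_negf sum_divide_distrib)
    also have "complex_of_real (exp (- ((t * L2_set c I)\<^sup>2) / 2)) = (\<integral>z. iexp ((t * L2_set c I) * z) \<partial>std_normal_distribution)"
      by (simp only: std_normal_iexp)
    also have "\<dots> = char ?Q t"
      by (simp add: char_def integral_distr mult.assoc)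
    finally show "char ?P t
        = char ?Q t" .
  qed
qed

lemma gauss_nn_integral_lin:
  assumes I: "finite I" and [measurable]: "f \<in> borel_measurable borel"
  shows "(\<integral>\<^sup>+z. f (\<Sum>i\<in>I. c i * z i) \<partial>gauss I) = (\<integral>\<^sup>+z. f (L2_set c I * z) \<partial>std_normal_distribution)"
proof -
  have "(\<integral>\<^sup>+z. f (\<Sum>i\<in>I. c i * z i) \<partial>gauss I) = (\<integral>\<^sup>+y. f y \<partial>distr (gauss I) borel (\<lambda>z. \<Sum>i\<in>I. c i * z i))"
    by (subst nn_integral_distr) auto
  also have "\<dots> = (\<integral>\<^sup>+z. f (L2_set c I * z) \<partial>std_normal_distribution)"
    unfolding gauss_lin_law[OF I] by (subst nn_integral_distr) auto
  finally show ?thesis .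
qed

lemma gauss_integral_lin:
  fixes f :: "real \<Rightarrow> real"
  assumes I: "finite I" and [measurable]: "f \<in> borel_measurable borel"
  shows "(\<integral>z. f (\<Sum>i\<in>I. c i * z i) \<partial>gauss I) = (\<integral>z. f (L2_set c I * z) \<partial>std_normal_distribution)"
proof -
  have "(\<integral>z. f (\<Sum>i\<in>I. c i * z i) \<partial>gauss I) = (\<integral>y. f y \<partial>distr (gauss I) borel (\<lambda>z. \<Sum>i\<in>I. c i * z i))"
    by (subst integral_distr) auto
  also have "\<dots> = (\<integral>z. f (L2_set c I * z) \<partial>std_normal_distribution)"
    unfolding gauss_lin_law[OF I] by (subst integral_distr) auto
  finally show ?thesis .
qed

lemma nn_integral_std_normal_sq: "(\<integral>\<^sup>+z. ennreal (z\<^sup>2) \<partial>std_normal_distribution) = 1"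
proof -
  have h: "has_bochner_integral lborel (\<lambda>x. std_normal_density x * x ^ (2 * 1)) (fact (2 * 1) / (2 ^ 1 * fact 1))"
    by (rule std_normal_moment_even)
  have "(\<integral>\<^sup>+z. ennreal (z\<^sup>2) \<partial>std_normal_distribution) = (\<integral>\<^sup>+z. ennreal (std_normal_density z * z ^ (2 * 1)) \<partial>lborel)"
    by (subst nn_integral_density) (auto simp: ennreal_mult')
  also have "\<dots> = ennreal (fact (2 * 1) / (2 ^ 1 * fact 1))"
    using h by (subst nn_integral_eq_integral) (auto simp: has_bochner_integral_iff)
  finally show ?thesis by simp
qed

text \<open>The tilted density is a multiple of the normal density with variance
  \<open>1 / (1 - 2 \<theta>)\<close>, so the integral is
  \<open>exp (- \<theta>) / sqrt (1 - 2 \<theta>)\<close>; its logarithm has no linear term in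
  \<open>\<theta>\<close>.\<close>

lemma chi_square_mgf:
  assumes "\<bar>\<theta>\<bar> \<le> 1/4"
  shows "(\<integral>\<^sup>+z. ennreal (exp (\<theta> * (z\<^sup>2 - 1))) \<partial>std_normal_distribution) \<le> ennreal (exp (4 * \<theta>\<^sup>2))"
proof -
  define v where "v = 1 - 2 * \<theta>"
  have v: "0 < v" using assms by (simp add: v_def)
  define s where "s = 1 / sqrt v"
  have s: "0 < s" "s\<^sup>2 = 1 / v" using v by (simp_all add: s_def power_divide)
  have dens: "std_normal_density z * exp (\<theta> * (z\<^sup>2 - 1)) = (exp (- \<theta>) * s) * normal_density 0 s z" for z
  proof -
    have "std_normal_density z * exp (\<theta> * (z\<^sup>2 - 1)) = 1 / sqrt (2 * pi) * exp (- z\<^sup>2 / 2 + \<theta> * (z\<^sup>2 - 1))"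
      unfolding std_normal_density_def exp_add by simp
    also have "- z\<^sup>2 / 2 + \<theta> * (z\<^sup>2 - 1) = - \<theta> + - (z - 0)\<^sup>2 / (2 * s\<^sup>2)"
      using v unfolding s(2) by (simp add: v_def field_simps)
    also have "1 / sqrt (2 * pi) * exp (- \<theta> + - (z - 0)\<^sup>2 / (2 * s\<^sup>2))
       = (exp (- \<theta>) * s) * normal_density 0 s z"
      using s(1) unfolding normal_density_def exp_add by (simp add: real_sqrt_mult)
    finally show ?thesis .
  qed
  have "(\<integral>\<^sup>+z. ennreal (exp (\<theta> * (z\<^sup>2 - 1))) \<partial>std_normal_distribution)
      = (\<integral>\<^sup>+z. ennreal (exp (- \<theta>) * s) * ennreal (normal_density 0 s z) \<partial>lborel)"
    by (subst nn_integral_density)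
       (use s in \<open>auto simp: ennreal_mult'[symmetric] dens intro!: nn_integral_cong\<close>)
  also have "\<dots> = ennreal (exp (- \<theta>) * s) * (\<integral>\<^sup>+z. ennreal (normal_density 0 s z) \<partial>lborel)"
    by (rule nn_integral_cmult) simp
  also have "(\<integral>\<^sup>+z. ennreal (normal_density 0 s z) \<partial>lborel) = 1"
    using prob_space.emeasure_space_1[OF prob_space_normal_density[OF s(1), of 0]]
    by (simp add: emeasure_density)
  also have "ennreal (exp (- \<theta>) * s) * 1 \<le> ennreal (exp (4 * \<theta>\<^sup>2))"
  proof -
    \<comment> \<open>The quadratic estimate of the logarithm holds for arguments up to
      \<open>1/2\<close> in absolute value; this is where \<open>1/4\<close> in the hypothesis comes
      from.\<close>
    have "\<bar>ln (1 + - 2 * \<theta>) - - 2 * \<theta>\<bar> \<le> 2 * (- 2 * \<theta>)\<^sup>2"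
      by (rule abs_ln_one_plus_x_minus_x_bound) (use assms in auto)
    then have "- 2 * \<theta> - 8 * \<theta>\<^sup>2 \<le> ln v" by (simp add: v_def power2_eq_square)
    then have "- \<theta> + - ln v / 2 \<le> 4 * \<theta>\<^sup>2" by simp
    moreover have "s = exp (- ln v / 2)"
      using v by (simp add: s_def exp_minus inverse_eq_divide ln_sqrt[symmetric])
    ultimately show ?thesis by (simp add: exp_add[symmetric])
  qed
  finally show ?thesis .
qed

lemma gauss_square_mgf:
  assumes "\<bar>\<theta>\<bar> * (nrm d c)\<^sup>2 \<le> 1/4"
  shows "(\<integral>\<^sup>+z. ennreal (exp (\<theta> * ((ip d c z)\<^sup>2 - (nrm d c)\<^sup>2))) \<partial>gauss {..<d})
    \<le> ennreal (exp (4 * (\<theta> * (nrm d c)\<^sup>2)\<^sup>2))"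
proof -
  have "(\<integral>\<^sup>+z. ennreal (exp (\<theta> * ((ip d c z)\<^sup>2 - (nrm d c)\<^sup>2))) \<partial>gauss {..<d})
     = (\<integral>\<^sup>+z. ennreal (exp (\<theta> * ((nrm d c * z)\<^sup>2 - (nrm d c)\<^sup>2))) \<partial>std_normal_distribution)"
    unfolding ip_def by (rule gauss_nn_integral_lin) auto
  also have "\<dots> = (\<integral>\<^sup>+z. ennreal (exp ((\<theta> * (nrm d c)\<^sup>2) * (z\<^sup>2 - 1))) \<partial>std_normal_distribution)"
    by (simp add: power_mult_distrib algebra_simps)
  also have "\<dots> \<le> ennreal (exp (4 * (\<theta> * (nrm d c)\<^sup>2)\<^sup>2))"
    by (rule chi_square_mgf) (use assms in \<open>simp add: abs_mult\<close>)
  finally show ?thesis .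
qed

lemma measurable_ip_gauss [measurable]: "ip d c \<in> borel_measurable (gauss {..<d})"
  unfolding ip_def by measurable

text \<open>Polarisation turns the product into a difference of two squares, which AM--GM separates.\<close>

lemma gauss_product_mgf:
  assumes a: "(nrm d (\<lambda>i. a i + b i))\<^sup>2 \<le> V" and b: "(nrm d (\<lambda>i. a i - b i))\<^sup>2 \<le> V"
    and l: "0 \<le> \<mu>" "\<mu> * V \<le> 1/2"
  shows "(\<integral>\<^sup>+z. ennreal (exp (\<mu> * (ip d a z * ip d b z - ip d a b))) \<partial>gauss {..<d})
    \<le> ennreal (exp (\<mu>\<^sup>2 * V\<^sup>2))"
proof -
  let ?p = "\<lambda>i. a i + b i" and ?m = "\<lambda>i. a i - b i"
  define f where "f \<theta> c z = exp (\<theta> * ((ip d c z)\<^sup>2 - (nrm d c)\<^sup>2))" for \<theta> c z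
  have fm[measurable]: "f \<theta> c \<in> borel_measurable (gauss {..<d})" for \<theta> c
    unfolding f_def by measurable
  have V0: "0 \<le> V" using a by (meson order.trans zero_le_power2)
  have pt: "exp (\<mu> * (ip d a z * ip d b z - ip d a b)) \<le> (f (\<mu>/2) ?p z + f (-\<mu>/2) ?m z) / 2" for z
  proof -
    have "ip d ?p z = ip d a z + ip d b z" "ip d ?m z = ip d a z - ip d b z"
      by (simp_all add: ip_def sum.distrib sum_subtractf algebra_simps)
    moreover have "(nrm d ?p)\<^sup>2 - (nrm d ?m)\<^sup>2 = 4 * ip d a b"
      unfolding ip_nrm[symmetric]
      by (simp add: ip_def sum_subtractf[symmetric] sum_distrib_left) (intro sum.cong refl, simp add: algebra_simps)
    ultimately have e: "2 * (\<mu> * (ip d a z * ip d b z - ip d a b))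
        = (\<mu>/2) * ((ip d ?p z)\<^sup>2 - (nrm d ?p)\<^sup>2) + (-\<mu>/2) * ((ip d ?m z)\<^sup>2 - (nrm d ?m)\<^sup>2)"
    proof -
      assume p: "ip d ?p z = ip d a z + ip d b z" and m: "ip d ?m z = ip d a z - ip d b z"
        and n: "(nrm d ?p)\<^sup>2 - (nrm d ?m)\<^sup>2 = 4 * ip d a b"
      have "(\<mu>/2) * ((ip d ?p z)\<^sup>2 - (nrm d ?p)\<^sup>2) + (-\<mu>/2) * ((ip d ?m z)\<^sup>2 - (nrm d ?m)\<^sup>2)
         = (\<mu>/2) * (((ip d ?p z)\<^sup>2 - (ip d ?m z)\<^sup>2) - ((nrm d ?p)\<^sup>2 - (nrm d ?m)\<^sup>2))"
        by (simp add: algebra_simps)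
      also have "\<dots> = (\<mu>/2) * (4 * (ip d a z * ip d b z) - 4 * ip d a b)"
        unfolding n p m by (simp add: power2_eq_square algebra_simps)
      finally show ?thesis by (simp add: algebra_simps)
    qed
    define x y where "x = exp ((\<mu>/2) * ((ip d ?p z)\<^sup>2 - (nrm d ?p)\<^sup>2) / 2)"
      and "y = exp ((-\<mu>/2) * ((ip d ?m z)\<^sup>2 - (nrm d ?m)\<^sup>2) / 2)"
    have "exp (\<mu> * (ip d a z * ip d b z - ip d a b)) = x * y"
      unfolding x_def y_def exp_add[symmetric] using e by (simp add: field_simps)
    moreover have "f (\<mu>/2) ?p z = x\<^sup>2" "f (-\<mu>/2) ?m z = y\<^sup>2"
      by (simp_all add: f_def x_def y_def exp_double[symmetric])
    moreover have "x * y \<le> (x\<^sup>2 + y\<^sup>2) / 2" using sum_squares_bound[of x y] by simp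
    ultimately show ?thesis by simp
  qed
  \<comment> \<open>Here \<open>\<bar>\<theta>\<bar> = \<mu> / 2\<close>, so
    \<open>\<mu> * V \<le> 1/2\<close> is exactly the range of \<open>gauss_square_mgf\<close>, and
    its exponent \<open>4 (\<theta> V)\<^sup>2\<close> becomes
    \<open>\<mu>\<^sup>2 V\<^sup>2\<close>.\<close>
  have bd: "(\<integral>\<^sup>+z. ennreal (f \<theta> c z) \<partial>gauss {..<d}) \<le> ennreal (exp (\<mu>\<^sup>2 * V\<^sup>2))"
    if c: "(nrm d c)\<^sup>2 \<le> V" and t: "\<bar>\<theta>\<bar> = \<mu>/2" for \<theta> c
  proof -
    have h: "\<bar>\<theta>\<bar> * (nrm d c)\<^sup>2 \<le> \<mu> * V / 2" using mult_left_mono[OF c, of "\<mu> / 2"] l(1) unfolding t by simp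
    have "(\<integral>\<^sup>+z. ennreal (f \<theta> c z) \<partial>gauss {..<d}) \<le> ennreal (exp (4 * (\<theta> * (nrm d c)\<^sup>2)\<^sup>2))"
      unfolding f_def by (rule gauss_square_mgf) (use h l in simp)
    also have "\<dots> \<le> ennreal (exp (\<mu>\<^sup>2 * V\<^sup>2))"
    proof -
      have "(\<bar>\<theta>\<bar> * (nrm d c)\<^sup>2)\<^sup>2 \<le> (\<mu> * V / 2)\<^sup>2" using h by (intro power_mono) auto
      then show ?thesis by (simp add: power_mult_distrib power_divide)
    qed
    finally show ?thesis .
  qed
  have "(\<integral>\<^sup>+z. ennreal (exp (\<mu> * (ip d a z * ip d b z - ip d a b))) \<partial>gauss {..<d})
     \<le> (\<integral>\<^sup>+z. (ennreal (f (\<mu>/2) ?p z) + ennreal (f (-\<mu>/2) ?m z)) * ennreal (1/2) \<partial>gauss {..<d})"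
  proof (rule nn_integral_mono)
    fix z
    have "ennreal (exp (\<mu> * (ip d a z * ip d b z - ip d a b))) \<le> ennreal ((f (\<mu>/2) ?p z + f (-\<mu>/2) ?m z) * (1/2))"
      using pt[of z] by (intro ennreal_leI) simp
    also have "\<dots> = (ennreal (f (\<mu>/2) ?p z) + ennreal (f (-\<mu>/2) ?m z)) * ennreal (1/2)"
      by (subst ennreal_mult) (auto simp: f_def ennreal_plus)
    finally show "ennreal (exp (\<mu> * (ip d a z * ip d b z - ip d a b)))
      \<le> (ennreal (f (\<mu>/2) ?p z) + ennreal (f (-\<mu>/2) ?m z)) * ennreal (1/2)" .
  qed
  also have "\<dots> = ((\<integral>\<^sup>+z. ennreal (f (\<mu>/2) ?p z) \<partial>gauss {..<d}) + (\<integral>\<^sup>+z. ennreal (f (-\<mu>/2) ?m z) \<partial>gauss {..<d})) * ennreal (1/2)"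
    by (subst nn_integral_multc) (auto simp: nn_integral_add)
  also have "\<dots> \<le> (ennreal (exp (\<mu>\<^sup>2 * V\<^sup>2)) + ennreal (exp (\<mu>\<^sup>2 * V\<^sup>2))) * ennreal (1/2)"
    by (intro mult_right_mono add_mono bd a b) (use l in auto)
  also have "\<dots> = ennreal (exp (\<mu>\<^sup>2 * V\<^sup>2))"
  proof -
    have "(ennreal e + ennreal e) * ennreal (1/2) = ennreal ((e + e) * (1/2))" if "0 \<le> e" for e
      using that by (simp only: ennreal_mult ennreal_plus add_nonneg_nonneg zero_le_divide_1_iff zero_le_numeral)
    then show ?thesis by simp
  qed
  finally show ?thesis .
qed

text \<open>Cameron--Martin in dimension one: completing the square shows that the density recentres
  the law at \<open>- u\<close>, and adding \<open>u\<close> moves it back. The product over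
  coordinates gives \<open>gauss_nn_integral_shift\<close>.\<close>

lemma std_normal_shift:
  "distr (density std_normal_distribution (\<lambda>z. ennreal (exp (- u * z - u\<^sup>2 / 2)))) std_normal_distribution (\<lambda>z. z + u)
    = std_normal_distribution" (is "?D = _")
proof (rule measure_eqI)
  fix A assume "A \<in> sets ?D"
  then have [measurable]: "A \<in> sets borel" by simp
  have e: "std_normal_density z * exp (- u * z - u\<^sup>2 / 2) = std_normal_density (z + u)" for z
  proof -
    have "- (z + u)\<^sup>2 / 2 = - z\<^sup>2 / 2 + (- u * z - u\<^sup>2 / 2)" by (simp add: power2_eq_square field_simps)
    then show ?thesis unfolding std_normal_density_def by (simp only: exp_add mult.assoc)
  qed
  have "emeasure ?D A = (\<integral>\<^sup>+z. indicator A z \<partial>?D)" by simp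
  also have "\<dots> = (\<integral>\<^sup>+z. ennreal (exp (- u * z - u\<^sup>2 / 2)) * indicator A (z + u) \<partial>std_normal_distribution)"
    by (subst nn_integral_distr, measurable, subst nn_integral_density) auto
  also have "\<dots> = (\<integral>\<^sup>+z. ennreal (std_normal_density (z + u)) * indicator A (z + u) \<partial>lborel)"
    by (subst nn_integral_density, measurable)
       (simp only: e[symmetric] ennreal_mult' exp_ge_zero normal_density_nonneg mult.assoc)
  also have "\<dots> = (\<integral>\<^sup>+z. ennreal (std_normal_density z) * indicator A z \<partial>lborel)"
    using nn_integral_real_affine[of "\<lambda>z. ennreal (std_normal_density z) * indicator A z" 1 u]
    by (simp add: add.commute)
  also have "\<dots> = emeasure std_normal_distribution A" by (simp add: emeasure_density)
  finally show "emeasure ?D A = emeasure std_normal_distribution A" .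
qed simp

lemma std_normal_uminus:
  "distr (density std_normal_distribution (\<lambda>z. 1)) std_normal_distribution (\<lambda>z. - z) = std_normal_distribution"
  (is "?D = _")
proof (rule measure_eqI)
  fix A assume "A \<in> sets ?D"
  then have [measurable]: "A \<in> sets borel" by simp
  have "emeasure ?D A = (\<integral>\<^sup>+z. indicator A z \<partial>?D)" by simp
  also have "\<dots> = (\<integral>\<^sup>+z. indicator A (- z) \<partial>std_normal_distribution)"
    by (subst nn_integral_distr, measurable, subst nn_integral_density) auto
  also have "\<dots> = (\<integral>\<^sup>+z. ennreal (std_normal_density (- z)) * indicator A (- z) \<partial>lborel)"
    by (subst nn_integral_density) (auto simp: std_normal_density_def)
  also have "\<dots> = (\<integral>\<^sup>+z. ennreal (std_normal_density z) * indicator A z \<partial>lborel)"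
    using nn_integral_real_affine[of "\<lambda>z. ennreal (std_normal_density z) * indicator A z" "-1" 0] by simp
  also have "\<dots> = emeasure std_normal_distribution A" by (simp add: emeasure_density)
  finally show "emeasure ?D A = emeasure std_normal_distribution A" .
qed simp

lemma gauss_nn_integral_shift:
  fixes u :: "'i \<Rightarrow> real"
  assumes I: "finite I" and F[measurable]: "F \<in> borel_measurable (gauss I)"
  shows "(\<integral>\<^sup>+z. F z \<partial>gauss I)
    = (\<integral>\<^sup>+z. ennreal (exp (- (\<Sum>i\<in>I. u i * z i) - (\<Sum>i\<in>I. (u i)\<^sup>2) / 2)) * F (\<lambda>i\<in>I. z i + u i) \<partial>gauss I)"
proof -
  let ?H = "\<lambda>z. \<Prod>i\<in>I. ennreal (exp (- u i * z i - (u i)\<^sup>2 / 2))"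
  have "gauss I = distr (density (gauss I) ?H) (gauss I) (\<lambda>z. \<lambda>i\<in>I. z i + u i)"
    by (rule PiM_transform[OF I product_sigma_finite_std_normal product_sigma_finite_std_normal, symmetric];
        (rule std_normal_shift | measurable))
  then have "(\<integral>\<^sup>+z. F z \<partial>gauss I) = (\<integral>\<^sup>+z. F z \<partial>distr (density (gauss I) ?H) (gauss I) (\<lambda>z. \<lambda>i\<in>I. z i + u i))"
    by simp
  also have "\<dots> = (\<integral>\<^sup>+z. ?H z * F (\<lambda>i\<in>I. z i + u i) \<partial>gauss I)"
    by (simp add: nn_integral_distr nn_integral_density)
  also have "?H = (\<lambda>z. ennreal (exp (- (\<Sum>i\<in>I. u i * z i) - (\<Sum>i\<in>I. (u i)\<^sup>2) / 2)))"
    by (rule ext) (simp add: prod_ennreal exp_sum[OF I, symmetric] sum_subtractf sum_negf sum_divide_distrib)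
  finally show ?thesis .
qed

lemma gauss_nn_integral_uminus:
  fixes F :: "('i \<Rightarrow> real) \<Rightarrow> ennreal"
  assumes I: "finite I" and F[measurable]: "F \<in> borel_measurable (gauss I)"
  shows "(\<integral>\<^sup>+z. F z \<partial>gauss I) = (\<integral>\<^sup>+z. F (\<lambda>i\<in>I. - z i) \<partial>gauss I)"
proof -
  have "gauss I = distr (density (gauss I) (\<lambda>z. \<Prod>i\<in>I. 1)) (gauss I) (\<lambda>z. \<lambda>i\<in>I. - z i)"
    by (rule PiM_transform[OF I product_sigma_finite_std_normal product_sigma_finite_std_normal, symmetric])
       (auto intro: std_normal_uminus)
  then have "(\<integral>\<^sup>+z. F z \<partial>gauss I) = (\<integral>\<^sup>+z. F z \<partial>distr (density (gauss I) (\<lambda>z. \<Prod>i\<in>I. 1)) (gauss I) (\<lambda>z. \<lambda>i\<in>I. - z i))"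
    by simp
  also have "\<dots> = (\<integral>\<^sup>+z. F (\<lambda>i\<in>I. - z i) \<partial>gauss I)"
    by (simp add: nn_integral_distr nn_integral_density)
  finally show ?thesis .
qed

lemma mv_ip: "ip d a (mv d S z) = ip d (mv d (\<lambda>i j. S j i) a) z"
proof -
  have "ip d a (mv d S z) = (\<Sum>i<d. \<Sum>j<d. a i * S i j * z j)"
    by (simp add: ip_def mv_def sum_distrib_left mult.assoc)
  also have "\<dots> = (\<Sum>j<d. \<Sum>i<d. a i * S i j * z j)" by (rule sum.swap)
  also have "\<dots> = ip d (mv d (\<lambda>i j. S j i) a) z"
    by (auto simp: ip_def mv_def sum_distrib_right intro!: sum.cong)
  finally show ?thesis .
qed

lemma ip_transpose_mv:
  "ip d (mv d (\<lambda>i j. S j i) a) (mv d (\<lambda>i j. S j i) b) = ip d a (mv d (\<lambda>i j. \<Sum>k<d. S i k * S j k) b)"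
  unfolding mv_mult[of d S "\<lambda>k j. S j k", simplified] by (rule mv_ip[symmetric])

lemma measurable_mv_gauss [measurable]:
  "(\<lambda>z. \<lambda>i\<in>{..<d}. mv d S z i) \<in> measurable (gauss {..<d}) (borel_vec d)"
  unfolding mv_def by measurable

text \<open>A projection \<open>a\<close> of the image is normal with variance equal to the
  quadratic form of \<open>S\<close> times its transpose at \<open>a\<close>, and Cramer--Wold lifts
  agreement of all projections to agreement of the laws.\<close>

lemma gauss_linear_image_law:
  assumes eq: "\<And>i j. i < d \<Longrightarrow> j < d \<Longrightarrow> (\<Sum>k<d. S i k * S j k) = (\<Sum>k<d. B i k * B j k)"
  shows "distr (gauss {..<d}) (borel_vec d) (\<lambda>z. \<lambda>i\<in>{..<d}. mv d S z i)
       = distr (gauss {..<d}) (borel_vec d) (\<lambda>z. \<lambda>i\<in>{..<d}. mv d B z i)"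
    (is "?law S = ?law B")
proof (rule cramer_wold)
  interpret G: prob_space "gauss {..<d} :: (nat \<Rightarrow> real) measure" by (rule prob_space_gauss)
  show "prob_space (?law S)"
    "prob_space (?law B)"
    by (rule G.prob_space_distr measurable_mv_gauss)+
  fix a :: "nat \<Rightarrow> real" and \<phi> :: real
  have *: "(\<integral>x. cos ((\<Sum>i<d. a i * x i) + \<phi>) \<partial>?law S)
     = (\<integral>z. cos (sqrt (ip d a (mv d (\<lambda>i j. \<Sum>k<d. S i k * S j k) a)) * z + \<phi>) \<partial>std_normal_distribution)" for S
  proof -
    have "(\<integral>x. cos ((\<Sum>i<d. a i * x i) + \<phi>) \<partial>?law S)
       = (\<integral>z. cos (ip d a (mv d S z) + \<phi>) \<partial>gauss {..<d})"
      by (subst integral_distr) (auto simp: ip_def)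
    also have "\<dots> = (\<integral>z. cos ((\<Sum>i<d. mv d (\<lambda>i j. S j i) a i * z i) + \<phi>) \<partial>gauss {..<d})"
      unfolding mv_ip by (simp add: ip_def)
    also have "\<dots> = (\<integral>z. cos (nrm d (mv d (\<lambda>i j. S j i) a) * z + \<phi>) \<partial>std_normal_distribution)"
      by (rule gauss_integral_lin) auto
    also have "nrm d (mv d (\<lambda>i j. S j i) a) = sqrt (ip d a (mv d (\<lambda>i j. \<Sum>k<d. S i k * S j k) a))"
      unfolding ip_transpose_mv[symmetric] ip_nrm by simp
    finally show ?thesis .
  qed
  have "ip d a (mv d (\<lambda>i j. \<Sum>k<d. S i k * S j k) a) = ip d a (mv d (\<lambda>i j. \<Sum>k<d. B i k * B j k) a)"
    unfolding ip_def by (intro sum.cong refl arg_cong2[where f = "(*)"] mv_cong eq) auto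
  then show "(\<integral>x. cos ((\<Sum>i<d. a i * x i) + \<phi>) \<partial>?law S)
     = (\<integral>x. cos ((\<Sum>i<d. a i * x i) + \<phi>) \<partial>?law B)"
    unfolding * by simp
qed auto

text \<open>This frees the normal law from the chosen square root: any factor \<open>B\<close> of
  the covariance represents it. The lower bounds use factors with an explicit structure, which need
  not be symmetric.\<close>

lemma centred_normal_eq:
  assumes \<Sigma>: "\<Sigma> \<in> psd_mats d"
    and B: "\<And>i j. i < d \<Longrightarrow> j < d \<Longrightarrow> (\<Sum>k<d. B i k * B j k) = \<Sigma> $$ (i, j)"
  shows "centred_normal d \<Sigma> = distr (gauss {..<d}) (borel_vec d) (\<lambda>z. \<lambda>i\<in>{..<d}. mv d B z i)"
proof -
  have "centred_normal d \<Sigma> = distr (gauss {..<d}) (borel_vec d) (\<lambda>z. \<lambda>i\<in>{..<d}. mv d (entries (psd_sqrt d \<Sigma>)) z i)"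
    by (simp add: centred_normal_def mv_def)
  also have "\<dots> = distr (gauss {..<d}) (borel_vec d) (\<lambda>z. \<lambda>i\<in>{..<d}. mv d B z i)"
  proof (rule gauss_linear_image_law)
    fix i j assume ij: "i < d" "j < d"
    have "(\<Sum>k<d. psd_sqrt d \<Sigma> $$ (i, k) * psd_sqrt d \<Sigma> $$ (j, k)) = (\<Sum>k<d. psd_sqrt d \<Sigma> $$ (i, k) * psd_sqrt d \<Sigma> $$ (k, j))"
      using psd_sqrt(1)[OF \<Sigma>] ij by (intro sum.cong refl) (auto simp: sym_entries_def)
    then show "(\<Sum>k<d. psd_sqrt d \<Sigma> $$ (i, k) * psd_sqrt d \<Sigma> $$ (j, k)) = (\<Sum>k<d. B i k * B j k)"
      using psd_sqrt(2)[OF \<Sigma> ij] B[OF ij] by simp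
  qed
  finally show ?thesis .
qed

lemma prob_space_centred_normal: "prob_space (centred_normal d \<Sigma>)"
proof -
  have "centred_normal d \<Sigma> = distr (gauss {..<d}) (borel_vec d) (\<lambda>z. \<lambda>i\<in>{..<d}. mv d (entries (psd_sqrt d \<Sigma>)) z i)"
    by (simp add: centred_normal_def mv_def)
  then show ?thesis by (auto intro!: prob_space.prob_space_distr prob_space_gauss)
qed

lemma sets_centred_normal [simp, measurable_cong]: "sets (centred_normal d \<Sigma>) = sets (borel_vec d)"
  by (simp add: centred_normal_def)

lemma space_centred_normal [simp]: "space (centred_normal d \<Sigma>) = space (borel_vec d)"
  by (simp add: centred_normal_def)

subsection \<open>Exponential moments under a tilted Gaussian prior\<close>

lemma ip_restrict [simp]: "ip d x (restrict y {..<d}) = ip d x y" "ip d (restrict x {..<d}) y = ip d x y"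
  by (simp_all add: ip_def)

lemma mv_restrict [simp]: "mv d A (restrict x {..<d}) = mv d A x"
  by (rule ext) (simp add: mv_def)

lemma measurable_quad_gauss [measurable]: "(\<lambda>z. ip d z (mv d S z)) \<in> borel_measurable (gauss {..<d})"
  unfolding ip_def mv_def by measurable

text \<open>With a square root \<open>T\<close> of \<open>S\<close> the form is the sum of the
  squares of the linear forms given by the rows of \<open>T\<close>, and the squared row norms are
  the diagonal entries of \<open>S\<close>.\<close>

lemma gauss_nn_integral_quad:
  assumes s: "sym_entries d S" and psd: "\<And>x. 0 \<le> ip d x (mv d S x)"
  shows "(\<integral>\<^sup>+z. ennreal (ip d z (mv d S z)) \<partial>gauss {..<d}) = ennreal (\<Sum>i<d. S i i)"
proof -
  obtain T where T: "sym_entries d T" "\<And>x. 0 \<le> ip d x (mv d T x)"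
    "\<And>i j. i < d \<Longrightarrow> j < d \<Longrightarrow> (\<Sum>k<d. T i k * T k j) = S i j"
    using psd_sqrt_ex[OF s psd] by blast
  have quad: "ip d z (mv d S z) = (\<Sum>i<d. (ip d (T i) z)\<^sup>2)" for z
  proof -
    have "ip d z (mv d S z) = ip d z (mv d (\<lambda>i j. \<Sum>k<d. T i k * T k j) z)"
      unfolding ip_def by (intro sum.cong refl arg_cong2[where f = "(*)"] mv_cong) (simp_all add: T)
    also have "\<dots> = ip d (mv d T z) (mv d T z)" unfolding mv_mult by (rule ip_mv_sym[OF T(1)])
    also have "\<dots> = (\<Sum>i<d. (ip d (T i) z)\<^sup>2)" by (simp add: ip_def mv_def power2_eq_square)
    finally show ?thesis .
  qed
  have one: "(\<integral>\<^sup>+z. ennreal ((ip d c z)\<^sup>2) \<partial>gauss {..<d}) = ennreal ((nrm d c)\<^sup>2)" for c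
  proof -
    have "(\<integral>\<^sup>+z. ennreal ((ip d c z)\<^sup>2) \<partial>gauss {..<d}) = (\<integral>\<^sup>+z. ennreal ((nrm d c * z)\<^sup>2) \<partial>std_normal_distribution)"
      unfolding ip_def by (rule gauss_nn_integral_lin) auto
    also have "\<dots> = (\<integral>\<^sup>+z. ennreal ((nrm d c)\<^sup>2) * ennreal (z\<^sup>2) \<partial>std_normal_distribution)"
      by (simp add: power_mult_distrib ennreal_mult)
    also have "\<dots> = ennreal ((nrm d c)\<^sup>2) * (\<integral>\<^sup>+z. ennreal (z\<^sup>2) \<partial>std_normal_distribution)"
      by (rule nn_integral_cmult) measurable
    finally show ?thesis by (simp add: nn_integral_std_normal_sq)
  qed
  have "(\<integral>\<^sup>+z. ennreal (ip d z (mv d S z)) \<partial>gauss {..<d}) = (\<integral>\<^sup>+z. (\<Sum>i<d. ennreal ((ip d (T i) z)\<^sup>2)) \<partial>gauss {..<d})"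
    unfolding quad by (simp add: sum_ennreal)
  also have "\<dots> = (\<Sum>i<d. \<integral>\<^sup>+z. ennreal ((ip d (T i) z)\<^sup>2) \<partial>gauss {..<d})"
    by (rule nn_integral_sum) measurable
  also have "\<dots> = ennreal (\<Sum>i<d. (nrm d (T i))\<^sup>2)" by (simp add: one sum_ennreal)
  also have "(\<Sum>i<d. (nrm d (T i))\<^sup>2) = (\<Sum>i<d. S i i)"
  proof (rule sum.cong[OF refl])
    fix i assume "i \<in> {..<d}"
    then have i: "i < d" by simp
    have "(nrm d (T i))\<^sup>2 = (\<Sum>k<d. T i k * T i k)" by (simp add: ip_nrm[symmetric] ip_def)
    also have "\<dots> = (\<Sum>k<d. T i k * T k i)" using T(1) i by (intro sum.cong refl) (auto simp: sym_entries_def)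
    finally show "(nrm d (T i))\<^sup>2 = S i i" using T(3)[OF i i] by simp
  qed
  finally show ?thesis .
qed

text \<open>Markov's inequality for a nonnegative variable with mean at most \<open>R / 2\<close>.
  It is here that the trace, and with it the effective rank, enters the upper bound in place of the
  dimension.\<close>

lemma gauss_quad_concentration:
  assumes s: "sym_entries d S" and psd: "\<And>x. 0 \<le> ip d x (mv d S x)"
    and R: "0 < R" and trace: "(\<Sum>i<d. S i i) \<le> R / 2"
  shows "ennreal (1/2) \<le> emeasure (gauss {..<d}) {z \<in> space (gauss {..<d}). ip d z (mv d S z) \<le> R}"
proof -
  interpret G: prob_space "gauss {..<d} :: (nat \<Rightarrow> real) measure" by (rule prob_space_gauss)
  let ?q = "\<lambda>z. ip d z (mv d S z)" and ?M = "gauss {..<d} :: (nat \<Rightarrow> real) measure"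
  have sub: "{z \<in> space ?M. \<not> ?q z \<le> R} \<subseteq> {z \<in> space ?M. 1 \<le> ennreal (1 / R) * ennreal (?q z)}"
  proof
    fix z assume z: "z \<in> {z \<in> space ?M. \<not> ?q z \<le> R}"
    then have "1 \<le> ?q z / R" using R by (simp add: less_imp_le)
    then have "ennreal 1 \<le> ennreal (1 / R * ?q z)" by (intro ennreal_leI) simp
    also have "\<dots> = ennreal (1 / R) * ennreal (?q z)" by (rule ennreal_mult) (use R psd in auto)
    finally show "z \<in> {z \<in> space ?M. 1 \<le> ennreal (1 / R) * ennreal (?q z)}"
      using z by (simp only: mem_Collect_eq ennreal_1)
  qed
  have "emeasure ?M {z \<in> space ?M. \<not> ?q z \<le> R} \<le> emeasure ?M {z \<in> space ?M. 1 \<le> ennreal (1 / R) * ennreal (?q z)}"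
    by (rule emeasure_mono[OF sub]) measurable
  also have "\<dots> \<le> ennreal (1 / R) * (\<integral>\<^sup>+z. ennreal (?q z) * indicator (space ?M) z \<partial>?M)"
    by (rule nn_integral_Markov_inequality) measurable
  also have "(\<integral>\<^sup>+z. ennreal (?q z) * indicator (space ?M) z \<partial>?M) = ennreal (\<Sum>i<d. S i i)"
    unfolding gauss_nn_integral_quad[OF s psd, symmetric] by (rule nn_integral_cong) simp
  also have "ennreal (1 / R) * ennreal (\<Sum>i<d. S i i) \<le> ennreal (1 / R) * ennreal (R / 2)"
    by (intro mult_left_mono ennreal_leI trace) simp
  also have "\<dots> = ennreal (1/2)" using R by (subst ennreal_mult[symmetric]) auto
  finally have "measure ?M {z \<in> space ?M. \<not> ?q z \<le> R} \<le> 1/2"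
    unfolding G.emeasure_eq_measure by (subst (asm) ennreal_le_iff) auto
  moreover have "measure ?M {z \<in> space ?M. \<not> ?q z \<le> R} = 1 - measure ?M {z \<in> space ?M. ?q z \<le> R}"
    by (rule G.prob_neg) measurable
  ultimately have "1/2 \<le> measure ?M {z \<in> space ?M. ?q z \<le> R}" by simp
  then show ?thesis unfolding G.emeasure_eq_measure by (rule ennreal_leI)
qed

text \<open>
  Shift the prior so that it is centred at \<open>v\<close>; the odd part of the exponent then only helps,
  because \<open>cosh \<ge> 1\<close>.
\<close>

lemma gauss_tilt:
  assumes s: "sym_entries d S" and psd: "\<And>x. 0 \<le> ip d x (mv d S x)"
    and R: "0 < R" and trace: "(\<Sum>i<d. S i i) \<le> R / 2"
    and v: "ip d v (mv d S v) \<le> R" "(nrm d v)\<^sup>2 \<le> b"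
  shows "ennreal (exp (ip d c v - b / 2) / 2)
    \<le> (\<integral>\<^sup>+z. indicator {z. ip d z (mv d S z) \<le> 4 * R} z * ennreal (exp (ip d c z)) \<partial>gauss {..<d})"
proof -
  let ?q = "\<lambda>z. ip d z (mv d S z)" and ?M = "gauss {..<d} :: (nat \<Rightarrow> real) measure"
  let ?E = "{z \<in> space ?M. ?q z \<le> R}"
  \<comment> \<open>At the shifted point \<open>z + v\<close> the exponent is \<open>c\<close>
    applied to \<open>z + v\<close>, and the Cameron--Martin density contributes \<open>- v\<close>
    applied to \<open>z\<close>. The part that is odd in \<open>z\<close> is therefore given by
    \<open>c - v\<close>.\<close>
  define w where "w i = c i + (- 1) * v i" for i
  have Em[measurable]: "?E \<in> sets ?M" by measurable
  define J where "J = (\<integral>\<^sup>+z. indicator ?E z * ennreal (exp (ip d w z)) \<partial>?M)"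
  have qneg: "?q (\<lambda>i. - z i) = ?q z" for z by (simp add: ip_def mv_def sum_negf)
  have wneg: "ip d w (\<lambda>i. - z i) = - ip d w z" for z by (simp add: ip_def sum_negf)
  have "J = (\<integral>\<^sup>+z. indicator ?E (\<lambda>i\<in>{..<d}. - z i) * ennreal (exp (ip d w (\<lambda>i\<in>{..<d}. - z i))) \<partial>?M)"
    unfolding J_def by (rule gauss_nn_integral_uminus) auto
  also have "\<dots> = (\<integral>\<^sup>+z. indicator ?E z * ennreal (exp (- ip d w z)) \<partial>?M)"
  proof (rule nn_integral_cong)
    fix z assume "z \<in> space ?M"
    then have "((\<lambda>i\<in>{..<d}. - z i) \<in> ?E) = (z \<in> ?E)"
      by (simp add: qneg) (simp add: space_PiM PiE_def)
    then show "indicator ?E (\<lambda>i\<in>{..<d}. - z i) * ennreal (exp (ip d w (\<lambda>i\<in>{..<d}. - z i)))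
        = indicator ?E z * ennreal (exp (- ip d w z))"
      by (simp only: indicator_def ip_restrict wneg)
  qed
  finally have J': "J = (\<integral>\<^sup>+z. indicator ?E z * ennreal (exp (- ip d w z)) \<partial>?M)" .
  \<comment> \<open>The set \<open>?E\<close> and the Gaussian are symmetric, so \<open>J\<close> is
    also the integral with \<open>- w\<close>; adding the two versions produces
    \<open>exp y + exp (- y) \<ge> 2\<close>.\<close>
  have "emeasure ?M ?E + emeasure ?M ?E = (\<integral>\<^sup>+z. indicator ?E z + indicator ?E z \<partial>?M)"
    by (subst nn_integral_add) auto
  also have "\<dots> \<le> (\<integral>\<^sup>+z. indicator ?E z * ennreal (exp (ip d w z)) + indicator ?E z * ennreal (exp (- ip d w z)) \<partial>?M)"
  proof (rule nn_integral_mono)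
    fix z
    have "2 \<le> exp y + exp (- y)" for y :: real
      using exp_ge_add_one_self[of y] exp_ge_add_one_self[of "- y"] by linarith
    then have "(2 :: ennreal) \<le> ennreal (exp (ip d w z)) + ennreal (exp (- ip d w z))"
      by (metis ennreal_leI ennreal_numeral ennreal_plus exp_ge_zero zero_le_numeral)
    then show "indicator ?E z + indicator ?E z
        \<le> indicator ?E z * ennreal (exp (ip d w z)) + indicator ?E z * ennreal (exp (- ip d w z))"
      by (cases "z \<in> ?E") (simp_all add: one_add_one)
  qed
  also have "\<dots> = J + J"
    unfolding J_def[symmetric] using J' by (subst nn_integral_add) (auto simp: J_def)
  finally have EJ: "emeasure ?M ?E + emeasure ?M ?E \<le> J + J" .
  have half: "ennreal (1/2) \<le> J"
  proof (rule ccontr)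
    assume "\<not> ennreal (1/2) \<le> J"
    then have j: "J < ennreal (1/2)" by (simp only: not_le)
    have e: "ennreal (1/2) \<le> emeasure ?M ?E" by (rule gauss_quad_concentration[OF s psd R trace])
    have "J + J < ennreal (1/2) + ennreal (1/2)" by (rule add_strict_mono[OF j j])
    also have "\<dots> \<le> emeasure ?M ?E + emeasure ?M ?E" by (rule add_mono[OF e e])
    finally show False using EJ by simp
  qed
  have b: "ip d v v \<le> b" using v(2) by (simp add: ip_nrm)
  have "ennreal (exp (ip d c v - b / 2) / 2) = ennreal (exp (ip d c v - b / 2)) * ennreal (1/2)"
    by (subst ennreal_mult[symmetric]) simp_all
  also have "\<dots> \<le> ennreal (exp (ip d c v - b / 2)) * J" by (rule mult_left_mono[OF half]) simp
  also have "\<dots> = (\<integral>\<^sup>+z. ennreal (exp (ip d c v - b / 2)) * (indicator ?E z * ennreal (exp (ip d w z))) \<partial>?M)"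
    unfolding J_def by (rule nn_integral_cmult[symmetric]) measurable
  also have "\<dots> \<le> (\<integral>\<^sup>+z. ennreal (exp (- (\<Sum>i<d. v i * z i) - (\<Sum>i<d. (v i)\<^sup>2) / 2)) *
        (indicator {z. ?q z \<le> 4 * R} (\<lambda>i\<in>{..<d}. z i + v i) * ennreal (exp (ip d c (\<lambda>i\<in>{..<d}. z i + v i)))) \<partial>?M)"
  proof (rule nn_integral_mono)
    fix z
    show "ennreal (exp (ip d c v - b / 2)) * (indicator ?E z * ennreal (exp (ip d w z)))
      \<le> ennreal (exp (- (\<Sum>i<d. v i * z i) - (\<Sum>i<d. (v i)\<^sup>2) / 2)) *
        (indicator {z. ?q z \<le> 4 * R} (\<lambda>i\<in>{..<d}. z i + v i) * ennreal (exp (ip d c (\<lambda>i\<in>{..<d}. z i + v i))))"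
    proof (cases "z \<in> ?E")
      case True
      \<comment> \<open>Positivity at \<open>z - v\<close> bounds the mixed terms and yields
        \<open>q (z + v) \<le> 2 q z + 2 q v\<close>. Both values are at most \<open>R\<close>,
        whence the truncation level \<open>4 * R\<close>.\<close>
      have "0 \<le> ?q (\<lambda>i. z i + (- 1) * v i)" by (rule psd)
      also have "\<dots> = ?q z - ip d z (mv d S v) - ip d v (mv d S z) + ?q v"
        unfolding mv_add_vec mv_scale_vec ip_add_left ip_add_right ip_scale_left ip_scale_right by simp
      finally have "?q (\<lambda>i. z i + v i) \<le> 2 * ?q z + 2 * ?q v"
        unfolding mv_add_vec ip_add_left ip_add_right by simp
      then have in': "?q (\<lambda>i. z i + v i) \<le> 4 * R" using True v(1) by simp
      have e1: "ip d c v - b / 2 + ip d w z \<le> - ip d v z - ip d v v / 2 + ip d c (\<lambda>i. z i + v i)"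
        unfolding w_def ip_add_left ip_add_right ip_scale_left using b by simp
      have e2: "(\<Sum>i<d. v i * z i) = ip d v z" "(\<Sum>i<d. (v i)\<^sup>2) = ip d v v"
        by (simp_all add: ip_def power2_eq_square)
      show ?thesis using True in' e1 unfolding e2
        by (simp add: ennreal_mult'[symmetric] exp_add[symmetric] ennreal_leI)
    next
      case False
      then have "indicator ?E z = (0 :: ennreal)" by (simp add: indicator_def)
      then show ?thesis by (simp only: mult_zero_left mult_zero_right zero_le)
    qed
  qed
  also have "\<dots> = (\<integral>\<^sup>+z. indicator {z. ?q z \<le> 4 * R} z * ennreal (exp (ip d c z)) \<partial>?M)"
    by (rule gauss_nn_integral_shift[symmetric]) measurable
  finally show ?thesis .
qed

subsection \<open>Concentration of the sample covariance\<close>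

text \<open>This is \<open>n\<close> times the bilinear form of sample covariance minus
  \<open>S\<close>, as \<open>dev_form_sample_cov\<close> records. Left unnormalised, its
  exponential is a product over the independent observations.\<close>

definition dev_form :: "nat \<Rightarrow> nat \<Rightarrow> (nat \<Rightarrow> nat \<Rightarrow> real) \<Rightarrow> (nat \<Rightarrow> nat \<Rightarrow> real) \<Rightarrow> (nat \<Rightarrow> real) \<Rightarrow> (nat \<Rightarrow> real) \<Rightarrow> real" where
  "dev_form n d S x p q = (\<Sum>k<n. ip d p (x k) * ip d q (x k) - ip d p (mv d S q))"

lemma dev_form_commute: "sym_entries d S \<Longrightarrow> dev_form n d S x p q = dev_form n d S x q p"
  unfolding dev_form_def by (simp add: ip_mv_sym[of d S p q] ip_commute[of d _ q] mult.commute)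

text \<open>With the sample and one argument fixed, the form is an inner product with a fixed
  vector. This is the shape of exponent that \<open>gauss_tilt\<close> requires.\<close>

lemma dev_form_lin:
  assumes "sym_entries d S"
  shows "dev_form n d S x p q = ip d (\<lambda>i. \<Sum>k<n. ip d p (x k) * x k i - mv d S p i) q"
proof -
  have "ip d (\<lambda>i. \<Sum>k<n. ip d p (x k) * x k i - mv d S p i) q
     = (\<Sum>i<d. \<Sum>k<n. (ip d p (x k) * x k i - mv d S p i) * q i)"
    by (simp add: ip_def[of d _ q] sum_distrib_right)
  also have "\<dots> = (\<Sum>k<n. \<Sum>i<d. (ip d p (x k) * x k i - mv d S p i) * q i)" by (rule sum.swap)
  also have "\<dots> = (\<Sum>k<n. ip d p (x k) * ip d (x k) q - ip d (mv d S p) q)"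
    by (simp add: ip_def[of d _ q] sum_distrib_left sum_subtractf algebra_simps)
  also have "\<dots> = dev_form n d S x p q"
    unfolding dev_form_def ip_mv_sym[OF assms] by (simp add: ip_commute[of d _ q])
  finally show ?thesis ..
qed

lemma dev_form_scale: "dev_form n d S x (\<lambda>i. a * p i) (\<lambda>i. b * q i) = a * b * dev_form n d S x p q"
  unfolding dev_form_def mv_scale_vec ip_scale_left ip_scale_right
  by (simp add: sum_distrib_left algebra_simps)

lemma measurable_dev_form [measurable]:
  "(\<lambda>y. dev_form n d S (fst y) (fst (snd y)) (snd (snd y))) \<in>
     borel_measurable (borel_sample n d \<Otimes>\<^sub>M (gauss {..<d} \<Otimes>\<^sub>M gauss {..<d}))"
    (is "_ \<in> borel_measurable ?N")
proof -
  have g: "(\<lambda>p. p i) \<in> borel_measurable (gauss {..<d})" if "i < d" for i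
    using that by (intro borel_measurable_gauss_coord) simp
  have f: "(\<lambda>y. fst y k i) \<in> borel_measurable ?N" if "k < n" "i < d" for k i
    by (rule measurable_compose[OF measurable_fst measurable_compose[OF measurable_component_singleton[of k]
          measurable_component_singleton[of i]]]) (use that in auto)
  have p: "(\<lambda>y. fst (snd y) i) \<in> borel_measurable ?N" if "i < d" for i
    by (rule measurable_compose[OF measurable_snd measurable_compose[OF measurable_fst g[OF that]]])
  have q: "(\<lambda>y. snd (snd y) i) \<in> borel_measurable ?N" if "i < d" for i
    by (rule measurable_compose[OF measurable_snd measurable_compose[OF measurable_snd g[OF that]]])
  show ?thesis unfolding dev_form_def ip_def mv_def
    by (intro borel_measurable_sum borel_measurable_diff borel_measurable_times borel_measurable_const f p q) auto
qed

lemma centred_normal_product_mgf: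
  assumes \<Sigma>: "\<Sigma> \<in> psd_mats d"
    and p: "ip d p (mv d (entries \<Sigma>) p) \<le> 4 * R" and q: "ip d q (mv d (entries \<Sigma>) q) \<le> 4 * R"
    and l: "0 \<le> \<mu>" "\<mu> * (16 * R) \<le> 1/2"
  shows "(\<integral>\<^sup>+x. ennreal (exp (\<mu> * (ip d p x * ip d q x - ip d p (mv d (entries \<Sigma>) q)))) \<partial>centred_normal d \<Sigma>)
    \<le> ennreal (exp (\<mu>\<^sup>2 * (16 * R)\<^sup>2))"
proof -
  let ?T = "entries (psd_sqrt d \<Sigma>)" and ?S = "entries \<Sigma>"
  note T = psd_sqrt[OF \<Sigma>]
  have TT: "ip d (mv d ?T a) (mv d ?T b) = ip d a (mv d ?S b)" for a b
  proof -
    have "ip d (mv d ?T a) (mv d ?T b) = ip d a (mv d ?T (mv d ?T b))" by (rule ip_mv_sym[OF T(1), symmetric])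
    also have "\<dots> = ip d a (mv d ?S b)" unfolding mv_mult[symmetric] ip_def
      by (intro sum.cong refl arg_cong2[where f = "(*)"] mv_cong) (simp_all add: T(2))
    finally show ?thesis .
  qed
  have psd: "0 \<le> ip d x (mv d ?S x)" for x using \<Sigma> by (simp add: psd_mats_iff)
  have Tm: "ip d a (mv d ?T z) = ip d (mv d ?T a) z" for a z by (rule ip_mv_sym[OF T(1)])
  have law: "centred_normal d \<Sigma> = distr (gauss {..<d}) (borel_vec d) (\<lambda>z. \<lambda>i\<in>{..<d}. mv d ?T z i)"
    by (simp add: centred_normal_def mv_def)
  have m[measurable]: "ip d a \<in> borel_measurable (borel_vec d)" for a unfolding ip_def by measurable
  \<comment> \<open>Both quadratic forms are at most \<open>4 * R\<close>, and the sum or difference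
    at most doubles their total: \<open>2 * 4 R + 2 * 4 R = 16 R\<close>.\<close>
  have n: "(nrm d (\<lambda>i. mv d ?T p i + c * mv d ?T q i))\<^sup>2 \<le> 16 * R" if c: "c = 1 \<or> c = -1" for c
  proof -
    let ?u = "\<lambda>c i. p i + c * q i"
    have e: "(nrm d (\<lambda>i. mv d ?T p i + c * mv d ?T q i))\<^sup>2 = ip d (?u c) (mv d ?S (?u c))"
      unfolding ip_nrm[symmetric] using TT[of "?u c" "?u c"] unfolding mv_add_vec mv_scale_vec .
    have "0 \<le> ip d (?u (- c)) (mv d ?S (?u (- c)))" by (rule psd)
    then have "ip d (?u c) (mv d ?S (?u c)) \<le> 2 * ip d p (mv d ?S p) + 2 * ip d q (mv d ?S q)"
      using c unfolding mv_add_vec mv_scale_vec ip_add_left ip_add_right ip_scale_left ip_scale_right by auto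
    then show ?thesis unfolding e using p q by simp
  qed
  have "(\<integral>\<^sup>+x. ennreal (exp (\<mu> * (ip d p x * ip d q x - ip d p (mv d ?S q)))) \<partial>centred_normal d \<Sigma>)
     = (\<integral>\<^sup>+z. ennreal (exp (\<mu> * (ip d (mv d ?T p) z * ip d (mv d ?T q) z - ip d p (mv d ?S q)))) \<partial>gauss {..<d})"
    unfolding law by (subst nn_integral_distr) (auto simp: Tm)
  also have "\<dots> \<le> ennreal (exp (\<mu>\<^sup>2 * (16 * R)\<^sup>2))"
    by (rule gauss_product_mgf[where d = d and a = "mv d ?T p" and b = "mv d ?T q", unfolded TT]) (use n[of 1] n[of "-1"] l in auto)
  finally show ?thesis .
qed

lemma prob_space_PiM_centred_normal: "prob_space (normal_sample n d \<Sigma>)"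
  by (intro prob_space_PiM prob_space_centred_normal)

lemma sets_PiM_centred_normal [measurable_cong]:
  "sets (normal_sample n d \<Sigma>) = sets (borel_sample n d)"
  by (intro sets_PiM_cong) auto

lemma space_PiM_centred_normal:
  "space (normal_sample n d \<Sigma>) = space (sample_space n d)"
  by (simp add: space_PiM sample_space_def)

lemma ennreal_power_mono: "x \<le> y \<Longrightarrow> x ^ n \<le> y ^ n" for x y :: ennreal
  by (induction n) (auto intro: mult_mono)

lemma dev_form_mgf:
  assumes \<Sigma>: "\<Sigma> \<in> psd_mats d"
    and p: "ip d p (mv d (entries \<Sigma>) p) \<le> 4 * R" and q: "ip d q (mv d (entries \<Sigma>) q) \<le> 4 * R"
    and l: "0 \<le> \<mu>" "\<mu> * (16 * R) \<le> 1/2"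
  shows "(\<integral>\<^sup>+x. ennreal (exp (\<mu> * dev_form n d (entries \<Sigma>) x p q)) \<partial>normal_sample n d \<Sigma>)
    \<le> ennreal (exp (real n * (\<mu>\<^sup>2 * (16 * R)\<^sup>2)))"
proof -
  let ?f = "\<lambda>y. ennreal (exp (\<mu> * (ip d p y * ip d q y - ip d p (mv d (entries \<Sigma>) q))))"
  have m: "?f \<in> borel_measurable (centred_normal d \<Sigma>)" unfolding ip_def by measurable
  have "(\<integral>\<^sup>+x. ennreal (exp (\<mu> * dev_form n d (entries \<Sigma>) x p q)) \<partial>normal_sample n d \<Sigma>)
     = (\<integral>\<^sup>+x. (\<Prod>k\<in>{..<n}. ?f (x k)) \<partial>normal_sample n d \<Sigma>)"
    by (simp add: dev_form_def sum_distrib_left exp_sum prod_ennreal)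
  also have "\<dots> = (\<Prod>k\<in>{..<n}. \<integral>\<^sup>+y. ?f y \<partial>centred_normal d \<Sigma>)"
    by (rule product_sigma_finite.product_nn_integral_prod)
       (auto intro!: product_sigma_finite.intro prob_space_imp_sigma_finite prob_space_centred_normal m)
  also have "\<dots> = (\<integral>\<^sup>+y. ?f y \<partial>centred_normal d \<Sigma>) ^ n" by (simp only: prod_constant card_lessThan)
  also have "\<dots> \<le> ennreal (exp (\<mu>\<^sup>2 * (16 * R)\<^sup>2)) ^ n"
    by (intro ennreal_power_mono centred_normal_product_mgf assms)
  also have "\<dots> = ennreal (exp (real n * (\<mu>\<^sup>2 * (16 * R)\<^sup>2)))"
    by (simp only: ennreal_power exp_ge_zero exp_of_nat_mult)
  finally show ?thesis .
qed

text \<open>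
  Markov's inequality is applied to the prior average of the exponential moment, a single random
  variable; this makes the bound uniform in the arguments.
\<close>

lemma dev_form_uniform:
  assumes \<Sigma>: "\<Sigma> \<in> psd_mats d" and b: "0 < b"
    and R: "0 < R" and trace: "(\<Sum>i<d. \<Sigma> $$ (i, i)) \<le> R / 2"
    and op: "\<And>u. nrm d u \<le> 1 \<Longrightarrow> b * ip d u (mv d (entries \<Sigma>) u) \<le> R"
    and l: "0 < \<mu>" "\<mu> * (16 * R) \<le> 1/2" and \<delta>: "0 < \<delta>"
  shows "\<exists>A \<in> sets (normal_sample n d \<Sigma>).
     1 - \<delta> \<le> measure (normal_sample n d \<Sigma>) A \<and>
     (\<forall>x\<in>A. \<forall>u v. nrm d u \<le> 1 \<longrightarrow> nrm d v \<le> 1 \<longrightarrow>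
        \<mu> * b * dev_form n d (entries \<Sigma>) x u v \<le> ln (4 / \<delta>) + b + real n * (\<mu>\<^sup>2 * (16 * R)\<^sup>2))"
proof -
  let ?S = "entries \<Sigma>" and ?G = "gauss {..<d} :: (nat \<Rightarrow> real) measure"
  let ?P = "normal_sample n d \<Sigma>"
  let ?q = "\<lambda>z. ip d z (mv d ?S z)"
  define \<kappa> where "\<kappa> = real n * (\<mu>\<^sup>2 * (16 * R)\<^sup>2)"
  have s: "sym_entries d ?S" and psd: "\<And>x. 0 \<le> ?q x" using \<Sigma> by (auto simp: psd_mats_iff)
  interpret P: prob_space ?P by (rule prob_space_PiM_centred_normal)
  interpret G: prob_space ?G by (rule prob_space_gauss)
  interpret GG: pair_prob_space ?G ?G ..
  interpret PG: pair_sigma_finite ?P "?G \<Otimes>\<^sub>M ?G" ..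
  define I where "I z = (indicator {z. ?q z \<le> 4 * R} z :: ennreal)" for z
  have Im[measurable]: "I \<in> borel_measurable ?G" unfolding I_def by measurable
  \<comment> \<open>Two independent priors, one for each argument of the form, both truncated. The
    truncation makes \<open>dev_form_mgf\<close> available wherever \<open>F\<close> is
    nonzero.\<close>
  define F where "F y = I (fst (snd y)) * I (snd (snd y)) * ennreal (exp (\<mu> * dev_form n d ?S (fst y) (fst (snd y)) (snd (snd y))))" for y
  have Fm: "F \<in> borel_measurable (?P \<Otimes>\<^sub>M (?G \<Otimes>\<^sub>M ?G))"
  proof -
    have [measurable]: "(\<lambda>y. dev_form n d ?S (fst y) (fst (snd y)) (snd (snd y))) \<in> borel_measurable (?P \<Otimes>\<^sub>M (?G \<Otimes>\<^sub>M ?G))"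
      using measurable_dev_form[of n d ?S]
      by (subst measurable_cong_sets[OF sets_pair_measure_cong[OF sets_PiM_centred_normal refl] refl])
    have [measurable]: "(\<lambda>y. I (fst (snd y))) \<in> borel_measurable (?P \<Otimes>\<^sub>M (?G \<Otimes>\<^sub>M ?G))"
      by (rule measurable_compose[OF measurable_snd measurable_compose[OF measurable_fst Im]])
    have [measurable]: "(\<lambda>y. I (snd (snd y))) \<in> borel_measurable (?P \<Otimes>\<^sub>M (?G \<Otimes>\<^sub>M ?G))"
      by (rule measurable_compose[OF measurable_snd measurable_compose[OF measurable_snd Im]])
    show ?thesis unfolding F_def by measurable
  qed
  define W where "W x = (\<integral>\<^sup>+y. F (x, y) \<partial>(?G \<Otimes>\<^sub>M ?G))" for x
  have Wm[measurable]: "W \<in> borel_measurable ?P"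
    unfolding W_def by (rule GG.P.borel_measurable_nn_integral_fst[OF Fm])
  have "(\<integral>\<^sup>+x. W x \<partial>?P) = (\<integral>\<^sup>+y. (\<integral>\<^sup>+x. F (x, y) \<partial>?P) \<partial>(?G \<Otimes>\<^sub>M ?G))"
    unfolding W_def by (rule PG.Fubini'[symmetric]) (use Fm in \<open>simp add: case_prod_beta'\<close>)
  also have "\<dots> \<le> (\<integral>\<^sup>+y. ennreal (exp \<kappa>) \<partial>(?G \<Otimes>\<^sub>M ?G))"
  proof (rule nn_integral_mono)
    fix y
    show "(\<integral>\<^sup>+x. F (x, y) \<partial>?P) \<le> ennreal (exp \<kappa>)"
    proof (cases "?q (fst y) \<le> 4 * R \<and> ?q (snd y) \<le> 4 * R")
      case True
      then have "(\<integral>\<^sup>+x. F (x, y) \<partial>?P) = (\<integral>\<^sup>+x. ennreal (exp (\<mu> * dev_form n d ?S x (fst y) (snd y))) \<partial>?P)"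
        by (simp add: F_def I_def)
      also have "\<dots> \<le> ennreal (exp \<kappa>)" unfolding \<kappa>_def
        by (rule dev_form_mgf[OF \<Sigma>]) (use True l in auto)
      finally show ?thesis .
    next
      case False
      then have "I (fst y) * I (snd y) = 0" by (auto simp: I_def)
      then have "F (x, y) = 0" for x by (simp only: F_def fst_conv snd_conv mult_zero_left)
      then show ?thesis by simp
    qed
  qed
  also have "\<dots> = ennreal (exp \<kappa>)" by (simp add: GG.P.emeasure_space_1)
  finally have EW: "(\<integral>\<^sup>+x. W x \<partial>?P) \<le> ennreal (exp \<kappa>)" .
  let ?A = "{x \<in> space ?P. W x \<le> ennreal (exp \<kappa> / \<delta>)}"
  have "emeasure ?P {x \<in> space ?P. \<not> W x \<le> ennreal (exp \<kappa> / \<delta>)}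
      \<le> emeasure ?P {x \<in> space ?P. 1 \<le> ennreal (\<delta> / exp \<kappa>) * W x}"
  proof (rule emeasure_mono)
    show "{x \<in> space ?P. \<not> W x \<le> ennreal (exp \<kappa> / \<delta>)} \<subseteq> {x \<in> space ?P. 1 \<le> ennreal (\<delta> / exp \<kappa>) * W x}"
    proof
      fix x assume x: "x \<in> {x \<in> space ?P. \<not> W x \<le> ennreal (exp \<kappa> / \<delta>)}"
      have "(1 :: ennreal) = ennreal (\<delta> / exp \<kappa>) * ennreal (exp \<kappa> / \<delta>)"
        using \<delta> by (subst ennreal_mult[symmetric]) auto
      also have "\<dots> \<le> ennreal (\<delta> / exp \<kappa>) * W x" using x by (intro mult_left_mono) auto
      finally show "x \<in> {x \<in> space ?P. 1 \<le> ennreal (\<delta> / exp \<kappa>) * W x}" using x by (simp only: mem_Collect_eq)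
    qed
  qed measurable
  also have "\<dots> \<le> ennreal (\<delta> / exp \<kappa>) * (\<integral>\<^sup>+x. W x * indicator (space ?P) x \<partial>?P)"
    by (rule nn_integral_Markov_inequality) measurable
  also have "(\<integral>\<^sup>+x. W x * indicator (space ?P) x \<partial>?P) = (\<integral>\<^sup>+x. W x \<partial>?P)"
    by (rule nn_integral_cong) simp
  also have "ennreal (\<delta> / exp \<kappa>) * (\<integral>\<^sup>+x. W x \<partial>?P) \<le> ennreal (\<delta> / exp \<kappa>) * ennreal (exp \<kappa>)"
    by (rule mult_left_mono[OF EW]) simp
  also have "\<dots> = ennreal \<delta>" using \<delta> by (subst ennreal_mult[symmetric]) auto
  finally have "measure ?P {x \<in> space ?P. \<not> W x \<le> ennreal (exp \<kappa> / \<delta>)} \<le> \<delta>"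
    unfolding P.emeasure_eq_measure using \<delta> by (subst (asm) ennreal_le_iff) auto
  moreover have "measure ?P {x \<in> space ?P. \<not> W x \<le> ennreal (exp \<kappa> / \<delta>)} = 1 - measure ?P ?A"
    by (rule P.prob_neg) measurable
  ultimately have prob: "1 - \<delta> \<le> measure ?P ?A" by simp
  have lower: "\<mu> * b * dev_form n d ?S x u v \<le> ln (4 / \<delta>) + b + \<kappa>"
    if x: "x \<in> ?A" and u: "nrm d u \<le> 1" and v: "nrm d v \<le> 1" for x u v
  proof -
    \<comment> \<open>The prior is kept standard and the unit vectors are stretched by
      \<open>sqrt b\<close> instead; this is equivalent to a prior of variance \<open>1 / b\<close>
      and unstretched vectors.\<close>
    let ?u = "\<lambda>i. sqrt b * u i" and ?v = "\<lambda>i. sqrt b * v i"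
    have scaled: "ip d (\<lambda>i. sqrt b * w i) (mv d ?S (\<lambda>i. sqrt b * w i)) \<le> R" "(nrm d (\<lambda>i. sqrt b * w i))\<^sup>2 \<le> b"
      if w: "nrm d w \<le> 1" for w
    proof -
      have "ip d (\<lambda>i. sqrt b * w i) (mv d ?S (\<lambda>i. sqrt b * w i)) = b * ip d w (mv d ?S w)"
        unfolding mv_scale_vec ip_scale_left ip_scale_right using b by simp
      then show "ip d (\<lambda>i. sqrt b * w i) (mv d ?S (\<lambda>i. sqrt b * w i)) \<le> R" using op[OF w] by simp
      have "(nrm d w)\<^sup>2 \<le> 1" using w by (simp add: power_le_one)
      then show "(nrm d (\<lambda>i. sqrt b * w i))\<^sup>2 \<le> b"
        unfolding nrm_scale using b by (simp add: power_mult_distrib)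
    qed
    have inner: "ennreal (exp (\<mu> * dev_form n d ?S x p w - b / 2) / 2)
        \<le> (\<integral>\<^sup>+q. I q * ennreal (exp (\<mu> * dev_form n d ?S x p q)) \<partial>?G)"
      if w: "?q w \<le> R" "(nrm d w)\<^sup>2 \<le> b" for p w
    proof -
      define c where "c i = \<mu> * (\<Sum>k<n. ip d p (x k) * x k i - mv d ?S p i)" for i
      have c: "\<mu> * dev_form n d ?S x p q = ip d c q" for q
        unfolding c_def ip_scale_left dev_form_lin[OF s] ..
      show ?thesis unfolding c I_def by (rule gauss_tilt[OF s psd R trace w])
    qed
    \<comment> \<open>\<open>gauss_tilt\<close> is applied twice, to one argument at a time with the
      other held fixed. Each application costs the factor \<open>exp (- b / 2) / 2\<close>; together
      they account for \<open>b\<close> and for the 4 in \<open>ln (4 / \<delta>)\<close>.\<close>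
    have "ennreal (exp (\<mu> * dev_form n d ?S x ?u ?v - b) / 4)
       = ennreal (exp (- b / 2) / 2) * ennreal (exp (\<mu> * dev_form n d ?S x ?v ?u - b / 2) / 2)"
      unfolding dev_form_commute[OF s, of n x ?v ?u]
      by (subst ennreal_mult[symmetric]) (auto simp: exp_add[symmetric])
    also have "\<dots> \<le> ennreal (exp (- b / 2) / 2) * (\<integral>\<^sup>+p. I p * ennreal (exp (\<mu> * dev_form n d ?S x ?v p)) \<partial>?G)"
      by (intro mult_left_mono inner scaled u) simp
    also have "\<dots> = (\<integral>\<^sup>+p. ennreal (exp (- b / 2) / 2) * (I p * ennreal (exp (\<mu> * dev_form n d ?S x ?v p))) \<partial>?G)"
      unfolding dev_form_lin[OF s] by (rule nn_integral_cmult[symmetric]) measurable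
    also have "\<dots> \<le> (\<integral>\<^sup>+p. (\<integral>\<^sup>+q. F (x, (p, q)) \<partial>?G) \<partial>?G)"
    proof (rule nn_integral_mono)
      fix p
      have "ennreal (exp (- b / 2) / 2) * (I p * ennreal (exp (\<mu> * dev_form n d ?S x ?v p)))
          = I p * ennreal (exp (\<mu> * dev_form n d ?S x p ?v - b / 2) / 2)"
      proof -
        have "ennreal (exp (\<mu> * dev_form n d ?S x p ?v - b / 2) / 2)
            = ennreal (exp (- b / 2) / 2) * ennreal (exp (\<mu> * dev_form n d ?S x p ?v))"
          by (subst ennreal_mult[symmetric]) (auto simp: exp_add[symmetric])
        then show ?thesis unfolding dev_form_commute[OF s, of n x ?v p] by (simp only: mult.left_commute)
      qed
      also have "\<dots> \<le> I p * (\<integral>\<^sup>+q. I q * ennreal (exp (\<mu> * dev_form n d ?S x p q)) \<partial>?G)"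
        by (intro mult_left_mono inner scaled v) simp
      also have "\<dots> = (\<integral>\<^sup>+q. F (x, (p, q)) \<partial>?G)"
        unfolding F_def fst_conv snd_conv mult.assoc dev_form_lin[OF s]
        by (rule nn_integral_cmult[symmetric]) measurable
      finally show "ennreal (exp (- b / 2) / 2) * (I p * ennreal (exp (\<mu> * dev_form n d ?S x ?v p)))
          \<le> (\<integral>\<^sup>+q. F (x, (p, q)) \<partial>?G)" .
    qed
    also have "\<dots> = W x"
    proof -
      have "(\<lambda>y. F (x, y)) \<in> borel_measurable (?G \<Otimes>\<^sub>M ?G)"
        by (rule measurable_compose[OF measurable_Pair1' Fm]) (use x in simp)
      then show ?thesis unfolding W_def by (rule G.nn_integral_fst)
    qed
    also have "\<dots> \<le> ennreal (exp \<kappa> / \<delta>)" using x by simp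
    finally have "exp (\<mu> * dev_form n d ?S x ?u ?v - b) / 4 \<le> exp \<kappa> / \<delta>"
      using \<delta> by (subst (asm) ennreal_le_iff) auto
    then have "exp (\<mu> * dev_form n d ?S x ?u ?v - b) \<le> exp (\<kappa> + ln (4 / \<delta>))"
      using \<delta> by (simp add: exp_add)
    then have "\<mu> * dev_form n d ?S x ?u ?v - b \<le> \<kappa> + ln (4 / \<delta>)" by (simp only: exp_le_cancel_iff)
    moreover have "dev_form n d ?S x ?u ?v = b * dev_form n d ?S x u v"
      unfolding dev_form_scale using b by simp
    ultimately show ?thesis by simp
  qed
  have "?A \<in> sets ?P" by measurable
  with prob lower show ?thesis unfolding \<kappa>_def by blast
qed

lemma op_bound_bilinear:
  assumes le: "\<And>u v. nrm d u \<le> 1 \<Longrightarrow> nrm d v \<le> 1 \<Longrightarrow> ip d u (mv d M v) \<le> t" and t: "0 \<le> t"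
  shows "op_bound d M t"
  unfolding op_bound_def
proof
  fix x
  let ?y = "mv d M x"
  show "nrm d ?y \<le> t * nrm d x"
  proof (cases "nrm d x = 0 \<or> nrm d ?y = 0")
    case True
    then show ?thesis
    proof
      assume "nrm d x = 0"
      then have "?y = (\<lambda>_. 0)" by (simp add: L2_set_eq_0_iff mv_def fun_eq_iff)
      then have "nrm d ?y = 0" by (simp add: L2_set_def)
      then show ?thesis using t by simp
    next
      assume "nrm d ?y = 0"
      then show ?thesis using t by simp
    qed
  next
    case False
    then have p: "0 < nrm d x" "0 < nrm d ?y" by (simp_all add: less_le)
    have "ip d (\<lambda>i. (1 / nrm d ?y) * ?y i) (mv d M (\<lambda>i. (1 / nrm d x) * x i)) \<le> t"
      using p by (intro le) (simp_all only: nrm_scale, simp_all)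
    then have "(1 / nrm d ?y) * ((1 / nrm d x) * (nrm d ?y)\<^sup>2) \<le> t"
      unfolding mv_scale_vec ip_scale_left ip_scale_right ip_nrm .
    then show ?thesis using p by (simp add: field_simps power2_eq_square)
  qed
qed

lemma cov_class_trace:
  assumes "\<Sigma> \<in> cov_class d \<sigma> r" "0 \<le> r"
  shows "(\<Sum>i<d. \<Sigma> $$ (i, i)) \<le> r * \<sigma>\<^sup>2"
proof -
  have \<Sigma>: "\<Sigma> \<in> carrier_mat d d" "op_norm \<Sigma> \<le> \<sigma>\<^sup>2" "tr \<Sigma> / op_norm \<Sigma> \<le> r"
    using assms by (auto simp: cov_class_def psd_mats_iff effective_rank_def)
  have tr: "tr \<Sigma> = (\<Sum>i<d. \<Sigma> $$ (i, i))" using \<Sigma> by (simp add: tr_def)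
  have "tr \<Sigma> \<le> r * op_norm \<Sigma>"
  proof (cases "op_norm \<Sigma> = 0")
    \<comment> \<open>Here the bound on the effective rank is void because of
      \<open>0/0 = 0\<close>, so the trace is controlled through the entries, all of which
      vanish.\<close>
    case True
    have "\<bar>\<Sigma> $$ (i, i)\<bar> \<le> 0" if "i < d" for i
      using op_bound_entry[OF op_bound_op_norm[OF \<Sigma>(1)] that that] True by simp
    then show ?thesis using True by (simp add: tr)
  next
    case False
    then show ?thesis using \<Sigma>(3) op_norm_nonneg[OF \<Sigma>(1)] by (simp add: field_simps)
  qed
  also have "\<dots> \<le> r * \<sigma>\<^sup>2" using assms(2) \<Sigma>(2) by (rule mult_left_mono[rotated])
  finally show ?thesis by (simp add: tr)
qed

lemma cov_class_quad:
  assumes "\<Sigma> \<in> cov_class d \<sigma> r" "nrm d u \<le> 1"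
  shows "ip d u (mv d (entries \<Sigma>) u) \<le> \<sigma>\<^sup>2"
proof -
  have \<Sigma>: "\<Sigma> \<in> carrier_mat d d" "op_norm \<Sigma> \<le> \<sigma>\<^sup>2"
    using assms by (auto simp: cov_class_def psd_mats_iff)
  have "ip d u (mv d (entries \<Sigma>) u) \<le> nrm d u * nrm d (mv d (entries \<Sigma>) u)"
    using ip_le_nrm by (meson abs_le_D1)
  also have "\<dots> \<le> 1 * op_norm \<Sigma>"
    by (intro mult_mono assms nrm_mv_le_op_norm \<Sigma>) auto
  finally show ?thesis using \<Sigma> by simp
qed

definition sample_cov :: "nat \<Rightarrow> (nat \<Rightarrow> nat \<Rightarrow> real) \<Rightarrow> nat \<Rightarrow> nat \<Rightarrow> real" where
  "sample_cov n x i j = (\<Sum>k<n. x k i * x k j) / real n"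

lemma dev_form_sample_cov:
  assumes "0 < n"
  shows "ip d u (mv d (\<lambda>i j. sample_cov n x i j - S i j) v) = dev_form n d S x u v / real n"
proof -
  have 1: "mv d (\<lambda>i j. \<Sum>k<n. x k i * x k j) v i = (\<Sum>k<n. x k i * ip d v (x k))" for i
  proof -
    have "mv d (\<lambda>i j. \<Sum>k<n. x k i * x k j) v i = (\<Sum>j<d. \<Sum>k<n. x k i * x k j * v j)"
      by (simp add: mv_def sum_distrib_right)
    also have "\<dots> = (\<Sum>k<n. \<Sum>j<d. x k i * x k j * v j)" by (rule sum.swap)
    also have "\<dots> = (\<Sum>k<n. x k i * ip d v (x k))"
      by (auto simp: ip_def sum_distrib_left intro!: sum.cong)
    finally show ?thesis .
  qed
  have 2: "ip d u (\<lambda>i. \<Sum>k<n. x k i * ip d v (x k)) = (\<Sum>k<n. ip d u (x k) * ip d v (x k))"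
  proof -
    have "ip d u (\<lambda>i. \<Sum>k<n. x k i * ip d v (x k)) = (\<Sum>i<d. \<Sum>k<n. u i * x k i * ip d v (x k))"
      by (simp add: ip_def[of d u] sum_distrib_left mult.assoc)
    also have "\<dots> = (\<Sum>k<n. \<Sum>i<d. u i * x k i * ip d v (x k))" by (rule sum.swap)
    also have "\<dots> = (\<Sum>k<n. ip d u (x k) * ip d v (x k))" by (simp add: ip_def[of d u] sum_distrib_right)
    finally show ?thesis .
  qed
  have M: "(\<lambda>i j. sample_cov n x i j - S i j) = (\<lambda>i j. (1 / real n) * (\<Sum>k<n. x k i * x k j) + (- 1) * S i j)"
    by (simp add: sample_cov_def)
  have "ip d u (mv d (\<lambda>i j. sample_cov n x i j - S i j) v)
      = (1 / real n) * (\<Sum>k<n. ip d u (x k) * ip d v (x k)) - ip d u (mv d S v)"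
    unfolding M mv_add mv_scale ip_add_right ip_scale_right 1 2 by simp
  then show ?thesis using assms by (simp add: dev_form_def sum_subtractf field_simps)
qed

lemma sample_cov_concentration:
  fixes \<sigma> r \<delta> :: real
  assumes n: "0 < n" and \<delta>: "0 < \<delta>" "\<delta> \<le> 1/4" and \<sigma>: "0 < \<sigma>" and r: "1 \<le> r"
    and L: "r + ln (1 / \<delta>) \<le> real n" and \<Sigma>: "\<Sigma> \<in> cov_class d \<sigma> r"
  shows "\<exists>A \<in> sets (normal_sample n d \<Sigma>).
     1 - \<delta> \<le> measure (normal_sample n d \<Sigma>) A \<and>
     (\<forall>x\<in>A. op_bound d (\<lambda>i j. sample_cov n x i j - \<Sigma> $$ (i, j)) (72 * (\<sigma>\<^sup>2 * sqrt ((r + ln (1 / \<delta>)) / real n))))"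
proof -
  define \<Lambda> where "\<Lambda> = r + ln (1 / \<delta>)"
  define w where "w = sqrt (\<Lambda> / real n)"
  have ln0: "0 \<le> ln (1 / \<delta>)" using \<delta> by (intro ln_ge_zero) simp
  have pos: "0 < \<Lambda>" "0 < w" using r ln0 n by (auto simp: \<Lambda>_def w_def)
  have w1: "w \<le> 1" using L n by (simp add: w_def \<Lambda>_def)
  have w2: "w\<^sup>2 = \<Lambda> / real n" using pos n by (simp add: w_def)
  \<comment> \<open>The choices are \<open>b = 2 r\<close> and
    \<open>R = 2 r \<sigma>\<^sup>2\<close>, and \<open>\<mu>\<close> is set so that
    \<open>\<mu> * 16 R = w / 2\<close>. The admissible range \<open>1/2\<close> of the exponential
    moment then reads \<open>w \<le> 1\<close>, which holds because
    \<open>r + ln (1 / \<delta>) \<le> n\<close>.\<close>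
  define \<mu> where "\<mu> = w / (32 * \<sigma>\<^sup>2) / (2 * r)"
  have \<mu>: "0 < \<mu>" "\<mu> * (16 * (2 * r * \<sigma>\<^sup>2)) = w / 2" using pos r \<sigma> by (simp_all add: \<mu>_def field_simps)
  have psd: "\<Sigma> \<in> psd_mats d" using \<Sigma> by (simp add: cov_class_def)
  have "\<exists>A \<in> sets (normal_sample n d \<Sigma>).
     1 - \<delta> \<le> measure (normal_sample n d \<Sigma>) A \<and>
     (\<forall>x\<in>A. \<forall>u v. nrm d u \<le> 1 \<longrightarrow> nrm d v \<le> 1 \<longrightarrow>
        \<mu> * (2 * r) * dev_form n d (entries \<Sigma>) x u v
          \<le> ln (4 / \<delta>) + 2 * r + real n * (\<mu>\<^sup>2 * (16 * (2 * r * \<sigma>\<^sup>2))\<^sup>2))"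
  proof (rule dev_form_uniform[OF psd])
    show "(\<Sum>i<d. \<Sigma> $$ (i, i)) \<le> 2 * r * \<sigma>\<^sup>2 / 2" using cov_class_trace[OF \<Sigma>] r by simp
    show "2 * r * ip d u (mv d (entries \<Sigma>) u) \<le> 2 * r * \<sigma>\<^sup>2" if "nrm d u \<le> 1" for u
      using cov_class_quad[OF \<Sigma> that] r by simp
    show "\<mu> * (16 * (2 * r * \<sigma>\<^sup>2)) \<le> 1/2" unfolding \<mu>(2) using w1 by simp
  qed (use r \<sigma> \<delta> \<mu> in auto)
  then obtain A where A: "A \<in> sets (normal_sample n d \<Sigma>)"
    "1 - \<delta> \<le> measure (normal_sample n d \<Sigma>) A"
    and dev: "\<And>x u v. x \<in> A \<Longrightarrow> nrm d u \<le> 1 \<Longrightarrow> nrm d v \<le> 1 \<Longrightarrow>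
        \<mu> * (2 * r) * dev_form n d (entries \<Sigma>) x u v
          \<le> ln (4 / \<delta>) + 2 * r + real n * (\<mu>\<^sup>2 * (16 * (2 * r * \<sigma>\<^sup>2))\<^sup>2)"
    by blast
  have "op_bound d (\<lambda>i j. sample_cov n x i j - \<Sigma> $$ (i, j)) (72 * (\<sigma>\<^sup>2 * w))" if x: "x \<in> A" for x
  proof (rule op_bound_bilinear)
    fix u v assume uv: "nrm d u \<le> 1" "nrm d v \<le> 1"
    let ?D = "dev_form n d (entries \<Sigma>) x u v"
    have "ln (4 / \<delta>) \<le> 2 * ln (1 / \<delta>)"
    proof -
      have "ln (4 / \<delta>) = ln 4 + ln (1 / \<delta>)" using \<delta> by (simp add: ln_div)
      moreover have "ln 4 \<le> ln (1 / \<delta>)" using \<delta> by (subst ln_le_cancel_iff) (auto simp: field_simps)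
      ultimately show ?thesis by simp
    qed
    moreover have "real n * (\<mu>\<^sup>2 * (16 * (2 * r * \<sigma>\<^sup>2))\<^sup>2) = \<Lambda> / 4"
      unfolding power_mult_distrib[symmetric] \<mu>(2) using w2 n by (simp add: power_divide)
    \<comment> \<open>The three terms are at most \<open>2 ln (1 / \<delta>)\<close>,
      \<open>2 r\<close> and \<open>\<Lambda> / 4\<close>, hence \<open>9/4\<close>. Clearing the
      factor \<open>w / (32 \<sigma>\<^sup>2)\<close> then gives the constant
      \<open>72 = 32 * 9/4\<close>.\<close>
    ultimately have "\<mu> * (2 * r) * ?D \<le> 9 / 4 * \<Lambda>" using dev[OF x uv] by (simp add: \<Lambda>_def)
    moreover have "\<mu> * (2 * r) = w / (32 * \<sigma>\<^sup>2)" using r by (simp add: \<mu>_def)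
    ultimately have "w / (32 * \<sigma>\<^sup>2) * ?D \<le> 9 / 4 * \<Lambda>" by simp
    then have "w / (32 * \<sigma>\<^sup>2) * ?D * (32 * \<sigma>\<^sup>2) \<le> 9 / 4 * \<Lambda> * (32 * \<sigma>\<^sup>2)"
      by (rule mult_right_mono) simp
    then have "w * ?D \<le> 72 * \<sigma>\<^sup>2 * \<Lambda>" using \<sigma> by (simp add: mult.commute)
    also have "\<dots> = 72 * \<sigma>\<^sup>2 * (w\<^sup>2 * real n)" using w2 n by simp
    finally have "w * ?D \<le> w * (72 * (\<sigma>\<^sup>2 * w) * real n)" by (simp add: power2_eq_square algebra_simps)
    then have "?D \<le> 72 * (\<sigma>\<^sup>2 * w) * real n" using pos(2) by simp
    then show "ip d u (mv d (\<lambda>i j. sample_cov n x i j - \<Sigma> $$ (i, j)) v) \<le> 72 * (\<sigma>\<^sup>2 * w)"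
      unfolding dev_form_sample_cov[OF n] using n by (simp add: field_simps)
  qed (use pos \<sigma> in simp)
  with A show ?thesis unfolding w_def \<Lambda>_def by blast
qed

subsection \<open>A measurable estimator with values in the parameter space\<close>

lemma space_pseudometric_borel [simp]: "space (pseudometric_borel \<Theta> \<rho>) = \<Theta>"
  unfolding pseudometric_borel_def by (rule space_measure_of) auto

lemma measurable_map_count_space:
  fixes f :: "'b \<Rightarrow> 'a \<Rightarrow> 'c :: countable"
  assumes "\<And>i. i \<in> set xs \<Longrightarrow> f i \<in> measurable M (count_space UNIV)"
  shows "(\<lambda>x. map (\<lambda>i. f i x) xs) \<in> measurable M (count_space UNIV)"
  using assms
proof (induction xs)
  case (Cons i xs)
  have m: "(\<lambda>x. f i x # l) \<in> measurable M (count_space UNIV)" for l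
    by (rule measurable_compose[of "f i" _ "count_space UNIV"]) (use Cons.prems in auto)
  have "(\<lambda>x. f i x # map (\<lambda>i. f i x) xs) \<in> measurable M (count_space UNIV)"
    by (rule measurable_compose_countable[where f = "\<lambda>l x. f i x # l" and g = "\<lambda>x. map (\<lambda>i. f i x) xs"])
       (use m Cons in auto)
  then show ?case by simp
qed simp

text \<open>Lists of integers form a countable type carrying the discrete sigma-algebra, so once the
  key is measurable every function of it is.\<close>

definition grid_key :: "nat \<Rightarrow> real \<Rightarrow> (nat \<Rightarrow> nat \<Rightarrow> real) \<Rightarrow> int list list" where
  "grid_key d \<epsilon> A = map (\<lambda>i. map (\<lambda>j. \<lfloor>A i j / \<epsilon>\<rfloor>) [0..<d]) [0..<d]"

definition grid_mat :: "nat \<Rightarrow> real \<Rightarrow> int list list \<Rightarrow> real mat" where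
  "grid_mat d \<epsilon> l = mat d d (\<lambda>(i, j). \<epsilon> * of_int (l ! i ! j))"

lemma op_bound_grid_mat:
  assumes \<epsilon>: "0 < \<epsilon>"
  shows "op_bound d (\<lambda>i j. entries (grid_mat d \<epsilon> (grid_key d \<epsilon> A)) i j - A i j) (real d * real d * \<epsilon>)"
proof (rule op_bound_mono[OF op_bound_sum_entries])
  have "\<bar>entries (grid_mat d \<epsilon> (grid_key d \<epsilon> A)) i j - A i j\<bar> \<le> \<epsilon>" if "i < d" "j < d" for i j
  proof -
    have "of_int \<lfloor>A i j / \<epsilon>\<rfloor> \<le> A i j / \<epsilon>" "A i j / \<epsilon> < of_int \<lfloor>A i j / \<epsilon>\<rfloor> + 1" by linarith+
    from mult_left_mono[OF this(1), of \<epsilon>] mult_strict_left_mono[OF this(2) \<epsilon>]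
    have "\<epsilon> * of_int \<lfloor>A i j / \<epsilon>\<rfloor> \<le> A i j" "A i j \<le> \<epsilon> * of_int \<lfloor>A i j / \<epsilon>\<rfloor> + \<epsilon>"
      using \<epsilon> by (simp_all add: distrib_left)
    then show ?thesis using that by (simp add: grid_mat_def grid_key_def)
  qed
  then have "(\<Sum>i<d. \<Sum>j<d. \<bar>entries (grid_mat d \<epsilon> (grid_key d \<epsilon> A)) i j - A i j\<bar>) \<le> (\<Sum>i<d. \<Sum>j<d. \<epsilon>)"
    by (intro sum_mono) auto
  then show "(\<Sum>i<d. \<Sum>j<d. \<bar>entries (grid_mat d \<epsilon> (grid_key d \<epsilon> A)) i j - A i j\<bar>) \<le> real d * real d * \<epsilon>"
    by (simp add: mult.assoc)
qed

text \<open>The effective rank of the zero matrix is 0 by the convention for \<open>0/0\<close>. The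
  matrix serves as default value of the rounded estimator and as the whole estimator when the sample
  is too small.\<close>

lemma zero_in_cov_class: "0 \<le> r \<Longrightarrow> 0\<^sub>m d d \<in> cov_class d \<sigma> r"
proof -
  assume r: "0 \<le> r"
  have "op_bound d (entries (0\<^sub>m d d)) 0"
    by (auto simp: op_bound_def mv_def L2_set_def)
  then have "op_norm (0\<^sub>m d d) \<le> 0" by (intro op_norm_le) auto
  moreover have "tr (0\<^sub>m d d) = 0" by (simp add: tr_def)
  moreover have "0\<^sub>m d d \<in> psd_mats d" by (auto simp: psd_mats_iff sym_entries_def ip_def mv_def)
  moreover have "op_norm (0\<^sub>m d d) \<le> \<sigma>\<^sup>2" using calculation(1) by (simp add: order.trans)
  ultimately show ?thesis using r by (simp add: cov_class_def effective_rank_def)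
qed

text \<open>
  The sample covariance need not lie in the parameter space. It is rounded to a grid, which leaves
  countably many values, and each grid point is replaced by a nearby parameter. Hence no
  measurable selection is needed.
\<close>

lemma rounded_estimator:
  fixes \<Theta> :: "real mat set"
  assumes \<Theta>: "\<Theta> \<subseteq> carrier_mat d d" and ne: "\<Sigma>0 \<in> \<Theta>" and t: "0 < t" and d: "0 < d"
  obtains est where "est \<in> measurable (sample_space n d) (pseudometric_borel \<Theta> op_loss)"
    "\<And>\<Sigma> s. {x \<in> space (sample_space n d). op_loss (est x) \<Sigma> \<le> s} \<in> sets (sample_space n d)"
    "\<And>x \<Sigma>. \<Sigma> \<in> \<Theta> \<Longrightarrow> op_bound d (\<lambda>i j. sample_cov n x i j - \<Sigma> $$ (i, j)) t \<Longrightarrow> op_loss (est x) \<Sigma> \<le> 4 * t"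
proof -
  \<comment> \<open>There are \<open>d * d\<close> entries, each rounded by at most
    \<open>\<epsilon>\<close>, so rounding moves the matrix by at most \<open>t\<close> in operator
    norm.\<close>
  define \<epsilon> where "\<epsilon> = t / (real d * real d)"
  have \<epsilon>: "0 < \<epsilon>" "real d * real d * \<epsilon> = t" using t d by (simp_all add: \<epsilon>_def)
  \<comment> \<open>If the sample covariance is within \<open>t\<close> of the true parameter, its
    grid point is within \<open>2 * t\<close>, so the search succeeds. The parameter found is within
    another \<open>2 * t\<close>, which gives \<open>4 * t\<close> in total.\<close>
  define h where "h l = (if \<exists>\<Sigma>\<in>\<Theta>. op_loss (grid_mat d \<epsilon> l) \<Sigma> \<le> 2 * t
      then SOME \<Sigma>. \<Sigma> \<in> \<Theta> \<and> op_loss (grid_mat d \<epsilon> l) \<Sigma> \<le> 2 * t else \<Sigma>0)" for l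
  have h: "h l \<in> \<Theta>" "\<Sigma> \<in> \<Theta> \<Longrightarrow> op_loss (grid_mat d \<epsilon> l) \<Sigma> \<le> 2 * t \<Longrightarrow> op_loss (grid_mat d \<epsilon> l) (h l) \<le> 2 * t" for l \<Sigma>
    unfolding h_def using ne by (auto intro: someI2)
  let ?key = "\<lambda>x. grid_key d \<epsilon> (sample_cov n x)"
  have key: "?key \<in> measurable (sample_space n d) (count_space UNIV)"
    unfolding grid_key_def
  proof (rule measurable_map_count_space, rule measurable_map_count_space)
    fix i j assume "i \<in> set [0..<d]" "j \<in> set [0..<d]"
    then have ij: "i < d" "j < d" by auto
    have comp: "(\<lambda>x. x k i) \<in> borel_measurable (sample_space n d)" if "k < n" "i < d" for k i
      unfolding sample_space_def
      by (rule measurable_compose[OF measurable_component_singleton[of k] measurable_component_singleton[of i]])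
         (use that in auto)
    have "(\<lambda>x. sample_cov n x i j / \<epsilon>) \<in> borel_measurable (sample_space n d)"
      unfolding sample_cov_def
      by (intro borel_measurable_divide borel_measurable_sum borel_measurable_times borel_measurable_const comp) (use ij in auto)
    then show "(\<lambda>x. \<lfloor>sample_cov n x i j / \<epsilon>\<rfloor>) \<in> measurable (sample_space n d) (count_space UNIV)"
      by measurable
  qed
  show ?thesis
  proof
    show "(\<lambda>x. h (?key x)) \<in> measurable (sample_space n d) (pseudometric_borel \<Theta> op_loss)"
      by (rule measurable_compose[OF key]) (use h(1) in auto)
    show "{x \<in> space (sample_space n d). op_loss (h (?key x)) \<Sigma> \<le> s} \<in> sets (sample_space n d)" for \<Sigma> s
      using measurable_sets[OF key, of "{l. op_loss (h l) \<Sigma> \<le> s}"]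
      by (simp add: vimage_def Int_def conj_commute)
    fix x \<Sigma> assume \<Sigma>: "\<Sigma> \<in> \<Theta>" and b: "op_bound d (\<lambda>i j. sample_cov n x i j - \<Sigma> $$ (i, j)) t"
    let ?g = "grid_mat d \<epsilon> (?key x)"
    have c: "?g \<in> carrier_mat d d" "\<Sigma> \<in> carrier_mat d d" "h (?key x) \<in> carrier_mat d d"
      using \<Theta> \<Sigma> h(1) by (auto simp: grid_mat_def)
    have "op_loss ?g \<Sigma> \<le> 2 * t"
      unfolding op_loss_def
    proof (rule op_norm_le)
      show "?g - \<Sigma> \<in> carrier_mat d d" using c by (intro minus_carrier_mat)
      have "op_bound d (\<lambda>i j. (entries ?g i j - sample_cov n x i j) + (sample_cov n x i j - \<Sigma> $$ (i, j)))
              (real d * real d * \<epsilon> + t)"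
        by (intro op_bound_add op_bound_grid_mat \<epsilon> b)
      then show "op_bound d (entries (?g - \<Sigma>)) (2 * t)"
        unfolding \<epsilon>(2) by (subst op_bound_cong[where B = "\<lambda>i j. (entries ?g i j - sample_cov n x i j) + (sample_cov n x i j - \<Sigma> $$ (i, j))"])
          (use c in auto)
    qed (use t in simp)
    moreover from this have "op_loss (h (?key x)) ?g \<le> 2 * t"
      using h(2)[OF \<Sigma>, of "?key x"] op_loss_commute[OF c(1,3)] by simp
    ultimately show "op_loss (h (?key x)) \<Sigma> \<le> 4 * t"
      using op_loss_triangle[OF c(3,1,2)] by simp
  qed
qed

lemma minimax_quantile_le:
  assumes est: "est \<in> measurable X T"
    and le: "\<And>\<theta> P. \<theta> \<in> space T \<Longrightarrow> P \<in> \<P> \<theta> \<Longrightarrow> 1 - \<delta> \<le> measure P {x \<in> space X. L (est x) \<theta> \<le> t}"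
    and t: "0 \<le> t"
  shows "minimax_quantile \<delta> X T \<P> L \<le> ennreal t"
  unfolding minimax_quantile_def
  by (rule INF_lower2[OF est], intro SUP_least INF_lower) (use le t in auto)

text \<open>If \<open>r + ln (1 / \<delta>) \<le> n\<close>, the rounded sample covariance has error
  \<open>4 * 72 = 288\<close> times the rate. Otherwise the minimum is
  \<open>\<sigma>\<^sup>2\<close>, and the constant estimator 0 already attains that error.\<close>

lemma minimax_upper_bound:
  fixes \<sigma> r \<delta> :: real
  assumes n: "0 < n" and d: "0 < d" and \<delta>: "0 < \<delta>" "\<delta> \<le> 1/4" and \<sigma>: "0 < \<sigma>" and r: "1 \<le> r"
  shows "minimax_quantile \<delta> (sample_space n d) (pseudometric_borel (cov_class d \<sigma> r) op_loss) (normal_family n d) op_loss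
    \<le> ennreal (288 * min (\<sigma>\<^sup>2 * sqrt ((r + ln (1 / \<delta>)) / real n)) (\<sigma>\<^sup>2))"
    (is "?M \<le> _")
proof (cases "r + ln (1 / \<delta>) \<le> real n")
  case True
  define t where "t = 72 * (\<sigma>\<^sup>2 * sqrt ((r + ln (1 / \<delta>)) / real n))"
  have ln0: "0 \<le> ln (1 / \<delta>)" using \<delta> by (intro ln_ge_zero) simp
  have t: "0 < t" using r ln0 n \<sigma> by (simp add: t_def)
  have s1: "sqrt ((r + ln (1 / \<delta>)) / real n) \<le> 1" using True n by simp
  have "0\<^sub>m d d \<in> cov_class d \<sigma> r" using r by (intro zero_in_cov_class) simp
  moreover have "cov_class d \<sigma> r \<subseteq> carrier_mat d d" by (auto simp: cov_class_def psd_mats_iff)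
  ultimately obtain est where est: "est \<in> measurable (sample_space n d) (pseudometric_borel (cov_class d \<sigma> r) op_loss)"
    "\<And>\<Sigma> s. {x \<in> space (sample_space n d). op_loss (est x) \<Sigma> \<le> s} \<in> sets (sample_space n d)"
    "\<And>x \<Sigma>. \<Sigma> \<in> cov_class d \<sigma> r \<Longrightarrow> op_bound d (\<lambda>i j. sample_cov n x i j - \<Sigma> $$ (i, j)) t \<Longrightarrow> op_loss (est x) \<Sigma> \<le> 4 * t"
    using rounded_estimator[OF _ _ t d, of "cov_class d \<sigma> r" "0\<^sub>m d d" n] by blast
  have "?M \<le> ennreal (4 * t)"
  proof (rule minimax_quantile_le[OF est(1)])
    fix \<Sigma> P assume "\<Sigma> \<in> space (pseudometric_borel (cov_class d \<sigma> r) op_loss)" "P \<in> normal_family n d \<Sigma>"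
    then have \<Sigma>: "\<Sigma> \<in> cov_class d \<sigma> r" and P: "P = normal_sample n d \<Sigma>"
      by (auto simp: normal_family_def)
    interpret P: prob_space P unfolding P by (rule prob_space_PiM_centred_normal)
    obtain A where A: "A \<in> sets P" "1 - \<delta> \<le> measure P A"
      "\<And>x. x \<in> A \<Longrightarrow> op_bound d (\<lambda>i j. sample_cov n x i j - \<Sigma> $$ (i, j)) t"
      using sample_cov_concentration[OF n \<delta> \<sigma> r True \<Sigma>] unfolding P t_def by blast
    have spP: "space P = space (sample_space n d)" unfolding P by (rule space_PiM_centred_normal)
    have "measure P A \<le> measure P {x \<in> space (sample_space n d). op_loss (est x) \<Sigma> \<le> 4 * t}"
    proof (rule P.finite_measure_mono)
      show "A \<subseteq> {x \<in> space (sample_space n d). op_loss (est x) \<Sigma> \<le> 4 * t}"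
        using A(3) est(3)[OF \<Sigma>] sets.sets_into_space[OF A(1)] spP by auto
      show "{x \<in> space (sample_space n d). op_loss (est x) \<Sigma> \<le> 4 * t} \<in> sets P"
        using est(2) unfolding P sets_PiM_centred_normal sample_space_def .
    qed
    with A(2) show "1 - \<delta> \<le> measure P {x \<in> space (sample_space n d). op_loss (est x) \<Sigma> \<le> 4 * t}" by simp
  qed (use t in simp)
  also have "4 * t = 288 * min (\<sigma>\<^sup>2 * sqrt ((r + ln (1 / \<delta>)) / real n)) (\<sigma>\<^sup>2)"
    using s1 \<sigma> by (simp add: t_def min_def mult_le_cancel_left1)
  finally show ?thesis .
next
  case False
  have s1: "1 \<le> sqrt ((r + ln (1 / \<delta>)) / real n)" using False n by simp
  have zero: "0\<^sub>m d d \<in> cov_class d \<sigma> r" using r by (intro zero_in_cov_class) simp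
  have "?M \<le> ennreal (\<sigma>\<^sup>2)"
  proof (rule minimax_quantile_le[where est = "\<lambda>_. 0\<^sub>m d d"])
    fix \<Sigma> P assume "\<Sigma> \<in> space (pseudometric_borel (cov_class d \<sigma> r) op_loss)" "P \<in> normal_family n d \<Sigma>"
    then have \<Sigma>: "\<Sigma> \<in> cov_class d \<sigma> r" and P: "P = normal_sample n d \<Sigma>"
      by (auto simp: normal_family_def)
    interpret P: prob_space P unfolding P by (rule prob_space_PiM_centred_normal)
    have c: "\<Sigma> \<in> carrier_mat d d" "op_norm \<Sigma> \<le> \<sigma>\<^sup>2" using \<Sigma> by (auto simp: cov_class_def psd_mats_iff)
    have "op_loss (0\<^sub>m d d) \<Sigma> = op_loss \<Sigma> (0\<^sub>m d d)" by (rule op_loss_commute) (use c in auto)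
    also have "\<dots> \<le> op_norm \<Sigma>" unfolding op_loss_def
    proof (rule op_norm_le)
      show "op_bound d (entries (\<Sigma> - 0\<^sub>m d d)) (op_norm \<Sigma>)"
        by (subst op_bound_cong[where B = "entries \<Sigma>"]) (use c op_bound_op_norm in auto)
    qed (use c op_norm_nonneg in \<open>auto intro: minus_carrier_mat\<close>)
    finally have "{x \<in> space (sample_space n d). op_loss (0\<^sub>m d d) \<Sigma> \<le> \<sigma>\<^sup>2} = space P"
      using c unfolding P space_PiM_centred_normal by auto
    then show "1 - \<delta> \<le> measure P {x \<in> space (sample_space n d). op_loss (0\<^sub>m d d) \<Sigma> \<le> \<sigma>\<^sup>2}"
      using \<delta> by (simp add: P.prob_space)
  qed (use zero in auto)
  also have "ennreal (\<sigma>\<^sup>2) \<le> ennreal (288 * min (\<sigma>\<^sup>2 * sqrt ((r + ln (1 / \<delta>)) / real n)) (\<sigma>\<^sup>2))"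
    using s1 \<sigma> by (intro ennreal_leI) (simp add: min_def mult_le_cancel_left1)
  finally show ?thesis .
qed

subsection \<open>Testing two hypotheses\<close>

text \<open>
  The integral of \<open>sqrt (f * g)\<close> is the Hellinger affinity of the two laws; it is split along \<open>A\<close>
  and its complement before the Cauchy--Schwarz inequality is applied.
\<close>

lemma testing_affinity:
  fixes f g :: "'a \<Rightarrow> real"
  assumes f[measurable]: "f \<in> borel_measurable R" and g[measurable]: "g \<in> borel_measurable R"
    and f0: "\<And>x. 0 \<le> f x" and g0: "\<And>x. 0 \<le> g x"
    and P: "prob_space (density R (\<lambda>x. ennreal (f x)))" and Q: "prob_space (density R (\<lambda>x. ennreal (g x)))"
    and A[measurable]: "A \<in> sets R"
    and \<rho>: "0 \<le> \<rho>" "ennreal \<rho> \<le> (\<integral>\<^sup>+x. ennreal (sqrt (f x * g x)) \<partial>R)"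
  shows "(measure (density R (\<lambda>x. ennreal (f x))) A - measure (density R (\<lambda>x. ennreal (g x))) A)\<^sup>2 \<le> 1 - \<rho>\<^sup>2"
proof -
  let ?P = "density R (\<lambda>x. ennreal (f x))" and ?Q = "density R (\<lambda>x. ennreal (g x))"
  interpret P: prob_space ?P by fact
  interpret Q: prob_space ?Q by fact
  have part: "(\<integral>\<^sup>+x. ennreal (sqrt (f x * g x)) * indicator B x \<partial>R) \<le> ennreal (sqrt (measure ?P B * measure ?Q B))"
    if [measurable]: "B \<in> sets R" for B
  proof -
    let ?I = "\<integral>\<^sup>+x. ennreal (sqrt (f x * g x)) * indicator B x \<partial>R"
    have "?I = (\<integral>\<^sup>+x. (ennreal (sqrt (f x)) * indicator B x) * (ennreal (sqrt (g x)) * indicator B x) \<partial>R)"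
      by (rule nn_integral_cong) (simp add: real_sqrt_mult ennreal_mult f0 g0 indicator_def)
    then have "?I\<^sup>2 \<le> (\<integral>\<^sup>+x. (ennreal (sqrt (f x)) * indicator B x)\<^sup>2 \<partial>R) * (\<integral>\<^sup>+x. (ennreal (sqrt (g x)) * indicator B x)\<^sup>2 \<partial>R)"
      using Cauchy_Schwarz_nn_integral[of "\<lambda>x. ennreal (sqrt (f x)) * indicator B x" R "\<lambda>x. ennreal (sqrt (g x)) * indicator B x"]
      by simp
    also have "(\<integral>\<^sup>+x. (ennreal (sqrt (f x)) * indicator B x)\<^sup>2 \<partial>R) = emeasure ?P B"
      by (subst emeasure_density) (auto intro!: nn_integral_cong simp: ennreal_power f0 indicator_def)
    also have "(\<integral>\<^sup>+x. (ennreal (sqrt (g x)) * indicator B x)\<^sup>2 \<partial>R) = emeasure ?Q B"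
      by (subst emeasure_density) (auto intro!: nn_integral_cong simp: ennreal_power g0 indicator_def)
    also have "emeasure ?P B * emeasure ?Q B = ennreal (measure ?P B * measure ?Q B)"
      by (simp add: P.emeasure_eq_measure Q.emeasure_eq_measure ennreal_mult)
    finally have le: "?I\<^sup>2 \<le> ennreal (measure ?P B * measure ?Q B)" .
    show ?thesis
    proof (cases ?I rule: ennreal_cases)
      case (real r)
      then have "r\<^sup>2 \<le> measure ?P B * measure ?Q B" using le by (simp add: ennreal_power)
      then have "r \<le> sqrt (measure ?P B * measure ?Q B)" using real_le_rsqrt by blast
      then show ?thesis using real by (simp add: ennreal_leI)
    next
      case top
      then show ?thesis using le by (simp add: power2_eq_square top_unique)
    qed
  qed
  let ?C = "space R - A"
  have "(\<integral>\<^sup>+x. ennreal (sqrt (f x * g x)) \<partial>R)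
      = (\<integral>\<^sup>+x. ennreal (sqrt (f x * g x)) * indicator A x + ennreal (sqrt (f x * g x)) * indicator ?C x \<partial>R)"
    by (rule nn_integral_cong) (auto simp: indicator_def)
  also have "\<dots> = (\<integral>\<^sup>+x. ennreal (sqrt (f x * g x)) * indicator A x \<partial>R) + (\<integral>\<^sup>+x. ennreal (sqrt (f x * g x)) * indicator ?C x \<partial>R)"
    by (rule nn_integral_add) measurable
  also have "\<dots> \<le> ennreal (sqrt (measure ?P A * measure ?Q A)) + ennreal (sqrt (measure ?P ?C * measure ?Q ?C))"
    by (intro add_mono part) auto
  also have "\<dots> = ennreal (sqrt (measure ?P A * measure ?Q A) + sqrt (measure ?P ?C * measure ?Q ?C))"
    by (simp add: ennreal_plus)
  finally have "ennreal \<rho> \<le> ennreal (sqrt (measure ?P A * measure ?Q A) + sqrt (measure ?P ?C * measure ?Q ?C))"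
    using \<rho>(2) by simp
  then have le: "\<rho> \<le> sqrt (measure ?P A * measure ?Q A) + sqrt (measure ?P ?C * measure ?Q ?C)"
    by (subst (asm) ennreal_le_iff) auto
  have C: "measure ?P ?C = 1 - measure ?P A" "measure ?Q ?C = 1 - measure ?Q A"
    using P.prob_compl[of A] Q.prob_compl[of A] by auto
  define a b where "a = measure ?P A" and "b = measure ?Q A"
  have ab: "0 \<le> a" "a \<le> 1" "0 \<le> b" "b \<le> 1" by (auto simp: a_def b_def)
  define x y where "x = sqrt (a * b)" and "y = sqrt ((1 - a) * (1 - b))"
  have "\<rho>\<^sup>2 \<le> (x + y)\<^sup>2" using le \<rho>(1) unfolding C x_def y_def a_def b_def by (intro power_mono) auto
  also have "\<dots> = a * b + (1 - a) * (1 - b) + 2 * (x * y)"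
    using ab by (simp add: power2_sum x_def y_def)
  \<comment> \<open>Regrouping the four factors by measure instead of by event gives a bound for
    which the right-hand side becomes exactly \<open>1 - (a - b)\<^sup>2\<close>.\<close>
  also have "2 * (x * y) \<le> a * (1 - a) + b * (1 - b)"
  proof -
    have "x * y = sqrt (a * (1 - a)) * sqrt (b * (1 - b))"
      by (simp add: x_def y_def real_sqrt_mult)
    also have "2 * \<dots> \<le> (sqrt (a * (1 - a)))\<^sup>2 + (sqrt (b * (1 - b)))\<^sup>2"
      using sum_squares_bound[of "sqrt (a * (1 - a))" "sqrt (b * (1 - b))"] by simp
    finally show ?thesis using ab by simp
  qed
  finally show ?thesis
    unfolding a_def[symmetric] b_def[symmetric] by (simp add: power2_eq_square algebra_simps)
qed

text \<open>A singular normal law is the image under \<open>\<tau>\<close> of a law with density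
  \<open>f\<close> on a reference measure; this carries the representation over to \<open>n\<close>
  independent observations.\<close>

lemma PiM_distr_density:
  fixes f :: "'a \<Rightarrow> real" and n :: nat
  assumes R: "sigma_finite_measure R" and f[measurable]: "f \<in> borel_measurable R" and f0: "\<And>x. 0 \<le> f x"
    and \<tau>[measurable]: "\<tau> \<in> measurable R N" and M: "prob_space M" "M = distr (density R (\<lambda>x. ennreal (f x))) N \<tau>"
  shows "PiM {..<n} (\<lambda>_. M) = distr (density (PiM {..<n} (\<lambda>_. R)) (\<lambda>x. ennreal (\<Prod>k<n. f (x k))))
           (PiM {..<n} (\<lambda>_. N)) (\<lambda>x. \<lambda>k\<in>{..<n}. \<tau> (x k))"
proof -
  have sM: "sets M = sets N" using M by simp
  have sPi: "sets (PiM {..<n} (\<lambda>_. M)) = sets (PiM {..<n} (\<lambda>_. N))" by (intro sets_PiM_cong sM refl)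
  have "distr (density (PiM {..<n} (\<lambda>_. R)) (\<lambda>x. \<Prod>k<n. ennreal (f (x k)))) (PiM {..<n} (\<lambda>_. M)) (\<lambda>x. \<lambda>k\<in>{..<n}. \<tau> (x k))
     = PiM {..<n} (\<lambda>_. M)"
  proof (rule PiM_transform)
    show "product_sigma_finite (\<lambda>_. R)" "product_sigma_finite (\<lambda>_. M)"
      using R M(1) by (auto intro!: product_sigma_finite.intro prob_space_imp_sigma_finite)
    show "\<tau> \<in> measurable R M" using \<tau> by (simp add: measurable_cong_sets[OF refl sM])
    show "distr (density R (\<lambda>x. ennreal (f x))) M \<tau> = M"
      by (subst (2) M(2)) (rule distr_cong, simp_all add: sM)
  qed auto
  also have "distr (density (PiM {..<n} (\<lambda>_. R)) (\<lambda>x. \<Prod>k<n. ennreal (f (x k)))) (PiM {..<n} (\<lambda>_. M)) (\<lambda>x. \<lambda>k\<in>{..<n}. \<tau> (x k))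
     = distr (density (PiM {..<n} (\<lambda>_. R)) (\<lambda>x. ennreal (\<Prod>k<n. f (x k)))) (PiM {..<n} (\<lambda>_. N)) (\<lambda>x. \<lambda>k\<in>{..<n}. \<tau> (x k))"
    by (rule distr_cong) (simp_all add: sPi prod_ennreal f0)
  finally show ?thesis ..
qed

text \<open>The affinity of product densities is the product of the affinities. Both hypotheses
  share the map \<open>\<tau>\<close>, so an event for the sample pulls back to a single event on
  the reference space.\<close>

lemma testing_affinity_PiM:
  fixes f g :: "'a \<Rightarrow> real" and n :: nat
  assumes R: "sigma_finite_measure R"
    and f[measurable]: "f \<in> borel_measurable R" and g[measurable]: "g \<in> borel_measurable R"
    and f0: "\<And>x. 0 \<le> f x" and g0: "\<And>x. 0 \<le> g x"
    and \<tau>[measurable]: "\<tau> \<in> measurable R N"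
    and P: "prob_space P" "P = distr (density R (\<lambda>x. ennreal (f x))) N \<tau>"
    and Q: "prob_space Q" "Q = distr (density R (\<lambda>x. ennreal (g x))) N \<tau>"
    and \<rho>: "0 \<le> \<rho>" "ennreal \<rho> \<le> (\<integral>\<^sup>+x. ennreal (sqrt (f x * g x)) \<partial>R)"
    and A: "A \<in> sets (PiM {..<n} (\<lambda>_. N))"
  shows "(measure (PiM {..<n} (\<lambda>_. P)) A - measure (PiM {..<n} (\<lambda>_. Q)) A)\<^sup>2 \<le> 1 - (\<rho> ^ n)\<^sup>2"
proof -
  let ?R = "PiM {..<n} (\<lambda>_. R)" and ?N = "PiM {..<n} (\<lambda>_. N)"
  let ?F = "\<lambda>x. \<Prod>k<n. f (x k)" and ?G = "\<lambda>x. \<Prod>k<n. g (x k)"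
  let ?t = "\<lambda>x. \<lambda>k\<in>{..<n}. \<tau> (x k)"
  have tm: "?t \<in> measurable ?R ?N" by measurable
  have vs: "?t -` space ?N \<inter> space ?R = space ?R" using measurable_space[OF tm] by blast
  note eqs = PiM_distr_density[OF R f f0 \<tau> P] PiM_distr_density[OF R g g0 \<tau> Q]
  have pr: "prob_space (density ?R (\<lambda>x. ennreal (h x)))"
    if "prob_space M" "PiM {..<n} (\<lambda>_. M) = distr (density ?R (\<lambda>x. ennreal (h x))) ?N ?t" for h M
  proof (rule prob_spaceI)
    interpret prob_space "PiM {..<n} (\<lambda>_. M)" using that(1) by (intro prob_space_PiM)
    have "1 = emeasure (PiM {..<n} (\<lambda>_. M)) (space (PiM {..<n} (\<lambda>_. M)))" by (simp only: emeasure_space_1)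
    also have "\<dots> = emeasure (density ?R (\<lambda>x. ennreal (h x))) (space (density ?R (\<lambda>x. ennreal (h x))))"
      unfolding that(2) using tm by (subst emeasure_distr) (simp_all add: vs)
    finally show "emeasure (density ?R (\<lambda>x. ennreal (h x))) (space (density ?R (\<lambda>x. ennreal (h x)))) = 1" ..
  qed
  have ms: "measure (distr (density ?R (\<lambda>x. ennreal (h x))) ?N ?t) A = measure (density ?R (\<lambda>x. ennreal (h x))) (?t -` A \<inter> space ?R)" for h
    using A tm by (subst measure_distr) auto
  have "ennreal (\<rho> ^ n) = ennreal \<rho> ^ n" using \<rho>(1) by (simp add: ennreal_power)
  also have "\<dots> \<le> (\<integral>\<^sup>+x. ennreal (sqrt (f x * g x)) \<partial>R) ^ n"
    by (rule ennreal_power_mono[OF \<rho>(2)])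
  also have "\<dots> = (\<Prod>k\<in>{..<n}. \<integral>\<^sup>+x. ennreal (sqrt (f x * g x)) \<partial>R)" by simp
  also have "\<dots> = (\<integral>\<^sup>+x. (\<Prod>k\<in>{..<n}. ennreal (sqrt (f (x k) * g (x k)))) \<partial>?R)"
    by (rule product_sigma_finite.product_nn_integral_prod[symmetric])
       (auto intro: product_sigma_finite.intro R)
  also have "\<dots> = (\<integral>\<^sup>+x. ennreal (sqrt (?F x * ?G x)) \<partial>?R)"
  proof (rule nn_integral_cong)
    fix x
    have "sqrt (?F x * ?G x) = (\<Prod>k<n. sqrt (f (x k) * g (x k)))"
    proof -
      have "sqrt (\<Prod>k<m. c k) = (\<Prod>k<m. sqrt (c k))" for c :: "nat \<Rightarrow> real" and m
        by (induction m) (simp_all add: real_sqrt_mult)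
      then show ?thesis by (simp only: prod.distrib[symmetric])
    qed
    then show "(\<Prod>k\<in>{..<n}. ennreal (sqrt (f (x k) * g (x k)))) = ennreal (sqrt (?F x * ?G x))"
      by (simp add: prod_ennreal f0 g0)
  qed
  finally have aff: "ennreal (\<rho> ^ n) \<le> (\<integral>\<^sup>+x. ennreal (sqrt (?F x * ?G x)) \<partial>?R)" .
  show ?thesis unfolding eqs ms
  proof (rule testing_affinity[OF _ _ _ _ pr[OF P(1) eqs(1)] pr[OF Q(1) eqs(2)] _ _ aff])
    show "?t -` A \<inter> space ?R \<in> sets ?R" by (rule measurable_sets[OF tm A])
  qed (use f0 g0 \<rho>(1) in \<open>auto intro!: prod_nonneg\<close>)
qed

text \<open>If the bound failed, one estimator would have all its quantiles below \<open>c\<close>,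
  and an infimum below \<open>c\<close> has a member below \<open>c\<close>. Lower bounds thus
  become contradictions from a uniformly good estimator.\<close>

lemma minimax_quantile_ge:
  assumes "\<And>est. est \<in> measurable X T \<Longrightarrow>
      (\<And>\<theta> P. \<theta> \<in> space T \<Longrightarrow> P \<in> \<P> \<theta> \<Longrightarrow>
         \<exists>t. 0 \<le> t \<and> t < c \<and> 1 - \<delta> \<le> measure P {x \<in> space X. L (est x) \<theta> \<le> t}) \<Longrightarrow> False"
  shows "ennreal c \<le> minimax_quantile \<delta> X T \<P> L"
  unfolding minimax_quantile_def
proof (rule INF_greatest, rule ccontr)
  fix est assume est: "est \<in> measurable X T"
  let ?S = "\<lambda>\<theta> P. {t. 0 \<le> t \<and> 1 - \<delta> \<le> measure P {x \<in> space X. L (est x) \<theta> \<le> t}}"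
  assume "\<not> ennreal c \<le> (SUP \<theta>\<in>space T. SUP P\<in>\<P> \<theta>. INF t\<in>?S \<theta> P. ennreal t)"
  then have lt: "(SUP \<theta>\<in>space T. SUP P\<in>\<P> \<theta>. INF t\<in>?S \<theta> P. ennreal t) < ennreal c" by simp
  show False
  proof (rule assms[OF est])
    fix \<theta> P assume \<theta>: "\<theta> \<in> space T" "P \<in> \<P> \<theta>"
    have "(INF t\<in>?S \<theta> P. ennreal t) \<le> (SUP \<theta>\<in>space T. SUP P\<in>\<P> \<theta>. INF t\<in>?S \<theta> P. ennreal t)"
      by (intro SUP_upper2[OF \<theta>(1)] SUP_upper2[OF \<theta>(2)] order.refl)
    then have "(INF t\<in>?S \<theta> P. ennreal t) < ennreal c" using lt by (rule le_less_trans)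
    then obtain t where "t \<in> ?S \<theta> P" "ennreal t < ennreal c" unfolding INF_less_iff by blast
    then show "\<exists>t. 0 \<le> t \<and> t < c \<and> 1 - \<delta> \<le> measure P {x \<in> space X. L (est x) \<theta> \<le> t}"
      by (auto simp: ennreal_less_iff)
  qed
qed

text \<open>\<open>measure\<close> is 0 outside the sigma-algebra, so an event of probability at
  least \<open>1 - \<delta> > 0\<close> is automatically measurable. This settles the measurability
  of the loss events in the lower bounds.\<close>

lemma measure_pos_imp_sets: "0 < measure M A \<Longrightarrow> A \<in> sets M"
  by (rule ccontr) (simp add: measure_notin_sets)

lemma sets_sample_space: "sets (sample_space n d) = sets (borel_sample n d)"
  by (simp add: sample_space_def)

subsection \<open>Lower bound from rank-one covariances\<close>

text \<open>The geometric mean of two centred normal densities is a multiple \<open>K\<close> of a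
  third, whose variance is the harmonic mean of the two variances; the integral is therefore
  \<open>K\<close>.\<close>

lemma normal_affinity:
  assumes s: "0 < s" and t: "0 < t"
  shows "(\<integral>\<^sup>+x. ennreal (sqrt (normal_density 0 s x * normal_density 0 t x)) \<partial>lborel)
    = ennreal (sqrt (2 * s * t / (s\<^sup>2 + t\<^sup>2)))"
proof -
  define c where "c = sqrt (2 * s\<^sup>2 * t\<^sup>2 / (s\<^sup>2 + t\<^sup>2))"
  have c2: "c\<^sup>2 = 2 * s\<^sup>2 * t\<^sup>2 / (s\<^sup>2 + t\<^sup>2)" using s t by (simp add: c_def)
  have c: "0 < c" using s t by (simp add: c_def add_pos_pos)
  define K where "K = sqrt (2 * s * t / (s\<^sup>2 + t\<^sup>2))"
  have Kc: "K\<^sup>2 * (s * t) = c\<^sup>2" unfolding c2 K_def using s t by (simp add: power2_eq_square)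
  have pt: "sqrt (normal_density 0 s x * normal_density 0 t x) = K * normal_density 0 c x" for x
  proof (rule real_sqrt_unique)
    have e: "- (x - 0)\<^sup>2 / (2 * s\<^sup>2) + - (x - 0)\<^sup>2 / (2 * t\<^sup>2) = - (x - 0)\<^sup>2 / (2 * c\<^sup>2) + - (x - 0)\<^sup>2 / (2 * c\<^sup>2)"
      unfolding c2 using s t by (simp add: field_simps power2_eq_square)
    have "(K * normal_density 0 c x)\<^sup>2 = K\<^sup>2 / (2 * pi * c\<^sup>2) * (exp (- (x - 0)\<^sup>2 / (2 * c\<^sup>2)) * exp (- (x - 0)\<^sup>2 / (2 * c\<^sup>2)))"
      unfolding normal_density_def by (simp add: power2_eq_square)
    also have "K\<^sup>2 / (2 * pi * c\<^sup>2) = 1 / sqrt (2 * pi * s\<^sup>2) * (1 / sqrt (2 * pi * t\<^sup>2))"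
    proof -
      have "sqrt (2 * pi * s\<^sup>2) * sqrt (2 * pi * t\<^sup>2) = 2 * pi * (s * t)"
      proof -
        have "sqrt (2 * pi * s\<^sup>2) * sqrt (2 * pi * t\<^sup>2) = sqrt ((2 * pi * (s * t))\<^sup>2)"
          unfolding real_sqrt_mult[symmetric] by (simp add: power2_eq_square algebra_simps)
        then show ?thesis using s t by simp
      qed
      moreover have "0 < K" using s t by (simp add: K_def add_pos_pos)
      ultimately show ?thesis unfolding Kc[symmetric] by simp
    qed
    also have "exp (- (x - 0)\<^sup>2 / (2 * c\<^sup>2)) * exp (- (x - 0)\<^sup>2 / (2 * c\<^sup>2)) = exp (- (x - 0)\<^sup>2 / (2 * s\<^sup>2)) * exp (- (x - 0)\<^sup>2 / (2 * t\<^sup>2))"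
      unfolding exp_add[symmetric] e ..
    finally show "(K * normal_density 0 c x)\<^sup>2 = normal_density 0 s x * normal_density 0 t x"
      unfolding normal_density_def by simp
    show "0 \<le> K * normal_density 0 c x" by (simp add: K_def s t less_imp_le)
  qed
  have "(\<integral>\<^sup>+x. ennreal (sqrt (normal_density 0 s x * normal_density 0 t x)) \<partial>lborel)
     = (\<integral>\<^sup>+x. ennreal K * ennreal (normal_density 0 c x) \<partial>lborel)"
    unfolding pt by (simp add: ennreal_mult K_def s t less_imp_le)
  also have "\<dots> = ennreal K * (\<integral>\<^sup>+x. ennreal (normal_density 0 c x) \<partial>lborel)" by (rule nn_integral_cmult) simp
  also have "(\<integral>\<^sup>+x. ennreal (normal_density 0 c x) \<partial>lborel) = 1"
    using prob_space.emeasure_space_1[OF prob_space_normal_density[OF c, of 0]] by (simp add: emeasure_density)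
  finally show ?thesis by (simp add: K_def)
qed

text \<open>For \<open>a > 0\<close> trace and operator norm both equal \<open>a\<close>, so the
  effective rank is 1 and the constraint \<open>r \<ge> 1\<close> is always met.\<close>

definition rank1_cov :: "nat \<Rightarrow> real \<Rightarrow> real mat" where
  "rank1_cov d a = mat d d (\<lambda>(i, j). if i = 0 \<and> j = 0 then a else 0)"

lemma mv_rank1: "0 < d \<Longrightarrow> mv d (\<lambda>i j. if i = 0 \<and> j = 0 then a else 0) x i = (if i = 0 then a * x 0 else 0)"
  by (cases "i = 0") (simp_all add: mv_def if_distrib[of "\<lambda>c. c * _"] cong: if_cong)

lemma rank1_cov_in_class:
  assumes d: "0 < d" and a: "0 < a" "a \<le> \<sigma>\<^sup>2" and r: "1 \<le> r"
  shows "rank1_cov d a \<in> cov_class d \<sigma> r"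
proof -
  have car: "rank1_cov d a \<in> carrier_mat d d" by (simp add: rank1_cov_def)
  have ent: "mv d (entries (rank1_cov d a)) x i = (if i = 0 then a * x 0 else 0)" if "i < d" for x i
  proof -
    have "mv d (entries (rank1_cov d a)) x i = mv d (\<lambda>i j. if i = 0 \<and> j = 0 then a else 0) x i"
      by (rule mv_cong[OF _ that]) (simp add: rank1_cov_def)
    then show ?thesis using mv_rank1[OF d] by simp
  qed
  have "op_bound d (entries (rank1_cov d a)) a"
    unfolding op_bound_def
  proof
    fix x
    have "(\<Sum>i<d. (mv d (entries (rank1_cov d a)) x i)\<^sup>2) = (\<Sum>i<d. if i = 0 then (a * x 0)\<^sup>2 else 0)"
      by (intro sum.cong refl) (simp add: ent)
    then have "nrm d (mv d (entries (rank1_cov d a)) x) = \<bar>a * x 0\<bar>"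
      using d by (simp add: L2_set_def)
    also have "\<dots> = a * \<bar>x 0\<bar>" using a by (simp add: abs_mult)
    also have "\<dots> \<le> a * nrm d (\<lambda>i. \<bar>x i\<bar>)" using a d by (intro mult_left_mono member_le_L2_set) auto
    finally show "nrm d (mv d (entries (rank1_cov d a)) x) \<le> a * nrm d x" by (simp add: L2_set_def)
  qed
  then have "op_norm (rank1_cov d a) \<le> a" using a by (intro op_norm_le[OF car]) auto
  moreover have "a \<le> op_norm (rank1_cov d a)"
    using op_bound_entry[OF op_bound_op_norm[OF car] d d] a d by (simp add: rank1_cov_def)
  ultimately have op: "op_norm (rank1_cov d a) = a" by simp
  have "tr (rank1_cov d a) = (\<Sum>i<d. if i = 0 then a else 0)" by (simp add: tr_def rank1_cov_def)
  then have tr: "tr (rank1_cov d a) = a" using d by simp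
  have psd: "rank1_cov d a \<in> psd_mats d"
    unfolding psd_mats_iff
  proof (intro conjI allI)
    show "sym_entries d (entries (rank1_cov d a))" by (auto simp: sym_entries_def rank1_cov_def)
    fix x
    have "ip d x (mv d (entries (rank1_cov d a)) x) = (\<Sum>i<d. if i = 0 then a * (x 0)\<^sup>2 else 0)"
      unfolding ip_def by (intro sum.cong refl) (simp add: ent power2_eq_square)
    then show "0 \<le> ip d x (mv d (entries (rank1_cov d a)) x)" using a by simp
  qed (rule car)
  show ?thesis using psd op tr a r by (simp add: cov_class_def effective_rank_def)
qed

text \<open>The law lives on a coordinate axis. Writing it as an embedded one-dimensional normal law
  gives it a density on the line, where \<open>normal_affinity\<close> applies.\<close>

lemma centred_normal_rank1:
  assumes d: "0 < d" and a: "0 < a" and psd: "rank1_cov d a \<in> psd_mats d"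
  shows "centred_normal d (rank1_cov d a)
    = distr (density lborel (\<lambda>x. ennreal (normal_density 0 (sqrt a) x))) (borel_vec d)
        (\<lambda>y. \<lambda>i\<in>{..<d}. if i = 0 then y else 0)"
proof -
  let ?B = "\<lambda>(i :: nat) (j :: nat). if i = 0 \<and> j = 0 then sqrt a else 0"
  have "centred_normal d (rank1_cov d a) = distr (gauss {..<d}) (borel_vec d) (\<lambda>z. \<lambda>i\<in>{..<d}. mv d ?B z i)"
  proof (rule centred_normal_eq[OF psd])
    fix i j assume ij: "i < d" "j < d"
    have "(\<Sum>k<d. ?B i k * ?B j k) = (\<Sum>k<d. if k = 0 then (if i = 0 \<and> j = 0 then a else 0) else 0)"
      using a by (intro sum.cong refl) auto
    then show "(\<Sum>k<d. ?B i k * ?B j k) = rank1_cov d a $$ (i, j)" using ij d by (simp add: rank1_cov_def)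
  qed
  also have "\<dots> = distr (gauss {..<d}) (borel_vec d) ((\<lambda>y. \<lambda>i\<in>{..<d}. if i = 0 then y else 0) \<circ> (\<lambda>z. \<Sum>i\<in>{..<d}. ?B 0 i * z i))"
    by (rule distr_cong) (auto simp: mv_def fun_eq_iff)
  also have "\<dots> = distr (distr (gauss {..<d}) borel (\<lambda>z. \<Sum>i\<in>{..<d}. ?B 0 i * z i)) (borel_vec d) (\<lambda>y. \<lambda>i\<in>{..<d}. if i = 0 then y else 0)"
    by (rule distr_distr[symmetric]) measurable
  also have "distr (gauss {..<d}) borel (\<lambda>z. \<Sum>i\<in>{..<d}. ?B 0 i * z i) = distr std_normal_distribution borel (\<lambda>z. L2_set (?B 0) {..<d} * z)"
    by (rule gauss_lin_law) simp
  also have "L2_set (?B 0) {..<d} = sqrt a"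
  proof -
    have "(\<Sum>i<d. (?B 0 i)\<^sup>2) = (\<Sum>i<d. if i = 0 then a else 0)" using a by (intro sum.cong refl) auto
    then show ?thesis using d by (simp add: L2_set_def)
  qed
  also have "distr std_normal_distribution borel (\<lambda>z. sqrt a * z) = density lborel (\<lambda>x. ennreal (normal_density 0 (sqrt a) x))"
  proof -
    interpret S: prob_space std_normal_distribution by (rule prob_space_std_normal)
    have "distributed std_normal_distribution lborel (\<lambda>x. x) std_normal_density"
      by (auto simp: distributed_def distr_id2)
    from S.normal_density_affine[OF this, of "sqrt a" 0] a
    have "distributed std_normal_distribution lborel (\<lambda>x. sqrt a * x) (normal_density 0 (sqrt a))" by simp
    then have "distr std_normal_distribution lborel (\<lambda>x. sqrt a * x) = density lborel (\<lambda>x. ennreal (normal_density 0 (sqrt a) x))"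
      by (simp add: distributed_def)
    moreover have "distr std_normal_distribution lborel (\<lambda>x. sqrt a * x) = distr std_normal_distribution borel (\<lambda>x. sqrt a * x)"
      by (rule distr_cong) auto
    ultimately show ?thesis by simp
  qed
  finally show ?thesis .
qed

text \<open>Testing yields \<open>4 \<delta> (1 - \<delta>)\<close>, which is as large as
  \<open>3/4\<close> at \<open>\<delta> = 1/4\<close>, whereas a bound by \<open>\<delta>\<close> is
  wanted. A fixed power suffices: 10 is the least exponent with \<open>(3/4) ^ k \<le> 1/16\<close>,
  and below \<open>1/16\<close> the factor \<open>4 ^ 10\<close> is absorbed by
  \<open>\<delta> ^ 9\<close>.\<close>

lemma quantile_power_bound:
  fixes \<delta> :: real
  assumes "0 < \<delta>" "\<delta> \<le> 1/4"
  shows "(4 * \<delta> * (1 - \<delta>)) ^ 10 \<le> \<delta>"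
proof (cases "\<delta> \<le> 1/16")
  case True
  have "(4 * \<delta> * (1 - \<delta>)) ^ 10 \<le> (4 * \<delta>) ^ 10"
    using assms by (intro power_mono mult_left_le) auto
  also have "\<dots> = 4 ^ 10 * \<delta> ^ 9 * \<delta>" by (simp add: power_mult_distrib eval_nat_numeral)
  also have "\<dots> \<le> 4 ^ 10 * (1/16) ^ 9 * \<delta>"
    using assms True by (intro mult_right_mono mult_left_mono power_mono) auto
  also have "\<dots> \<le> 1 * \<delta>" using assms by (intro mult_right_mono) (auto simp: power_divide)
  finally show ?thesis by simp
next
  case False
  have "(4 * \<delta> * (1 - \<delta>)) ^ 10 \<le> (3/4) ^ 10"
  proof (rule power_mono)
    have "0 \<le> (1/4 - \<delta>) * (3/4 - \<delta>)" using assms by (intro mult_nonneg_nonneg) auto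
    moreover have "4 * ((1/4 - \<delta>) * (3/4 - \<delta>)) = 3/4 - 4 * \<delta> * (1 - \<delta>)" by (simp add: field_simps)
    ultimately show "4 * \<delta> * (1 - \<delta>) \<le> 3/4" by linarith
  qed (use assms in auto)
  also have "\<dots> \<le> (1/16 :: real)" by (simp add: power_divide)
  also have "\<dots> \<le> \<delta>" using False by simp
  finally show ?thesis .
qed

lemma minimax_lower_bound_rank1:
  fixes \<sigma> r \<delta> :: real
  assumes n: "0 < n" and d: "0 < d" and \<delta>: "0 < \<delta>" "\<delta> \<le> 1/4" and \<sigma>: "0 < \<sigma>" and r: "1 \<le> r"
  shows "ennreal (\<sigma>\<^sup>2 / 8 * min (sqrt (ln (1 / \<delta>) / real n)) 1)
    \<le> minimax_quantile \<delta> (sample_space n d) (pseudometric_borel (cov_class d \<sigma> r) op_loss) (normal_family n d) op_loss"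
proof (rule minimax_quantile_ge)
  fix est assume "est \<in> measurable (sample_space n d) (pseudometric_borel (cov_class d \<sigma> r) op_loss)"
  then have est: "est x \<in> cov_class d \<sigma> r" if "x \<in> space (sample_space n d)" for x
    using that by (auto dest: measurable_space)
  \<comment> \<open>The two variances will differ by \<open>\<sigma>\<^sup>2 * \<kappa>\<close>, and
    the error to be excluded is half of that. The factor \<open>1/4\<close> secures
    \<open>16 \<kappa>\<^sup>2 n \<le> ln (1 / \<delta>)\<close>, of which the final contradiction
    consumes only \<open>10 \<kappa>\<^sup>2 n\<close>.\<close>
  define \<kappa> where "\<kappa> = min (sqrt (ln (1 / \<delta>) / real n)) 1 / 4"
  have ln_pos: "0 < ln (1 / \<delta>)" using \<delta> by (intro ln_gt_zero) simp
  have \<kappa>: "0 < \<kappa>" "\<kappa> \<le> 1/4" using ln_pos n by (auto simp: \<kappa>_def)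
  have \<kappa>2: "16 * \<kappa>\<^sup>2 * real n \<le> ln (1 / \<delta>)"
  proof -
    have "4 * \<kappa> \<le> sqrt (ln (1 / \<delta>) / real n)" by (simp add: \<kappa>_def)
    then have "(4 * \<kappa>)\<^sup>2 \<le> (sqrt (ln (1 / \<delta>) / real n))\<^sup>2" using \<kappa> by (intro power_mono) auto
    then show ?thesis using ln_pos n by (simp add: power_mult_distrib field_simps)
  qed
  assume good: "\<And>\<theta> P. \<theta> \<in> space (pseudometric_borel (cov_class d \<sigma> r) op_loss) \<Longrightarrow> P \<in> normal_family n d \<theta> \<Longrightarrow>
      \<exists>t. 0 \<le> t \<and> t < \<sigma>\<^sup>2 / 8 * min (sqrt (ln (1 / \<delta>) / real n)) 1 \<and>
        1 - \<delta> \<le> measure P {x \<in> space (sample_space n d). op_loss (est x) \<theta> \<le> t}"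
  define a0 a1 where "a0 = \<sigma>\<^sup>2 * (1 - \<kappa>)" and "a1 = \<sigma>\<^sup>2"
  have a: "0 < a0" "a0 \<le> \<sigma>\<^sup>2" "0 < a1" "a1 \<le> \<sigma>\<^sup>2" using \<sigma> \<kappa> by (auto simp: a0_def a1_def)
  note c0 = rank1_cov_in_class[OF d a(1,2) r] and c1 = rank1_cov_in_class[OF d a(3,4) r]
  define P where "P a = PiM {..<n} (\<lambda>_. centred_normal d (rank1_cov d a))" for a
  have g: "\<exists>t. t < \<sigma>\<^sup>2 * \<kappa> / 2 \<and> 1 - \<delta> \<le> measure (P a) {x \<in> space (sample_space n d). op_loss (est x) (rank1_cov d a) \<le> t}"
    if "rank1_cov d a \<in> cov_class d \<sigma> r" for a
    using good[of "rank1_cov d a" "P a"] that by (auto simp: normal_family_def P_def \<kappa>_def)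
  obtain t0 where t0: "t0 < \<sigma>\<^sup>2 * \<kappa> / 2" "1 - \<delta> \<le> measure (P a0) {x \<in> space (sample_space n d). op_loss (est x) (rank1_cov d a0) \<le> t0}"
    using g[OF c0] by blast
  obtain t1 where t1: "t1 < \<sigma>\<^sup>2 * \<kappa> / 2" "1 - \<delta> \<le> measure (P a1) {x \<in> space (sample_space n d). op_loss (est x) (rank1_cov d a1) \<le> t1}"
    using g[OF c1] by blast
  let ?A0 = "{x \<in> space (sample_space n d). op_loss (est x) (rank1_cov d a0) \<le> t0}"
  let ?A1 = "{x \<in> space (sample_space n d). op_loss (est x) (rank1_cov d a1) \<le> t1}"
  interpret P0: prob_space "P a0" unfolding P_def by (rule prob_space_PiM_centred_normal)
  interpret P1: prob_space "P a1" unfolding P_def by (rule prob_space_PiM_centred_normal)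
  have sets_P: "sets (P a) = sets (borel_sample n d)" for a
    unfolding P_def by (rule sets_PiM_centred_normal)
  have A0: "?A0 \<in> sets (P a0)" by (rule measure_pos_imp_sets) (use t0(2) \<delta> in linarith)
  have A1: "?A1 \<in> sets (P a1)" by (rule measure_pos_imp_sets) (use t1(2) \<delta> in linarith)
  \<comment> \<open>An estimate within half the separation of one covariance cannot be that close to
    the other, so the estimator induces a test with both errors at most
    \<open>\<delta>\<close>.\<close>
  have "?A0 \<inter> ?A1 = {}"
  proof (rule ccontr)
    assume "?A0 \<inter> ?A1 \<noteq> {}"
    then obtain x where x: "x \<in> space (sample_space n d)" "op_loss (est x) (rank1_cov d a0) \<le> t0"
      "op_loss (est x) (rank1_cov d a1) \<le> t1" by auto
    have car: "est x \<in> carrier_mat d d" "rank1_cov d b \<in> carrier_mat d d" for b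
      using est[OF x(1)] by (auto simp: cov_class_def psd_mats_iff rank1_cov_def)
    have "\<sigma>\<^sup>2 * \<kappa> = \<bar>rank1_cov d a0 $$ (0, 0) - rank1_cov d a1 $$ (0, 0)\<bar>"
      using d \<kappa> \<sigma> by (simp add: rank1_cov_def a0_def a1_def algebra_simps)
    also have "\<dots> \<le> op_loss (rank1_cov d a0) (rank1_cov d a1)" by (rule op_loss_entry[OF car(2) car(2) d d])
    also have "\<dots> \<le> op_loss (rank1_cov d a0) (est x) + op_loss (est x) (rank1_cov d a1)"
      by (rule op_loss_triangle[OF car(2) car(1) car(2)])
    also have "op_loss (rank1_cov d a0) (est x) = op_loss (est x) (rank1_cov d a0)"
      by (rule op_loss_commute[OF car(2) car(1)])
    finally show False using x t0(1) t1(1) by linarith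
  qed
  then have "measure (P a0) ?A0 + measure (P a0) ?A1 = measure (P a0) (?A0 \<union> ?A1)"
    using A0 A1 sets_P by (intro P0.finite_measure_Union[symmetric]) auto
  then have "measure (P a0) ?A1 \<le> \<delta>" using t0(2) P0.prob_le_1[of "?A0 \<union> ?A1"] by linarith
  then have diff: "1 - 2 * \<delta> \<le> measure (P a1) ?A1 - measure (P a0) ?A1" using t1(2) by linarith
  define \<rho> where "\<rho> = sqrt (2 * sqrt a1 * sqrt a0 / ((sqrt a1)\<^sup>2 + (sqrt a0)\<^sup>2))"
  have aff: "(measure (P a1) ?A1 - measure (P a0) ?A1)\<^sup>2 \<le> 1 - (\<rho> ^ n)\<^sup>2"
    unfolding P_def
  proof (rule testing_affinity_PiM)
    show "sigma_finite_measure lborel" by (rule sigma_finite_lborel)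
    show "centred_normal d (rank1_cov d a1) = distr (density lborel (\<lambda>x. ennreal (normal_density 0 (sqrt a1) x))) (borel_vec d)
        (\<lambda>y. \<lambda>i\<in>{..<d}. if i = 0 then y else 0)"
      "centred_normal d (rank1_cov d a0) = distr (density lborel (\<lambda>x. ennreal (normal_density 0 (sqrt a0) x))) (borel_vec d)
        (\<lambda>y. \<lambda>i\<in>{..<d}. if i = 0 then y else 0)"
      using c0 c1 a d by (auto intro!: centred_normal_rank1 simp: cov_class_def)
    show "ennreal \<rho> \<le> (\<integral>\<^sup>+x. ennreal (sqrt (normal_density 0 (sqrt a1) x * normal_density 0 (sqrt a0) x)) \<partial>lborel)"
      unfolding \<rho>_def using a by (subst normal_affinity) auto
    show "0 \<le> \<rho>" using a by (simp add: \<rho>_def)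
    show "?A1 \<in> sets (borel_sample n d)" using A1 sets_P by simp
  qed (auto intro: prob_space_centred_normal)
  have \<rho>0: "0 \<le> \<rho>" using a by (simp add: \<rho>_def)
  have "(1 - 2 * \<delta>)\<^sup>2 \<le> (measure (P a1) ?A1 - measure (P a0) ?A1)\<^sup>2"
    using diff \<delta> by (intro power_mono) auto
  then have "(\<rho> ^ n)\<^sup>2 \<le> 4 * \<delta> * (1 - \<delta>)" using aff by (simp add: power2_eq_square algebra_simps)
  then have "((\<rho> ^ n)\<^sup>2) ^ 10 \<le> (4 * \<delta> * (1 - \<delta>)) ^ 10" by (intro power_mono) auto
  also have "\<dots> \<le> \<delta>" by (rule quantile_power_bound[OF \<delta>])
  finally have up: "((\<rho> ^ n)\<^sup>2) ^ 10 \<le> \<delta>" .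
  have "((\<rho> ^ n)\<^sup>2) ^ 10 = (\<rho> ^ 4) ^ (5 * n)"
    by (simp add: power_mult[symmetric] algebra_simps)
  \<comment> \<open>The fourth power of the affinity is a rational function of
    \<open>\<kappa>\<close> without square roots:
    \<open>4 (1 - \<kappa>) / (2 - \<kappa>)\<^sup>2\<close>, which is at least
    \<open>1 - \<kappa>\<^sup>2\<close>.\<close>
  also have "\<dots> \<ge> (1 - \<kappa>\<^sup>2) ^ (5 * n)"
  proof (rule power_mono)
    have "\<rho> ^ 4 = (\<rho>\<^sup>2)\<^sup>2" by (simp add: power_mult[symmetric])
    also have "\<rho>\<^sup>2 = 2 * sqrt a1 * sqrt a0 / (a1 + a0)" using a by (simp add: \<rho>_def)
    also have "\<dots>\<^sup>2 = 4 * a1 * a0 / (a1 + a0)\<^sup>2" using a by (simp add: power_divide power_mult_distrib)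
    also have "\<dots> = 4 * (1 - \<kappa>) / (2 - \<kappa>)\<^sup>2"
    proof -
      have "4 * a1 * a0 = (\<sigma>\<^sup>2)\<^sup>2 * (4 * (1 - \<kappa>))" by (simp add: a0_def a1_def power2_eq_square)
      moreover have "(a1 + a0)\<^sup>2 = (\<sigma>\<^sup>2)\<^sup>2 * (2 - \<kappa>)\<^sup>2"
      proof -
        have "a1 + a0 = \<sigma>\<^sup>2 * (2 - \<kappa>)" by (simp add: a0_def a1_def algebra_simps)
        then show ?thesis by (simp only: power_mult_distrib)
      qed
      ultimately show ?thesis using \<sigma> by simp
    qed
    finally have \<rho>4: "\<rho> ^ 4 = 4 * (1 - \<kappa>) / (2 - \<kappa>)\<^sup>2" .
    have "4 * (1 - \<kappa>) - (1 - \<kappa>\<^sup>2) * (2 - \<kappa>)\<^sup>2 = (1 - \<kappa>) * (\<kappa>\<^sup>2 * (3 - \<kappa>))"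
      by (simp add: power2_eq_square algebra_simps)
    moreover have "0 \<le> (1 - \<kappa>) * (\<kappa>\<^sup>2 * (3 - \<kappa>))" using \<kappa> by (intro mult_nonneg_nonneg) auto
    ultimately have "(1 - \<kappa>\<^sup>2) * (2 - \<kappa>)\<^sup>2 \<le> 4 * (1 - \<kappa>)" by simp
    moreover have "0 < (2 - \<kappa>)\<^sup>2" using \<kappa> by (intro zero_less_power) simp
    ultimately show "1 - \<kappa>\<^sup>2 \<le> \<rho> ^ 4" unfolding \<rho>4 by (simp add: pos_le_divide_eq)
    show "0 \<le> 1 - \<kappa>\<^sup>2" using \<kappa> by (simp add: power_le_one)
  qed
  finally have low: "(1 - \<kappa>\<^sup>2) ^ (5 * n) \<le> ((\<rho> ^ n)\<^sup>2) ^ 10" .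
  have "\<kappa>\<^sup>2 \<le> (1/4)\<^sup>2" using \<kappa> by (intro power_mono) auto
  then have k2: "0 < \<kappa>\<^sup>2" "\<kappa>\<^sup>2 \<le> 1/16" using \<kappa> by (auto simp: power2_eq_square)
  have "- \<kappa>\<^sup>2 - 2 * (\<kappa>\<^sup>2)\<^sup>2 \<le> ln (1 - \<kappa>\<^sup>2)" by (rule ln_one_minus_pos_lower_bound) (use k2 in auto)
  moreover have "2 * (\<kappa>\<^sup>2)\<^sup>2 \<le> \<kappa>\<^sup>2" using k2 mult_left_mono[of "\<kappa>\<^sup>2" "1/16" "\<kappa>\<^sup>2"] by (simp add: power2_eq_square)
  ultimately have lnk: "- 2 * \<kappa>\<^sup>2 \<le> ln (1 - \<kappa>\<^sup>2)" by linarith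
  \<comment> \<open>The slack between 16 and 10 is spent here. The inequality is strict because
    \<open>n * \<kappa>\<^sup>2\<close> is positive, and it contradicts \<open>up\<close> and
    \<open>low\<close>.\<close>
  have "ln \<delta> < real (5 * n) * (- 2 * \<kappa>\<^sup>2)"
  proof -
    have "ln (1 / \<delta>) = - ln \<delta>" using \<delta> by (simp add: ln_div)
    moreover have "real n * \<kappa>\<^sup>2 > 0" using n k2 by simp
    ultimately show ?thesis using \<kappa>2 by (simp add: mult.commute)
  qed
  also have "\<dots> \<le> real (5 * n) * ln (1 - \<kappa>\<^sup>2)" by (rule mult_left_mono[OF lnk]) simp
  also have "\<dots> = ln ((1 - \<kappa>\<^sup>2) ^ (5 * n))" using k2 by (subst ln_realpow) auto
  finally have "\<delta> < (1 - \<kappa>\<^sup>2) ^ (5 * n)" using \<delta> k2 by (subst (asm) ln_less_cancel_iff) auto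
  with low up show False by linarith
qed

subsection \<open>Lower bound from a hypercube of correlations\<close>

text \<open>Assouad's lemma: \<open>pr T j\<close> is the probability, under the vertex \<open>T\<close>, of guessing that \<open>j \<in> T\<close>.\<close>

lemma assouad:
  fixes pr :: "'a set \<Rightarrow> 'a \<Rightarrow> real"
  assumes J: "finite J" "J \<noteq> {}"
    and close: "\<And>j T. j \<in> J \<Longrightarrow> T \<subseteq> J - {j} \<Longrightarrow> pr (insert j T) j - pr T j \<le> 1/5"
    and good: "\<And>T. T \<subseteq> J \<Longrightarrow> (\<Sum>j\<in>J. if j \<in> T then 1 - pr T j else pr T j) \<le> 3/8 * real (card J)"
  shows False
proof -
  let ?w = "\<lambda>T j. if j \<in> T then 1 - pr T j else pr T j"
  have m: "0 < card J" using J by (simp add: card_gt_0_iff)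
  have "(\<Sum>T\<in>Pow J. \<Sum>j\<in>J. ?w T j) \<le> (\<Sum>T\<in>Pow J. 3/8 * real (card J))"
    by (rule sum_mono) (use good in auto)
  also have "\<dots> = 3/8 * real (card J) * 2 ^ card J" using J by (simp add: card_Pow)
  finally have up: "(\<Sum>T\<in>Pow J. \<Sum>j\<in>J. ?w T j) \<le> 3/8 * real (card J) * 2 ^ card J" .
  \<comment> \<open>Vertices are paired across direction \<open>j\<close>. Each pair contributes at
    least \<open>1 - 1/5\<close>, so the average over vertices is at least \<open>2/5\<close>, which
    exceeds the assumed \<open>3/8\<close>.\<close>
  have one: "2/5 * 2 ^ card J \<le> (\<Sum>T\<in>Pow J. ?w T j)" if j: "j \<in> J" for j
  proof -
    let ?K = "Pow (J - {j})"
    have "Pow J = Pow (insert j (J - {j}))" using j by (simp add: insert_absorb)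
    then have PJ: "Pow J = ?K \<union> insert j ` ?K" by (simp only: Pow_insert)
    have "(\<Sum>T\<in>Pow J. ?w T j) = (\<Sum>T\<in>?K. ?w T j) + (\<Sum>T\<in>insert j ` ?K. ?w T j)"
      unfolding PJ by (rule sum.union_disjoint) (use J in auto)
    also have "(\<Sum>T\<in>insert j ` ?K. ?w T j) = (\<Sum>T\<in>?K. ?w (insert j T) j)"
      by (rule sum.reindex_cong[of "insert j"]) (auto simp: inj_on_def)
    also have "(\<Sum>T\<in>?K. ?w T j) + (\<Sum>T\<in>?K. ?w (insert j T) j) = (\<Sum>T\<in>?K. pr T j + (1 - pr (insert j T) j))"
      unfolding sum.distrib[symmetric] by (rule sum.cong) auto
    also have "\<dots> \<ge> (\<Sum>T\<in>?K. 4/5)"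
    proof (rule sum_mono)
      fix T assume "T \<in> ?K"
      then show "4/5 \<le> pr T j + (1 - pr (insert j T) j)" using close[OF j, of T] by simp
    qed
    finally have "4/5 * 2 ^ card (J - {j}) \<le> (\<Sum>T\<in>Pow J. ?w T j)" using J by (simp add: card_Pow mult.commute)
    moreover have "(2 :: real) ^ card J = 2 * 2 ^ card (J - {j})"
      using card_Suc_Diff1[OF J(1) j] by (metis power_Suc)
    ultimately show ?thesis by simp
  qed
  have "(\<Sum>j\<in>J. 2/5 * 2 ^ card J) \<le> (\<Sum>j\<in>J. \<Sum>T\<in>Pow J. ?w T j)" by (rule sum_mono) (rule one)
  also have "\<dots> = (\<Sum>T\<in>Pow J. \<Sum>j\<in>J. ?w T j)" by (rule sum.swap)
  also note up
  finally have "2/5 * (real (card J) * 2 ^ card J) \<le> 3/8 * (real (card J) * 2 ^ card J)" by simp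
  moreover have "0 < real (card J) * 2 ^ card J" using m by simp
  ultimately show False by linarith
qed

text \<open>
  The law of \<open>z\<close> with \<open>w i * z 0\<close> added to the coordinates \<open>i\<close>, for \<open>w 0 = 0\<close>: conditionally on
  \<open>z 0\<close> this is a shift.
\<close>

definition shear_density :: "nat \<Rightarrow> (nat \<Rightarrow> real) \<Rightarrow> (nat \<Rightarrow> real) \<Rightarrow> real" where
  "shear_density d w x = exp ((\<Sum>i\<in>{1..<d}. w i * x i) * x 0 - (\<Sum>i\<in>{1..<d}. (w i)\<^sup>2) * (x 0)\<^sup>2 / 2)"

lemma measurable_shear_density [measurable]:
  assumes "0 < d"
  shows "shear_density d w \<in> borel_measurable (gauss {..<d})"
proof -
  have c: "(\<lambda>z. z i) \<in> borel_measurable (gauss {..<d})" if "i < d" for i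
    using that by (intro borel_measurable_gauss_coord) simp
  note [measurable] = c[OF assms]
  have [measurable]: "(\<lambda>x. \<Sum>i\<in>{1..<d}. w i * x i) \<in> borel_measurable (gauss {..<d})"
    by (intro borel_measurable_sum borel_measurable_times borel_measurable_const c) auto
  show ?thesis unfolding shear_density_def by measurable
qed

lemma measurable_shear:
  assumes "0 < d"
  shows "(\<lambda>z. \<lambda>i\<in>{..<d}. z i + w i * z 0) \<in> measurable (gauss {..<d}) (gauss {..<d})"
proof (rule measurable_restrict)
  have c: "(\<lambda>z. z i) \<in> borel_measurable (gauss {..<d})" if "i < d" for i
    using that by (intro borel_measurable_gauss_coord) simp
  fix i assume "i \<in> {..<d}"
  then have "(\<lambda>z. z i + w i * z 0) \<in> borel_measurable (gauss {..<d})"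
    using assms by (intro borel_measurable_add borel_measurable_times borel_measurable_const c) auto
  then show "(\<lambda>z. z i + w i * z 0) \<in> measurable (gauss {..<d}) std_normal_distribution" by simp
qed

text \<open>Coordinate 0 is split off by Fubini. For \<open>z 0 = y\<close> the remaining
  coordinates undergo a deterministic shift by \<open>w i * y\<close>, which Cameron--Martin turns
  into the density.\<close>

lemma gauss_nn_integral_shear:
  assumes d: "0 < d" and w0: "w 0 = 0" and F[measurable]: "F \<in> borel_measurable (gauss {..<d})"
  shows "(\<integral>\<^sup>+z. F (\<lambda>i\<in>{..<d}. z i + w i * z 0) \<partial>gauss {..<d})
    = (\<integral>\<^sup>+z. ennreal (shear_density d w z) * F z \<partial>gauss {..<d})"
proof -
  define J where "J = {1..<d}"
  have I: "{..<d} = insert 0 J" using d by (auto simp: J_def)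
  have J: "finite J" "0 \<notin> J" by (auto simp: J_def)
  note ins = product_sigma_finite.product_nn_integral_insert_rev[OF product_sigma_finite_std_normal J]
  have F'[measurable]: "F \<in> borel_measurable (gauss (insert 0 J))" using F unfolding I .
  have "(\<integral>\<^sup>+z. F (\<lambda>i\<in>{..<d}. z i + w i * z 0) \<partial>gauss {..<d})
      = (\<integral>\<^sup>+y. (\<integral>\<^sup>+x. F (\<lambda>i\<in>{..<d}. (x(0 := y)) i + w i * (x(0 := y)) 0) \<partial>gauss J) \<partial>std_normal_distribution)"
    unfolding I
    by (rule ins) (use measurable_compose[OF measurable_shear[OF d, of w] F] in \<open>simp only: I\<close>)
  also have "\<dots> = (\<integral>\<^sup>+y. (\<integral>\<^sup>+x. ennreal (shear_density d w (x(0 := y))) * F (x(0 := y)) \<partial>gauss J) \<partial>std_normal_distribution)"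
  proof (rule nn_integral_cong)
    fix y
    let ?H = "\<lambda>x. F (x(0 := y))"
    have upd: "(\<lambda>x. x(0 := y)) \<in> measurable (gauss J) (gauss (insert 0 J))"
      by (rule measurable_fun_upd[where J = J]) auto
    have H[measurable]: "?H \<in> borel_measurable (gauss J)" by (rule measurable_compose[OF upd F'])
    define u where "u i = w i * y" for i
    let ?S = "(\<Sum>i\<in>J. (u i)\<^sup>2) / 2"
    \<comment> \<open>The claimed density is built into the integrand; after the shift it cancels
      against the Cameron--Martin factor and leaves \<open>F\<close> alone.\<close>
    define K where "K x = ennreal (exp ((\<Sum>i\<in>J. u i * x i) - ?S)) * ?H x" for x
    have K[measurable]: "K \<in> borel_measurable (gauss J)" unfolding K_def by measurable
    have "(\<integral>\<^sup>+x. K x \<partial>gauss J) = (\<integral>\<^sup>+x. ennreal (exp (- (\<Sum>i\<in>J. u i * x i) - ?S)) * K (\<lambda>i\<in>J. x i + u i) \<partial>gauss J)"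
      by (rule gauss_nn_integral_shift) (use J K in auto)
    also have "\<dots> = (\<integral>\<^sup>+x. F (\<lambda>i\<in>{..<d}. (x(0 := y)) i + w i * (x(0 := y)) 0) \<partial>gauss J)"
    proof (rule nn_integral_cong)
      fix x
      have "(\<Sum>i\<in>J. u i * (\<lambda>i\<in>J. x i + u i) i) = (\<Sum>i\<in>J. u i * x i) + (\<Sum>i\<in>J. (u i)\<^sup>2)"
        by (simp add: sum.distrib distrib_left power2_eq_square)
      then have "- (\<Sum>i\<in>J. u i * x i) - ?S + ((\<Sum>i\<in>J. u i * (\<lambda>i\<in>J. x i + u i) i) - ?S) = 0" by (simp add: field_simps)
      then have "exp (- (\<Sum>i\<in>J. u i * x i) - ?S) * exp ((\<Sum>i\<in>J. u i * (\<lambda>i\<in>J. x i + u i) i) - ?S) = 1"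
        by (simp only: exp_add[symmetric] exp_zero)
      then have e: "ennreal (exp (- (\<Sum>i\<in>J. u i * x i) - ?S)) * ennreal (exp ((\<Sum>i\<in>J. u i * (\<lambda>i\<in>J. x i + u i) i) - ?S)) = 1"
        by (simp only: ennreal_mult[symmetric] exp_ge_zero ennreal_1)
      have p: "(\<lambda>i\<in>J. x i + u i)(0 := y) = (\<lambda>i\<in>{..<d}. (x(0 := y)) i + w i * (x(0 := y)) 0)"
        using d w0 by (auto simp: fun_eq_iff u_def J_def)
      show "ennreal (exp (- (\<Sum>i\<in>J. u i * x i) - ?S)) * K (\<lambda>i\<in>J. x i + u i)
          = F (\<lambda>i\<in>{..<d}. (x(0 := y)) i + w i * (x(0 := y)) 0)"
        unfolding K_def mult.assoc[symmetric] e p by simp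
    qed
    finally have *: "(\<integral>\<^sup>+x. F (\<lambda>i\<in>{..<d}. (x(0 := y)) i + w i * (x(0 := y)) 0) \<partial>gauss J) = (\<integral>\<^sup>+x. K x \<partial>gauss J)" ..
    have "K x = ennreal (shear_density d w (x(0 := y))) * F (x(0 := y))" for x
    proof -
      have "(\<Sum>i\<in>J. w i * (x(0 := y)) i) * y = (\<Sum>i\<in>J. u i * x i)"
        unfolding sum_distrib_right by (intro sum.cong refl) (use J in \<open>auto simp: u_def\<close>)
      moreover have "(\<Sum>i\<in>J. (w i)\<^sup>2) * y\<^sup>2 = (\<Sum>i\<in>J. (u i)\<^sup>2)"
        by (simp add: sum_distrib_right u_def power_mult_distrib)
      ultimately show ?thesis by (simp add: K_def shear_density_def J_def[symmetric] del: One_nat_def)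
    qed
    then have "K = (\<lambda>x. ennreal (shear_density d w (x(0 := y))) * F (x(0 := y)))" by (rule ext)
    then show "(\<integral>\<^sup>+x. F (\<lambda>i\<in>{..<d}. (x(0 := y)) i + w i * (x(0 := y)) 0) \<partial>gauss J)
        = (\<integral>\<^sup>+x. ennreal (shear_density d w (x(0 := y))) * F (x(0 := y)) \<partial>gauss J)"
      unfolding * by (simp only:)
  qed
  also have "\<dots> = (\<integral>\<^sup>+z. ennreal (shear_density d w z) * F z \<partial>gauss {..<d})"
  proof -
    have "(\<lambda>z. ennreal (shear_density d w z) * F z) \<in> borel_measurable (gauss {..<d})"
      using measurable_shear_density[OF d, of w] by measurable
    then show ?thesis unfolding I by (rule ins[symmetric])
  qed
  finally show ?thesis .
qed

lemma gauss_shear_law: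
  assumes d: "0 < d" and w0: "w 0 = 0"
  shows "distr (gauss {..<d}) (gauss {..<d}) (\<lambda>z. \<lambda>i\<in>{..<d}. z i + w i * z 0)
    = density (gauss {..<d}) (\<lambda>x. ennreal (shear_density d w x))"
proof (rule measure_eqI)
  note [measurable] = measurable_shear[OF d] measurable_shear_density[OF d]
  fix A assume "A \<in> sets (distr (gauss {..<d}) (gauss {..<d}) (\<lambda>z. \<lambda>i\<in>{..<d}. z i + w i * z 0))"
  then have [measurable]: "A \<in> sets (gauss {..<d})" by simp
  let ?D = "distr (gauss {..<d}) (gauss {..<d}) (\<lambda>z. \<lambda>i\<in>{..<d}. z i + w i * z 0)"
  have "emeasure ?D A = (\<integral>\<^sup>+z. indicator A z \<partial>?D)" by simp
  also have "\<dots> = (\<integral>\<^sup>+z. indicator A (\<lambda>i\<in>{..<d}. z i + w i * z 0) \<partial>gauss {..<d})"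
    by (rule nn_integral_distr) measurable
  also have "\<dots> = (\<integral>\<^sup>+z. ennreal (shear_density d w z) * indicator A z \<partial>gauss {..<d})"
    by (rule gauss_nn_integral_shear[where w = w, OF d w0]) measurable
  also have "\<dots> = emeasure (density (gauss {..<d}) (\<lambda>x. ennreal (shear_density d w x))) A"
    by (subst emeasure_density) auto
  finally show "emeasure ?D A = emeasure (density (gauss {..<d}) (\<lambda>x. ennreal (shear_density d w x))) A" .
qed simp

text \<open>The linear terms \<open>e\<close> and \<open>- e\<close> in direction \<open>j\<close>
  cancel in the geometric mean. What remains is the shear density without that direction times a
  Gaussian damping in \<open>x 0\<close>, so the affinity is
  \<open>E exp (- e\<^sup>2 Z\<^sup>2 / 2)\<close> with \<open>Z\<close> standard normal, uniformly
  in the other signs.\<close>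

lemma shear_affinity:
  assumes d: "0 < d" and w0: "w 0 = 0" and j: "j \<in> {1..<d}" and wj: "w j = 0"
  shows "ennreal (1 - e\<^sup>2 / 2)
    \<le> (\<integral>\<^sup>+x. ennreal (sqrt (shear_density d (w(j := e)) x * shear_density d (w(j := - e)) x)) \<partial>gauss {..<d})"
proof -
  let ?J = "{1..<d}"
  have c0: "(\<lambda>z. z 0) \<in> borel_measurable (gauss {..<d})"
    using d by (intro borel_measurable_gauss_coord) simp
  note [measurable] = c0
  have pt: "sqrt (shear_density d (w(j := e)) x * shear_density d (w(j := - e)) x)
      = shear_density d w x * exp (- e\<^sup>2 / 2 * (x 0)\<^sup>2)" for x
  proof (rule real_sqrt_unique)
    have lin: "(\<Sum>i\<in>?J. (w(j := c)) i * x i) = (\<Sum>i\<in>?J. w i * x i) + c * x j" for c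
    proof -
      have "(\<Sum>i\<in>?J. (w(j := c)) i * x i) = (w(j := c)) j * x j + (\<Sum>i\<in>?J - {j}. (w(j := c)) i * x i)"
        by (rule sum.remove) (use j in auto)
      also have "(\<Sum>i\<in>?J - {j}. (w(j := c)) i * x i) = (\<Sum>i\<in>?J - {j}. w i * x i)"
        by (rule sum.cong) auto
      also have "\<dots> = (\<Sum>i\<in>?J. w i * x i)" using sum.remove[of ?J j "\<lambda>i. w i * x i"] j wj by simp
      finally show ?thesis by simp
    qed
    have sq: "(\<Sum>i\<in>?J. ((w(j := c)) i)\<^sup>2) = (\<Sum>i\<in>?J. (w i)\<^sup>2) + c\<^sup>2" for c
    proof -
      have "(\<Sum>i\<in>?J. ((w(j := c)) i)\<^sup>2) = ((w(j := c)) j)\<^sup>2 + (\<Sum>i\<in>?J - {j}. ((w(j := c)) i)\<^sup>2)"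
        by (rule sum.remove) (use j in auto)
      also have "(\<Sum>i\<in>?J - {j}. ((w(j := c)) i)\<^sup>2) = (\<Sum>i\<in>?J - {j}. (w i)\<^sup>2)"
        by (rule sum.cong) auto
      also have "\<dots> = (\<Sum>i\<in>?J. (w i)\<^sup>2)" using sum.remove[of ?J j "\<lambda>i. (w i)\<^sup>2"] j wj by simp
      finally show ?thesis by simp
    qed
    show "(shear_density d w x * exp (- e\<^sup>2 / 2 * (x 0)\<^sup>2))\<^sup>2
        = shear_density d (w(j := e)) x * shear_density d (w(j := - e)) x"
      unfolding shear_density_def lin sq exp_add[symmetric] exp_double[symmetric]
      by (rule arg_cong[where f = exp]) (simp add: field_simps)
  qed (simp add: shear_density_def)
  have ge: "ennreal (1 - e\<^sup>2 / 2) \<le> (\<integral>\<^sup>+y. ennreal (exp (- e\<^sup>2 / 2 * y\<^sup>2)) \<partial>std_normal_distribution)"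
    (is "_ \<le> ?X")
  proof -
    interpret S: prob_space std_normal_distribution by (rule prob_space_std_normal)
    have "1 = (\<integral>\<^sup>+y. 1 \<partial>std_normal_distribution)" using S.emeasure_space_1 by simp
    also have "\<dots> \<le> (\<integral>\<^sup>+y. ennreal (exp (- e\<^sup>2 / 2 * y\<^sup>2)) + ennreal (e\<^sup>2 / 2) * ennreal (y\<^sup>2) \<partial>std_normal_distribution)"
    proof (rule nn_integral_mono)
      fix y
      have "1 \<le> exp (- e\<^sup>2 / 2 * y\<^sup>2) + e\<^sup>2 / 2 * y\<^sup>2"
        using exp_ge_add_one_self[of "- e\<^sup>2 / 2 * y\<^sup>2"] by simp
      then have "ennreal 1 \<le> ennreal (exp (- e\<^sup>2 / 2 * y\<^sup>2) + e\<^sup>2 / 2 * y\<^sup>2)" by (rule ennreal_leI)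
      moreover have "ennreal (exp (- e\<^sup>2 / 2 * y\<^sup>2) + e\<^sup>2 / 2 * y\<^sup>2) = ennreal (exp (- e\<^sup>2 / 2 * y\<^sup>2)) + ennreal (e\<^sup>2 / 2 * y\<^sup>2)"
        by (rule ennreal_plus) auto
      moreover have "ennreal (e\<^sup>2 / 2 * y\<^sup>2) = ennreal (e\<^sup>2 / 2) * ennreal (y\<^sup>2)"
        by (rule ennreal_mult) auto
      ultimately show "1 \<le> ennreal (exp (- e\<^sup>2 / 2 * y\<^sup>2)) + ennreal (e\<^sup>2 / 2) * ennreal (y\<^sup>2)"
        by (simp only: ennreal_1)
    qed
    also have "\<dots> = ?X + ennreal (e\<^sup>2 / 2) * (\<integral>\<^sup>+y. ennreal (y\<^sup>2) \<partial>std_normal_distribution)"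
      by (simp add: nn_integral_add nn_integral_cmult)
    also have "\<dots> = ?X + ennreal (e\<^sup>2 / 2)" by (simp add: nn_integral_std_normal_sq)
    finally have le: "1 \<le> ?X + ennreal (e\<^sup>2 / 2)" .
    show ?thesis
    proof (cases ?X rule: ennreal_cases)
      case (real x)
      have "ennreal 1 \<le> ennreal (x + e\<^sup>2 / 2)" using le real by (simp add: ennreal_plus)
      then have "1 \<le> x + e\<^sup>2 / 2" using real by (subst (asm) ennreal_le_iff) auto
      then show ?thesis unfolding real by (intro ennreal_leI) simp
    qed simp
  qed
  also have "(\<integral>\<^sup>+y. ennreal (exp (- e\<^sup>2 / 2 * y\<^sup>2)) \<partial>std_normal_distribution)
      = (\<integral>\<^sup>+z. ennreal (exp (- e\<^sup>2 / 2 * (z 0)\<^sup>2)) \<partial>gauss {..<d})"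
  proof -
    have "distr (gauss {..<d}) std_normal_distribution (\<lambda>z. z 0) = std_normal_distribution"
      using d by (intro distr_PiM_component prob_space_std_normal) auto
    then have "(\<integral>\<^sup>+y. ennreal (exp (- e\<^sup>2 / 2 * y\<^sup>2)) \<partial>std_normal_distribution)
        = (\<integral>\<^sup>+y. ennreal (exp (- e\<^sup>2 / 2 * y\<^sup>2)) \<partial>distr (gauss {..<d}) std_normal_distribution (\<lambda>z. z 0))"
      by (simp only:)
    also have "\<dots> = (\<integral>\<^sup>+z. ennreal (exp (- e\<^sup>2 / 2 * (z 0)\<^sup>2)) \<partial>gauss {..<d})"
      by (rule nn_integral_distr) (use c0 in auto)
    finally show ?thesis .
  qed
  \<comment> \<open>The shear fixes coordinate 0 because \<open>w 0 = 0\<close>, so the expectation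
    is unchanged when taken at the sheared point.\<close>
  also have "\<dots> = (\<integral>\<^sup>+z. ennreal (exp (- e\<^sup>2 / 2 * ((\<lambda>i\<in>{..<d}. z i + w i * z 0) 0)\<^sup>2)) \<partial>gauss {..<d})"
    using d w0 by simp
  also have "\<dots> = (\<integral>\<^sup>+z. ennreal (shear_density d w z) * ennreal (exp (- e\<^sup>2 / 2 * (z 0)\<^sup>2)) \<partial>gauss {..<d})"
    by (rule gauss_nn_integral_shear[where w = w, OF d w0]) measurable
  also have "\<dots> = (\<integral>\<^sup>+x. ennreal (sqrt (shear_density d (w(j := e)) x * shear_density d (w(j := - e)) x)) \<partial>gauss {..<d})"
    unfolding pt by (simp add: ennreal_mult shear_density_def)
  finally show ?thesis .
qed

section \<open>Covariances with one coordinate correlated to \<open>m\<close> others\<close>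

text \<open>This is \<open>corr_root\<close> times its transpose, multiplied out: the covariance of
  the vector with coordinates \<open>s * (w i * z 0 + z i)\<close>, where the term
  \<open>z i\<close> is present only for \<open>i \<le> m\<close>. Signs in \<open>w\<close> are
  visible in column 0.\<close>

definition corr_cov :: "nat \<Rightarrow> nat \<Rightarrow> real \<Rightarrow> (nat \<Rightarrow> real) \<Rightarrow> real mat" where
  "corr_cov d m s w = mat d d (\<lambda>(i, j). s\<^sup>2 * (w i * w j + (if j = 0 then w i else 0)
      + (if i = 0 then w j else 0) + (if i = j \<and> i \<le> m then 1 else 0)))"

definition corr_root :: "nat \<Rightarrow> real \<Rightarrow> (nat \<Rightarrow> real) \<Rightarrow> nat \<Rightarrow> nat \<Rightarrow> real" where
  "corr_root m s w i j = s * ((if j = 0 then w i else 0) + (if i = j \<and> i \<le> m then 1 else 0))"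

lemma corr_root_mult:
  assumes "i < d" "j < d" "0 < d"
  shows "(\<Sum>k<d. corr_root m s w i k * corr_root m s w j k) = corr_cov d m s w $$ (i, j)"
proof -
  let ?t = "\<lambda>i k. if i = k \<and> i \<le> m then 1 else 0 :: real"
  have "(\<Sum>k<d. corr_root m s w i k * corr_root m s w j k)
     = (\<Sum>k<d. s\<^sup>2 * ((if k = 0 then w i * w j else 0) + (if k = 0 then w i * ?t j 0 else 0)
         + (if k = 0 then w j * ?t i 0 else 0) + (if k = i then ?t i i * ?t j i else 0)))"
    by (intro sum.cong refl) (auto simp: corr_root_def power2_eq_square algebra_simps)
  also have "\<dots> = s\<^sup>2 * (w i * w j + w i * ?t j 0 + w j * ?t i 0 + ?t i i * ?t j i)"
    using assms by (simp add: sum.distrib sum_distrib_left[symmetric])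
  also have "\<dots> = corr_cov d m s w $$ (i, j)"
    using assms by (simp add: corr_cov_def)
  finally show ?thesis .
qed

lemma mv_corr_root:
  assumes "i < d"
  shows "mv d (corr_root m s w) z i = s * (w i * z 0 + (if i \<le> m then z i else 0))"
proof -
  have "mv d (corr_root m s w) z i = (\<Sum>k<d. s * ((if k = 0 then w i * z 0 else 0) + (if k = i then (if i \<le> m then z i else 0) else 0)))"
    unfolding mv_def by (intro sum.cong refl) (auto simp: corr_root_def algebra_simps)
  also have "\<dots> = s * (w i * z 0 + (if i \<le> m then z i else 0))"
    using assms by (simp add: sum.distrib sum_distrib_left[symmetric])
  finally show ?thesis .
qed

lemma corr_cov_quad:
  "0 < d \<Longrightarrow> ip d x (mv d (entries (corr_cov d m s w)) x) = (nrm d (mv d (\<lambda>i j. corr_root m s w j i) x))\<^sup>2"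
proof -
  assume d: "0 < d"
  have "ip d x (mv d (entries (corr_cov d m s w)) x) = ip d x (mv d (\<lambda>i j. \<Sum>k<d. corr_root m s w i k * corr_root m s w j k) x)"
    unfolding ip_def by (intro sum.cong refl arg_cong2[where f = "(*)"] mv_cong) (simp_all add: corr_root_mult d)
  also have "\<dots> = ip d (mv d (\<lambda>i j. corr_root m s w j i) x) (mv d (\<lambda>i j. corr_root m s w j i) x)"
    by (rule ip_transpose_mv[symmetric])
  finally show ?thesis by (simp only: ip_nrm)
qed

lemma corr_cov_psd: "0 < d \<Longrightarrow> corr_cov d m s w \<in> psd_mats d"
  unfolding psd_mats_iff
  by (auto simp: corr_cov_quad) (auto simp: corr_cov_def sym_entries_def mult.commute)

text \<open>The transposed factor stretches by at most \<open>1 + nrm d w \<le> 3/2\<close>; its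
  square \<open>9/4\<close> is rounded up to 3.\<close>

lemma corr_cov_op_bound:
  assumes d: "0 < d" and s: "0 < s" and w: "nrm d w \<le> 1/2"
  shows "op_bound d (entries (corr_cov d m s w)) (3 * s\<^sup>2)"
proof (rule op_bound_psd)
  have psd: "corr_cov d m s w \<in> psd_mats d" by (rule corr_cov_psd[OF d])
  then show "sym_entries d (entries (corr_cov d m s w))" "0 \<le> ip d x (mv d (entries (corr_cov d m s w)) x)" for x
    by (auto simp: psd_mats_iff)
  show "0 < 3 * s\<^sup>2" using s by simp
  fix x :: "nat \<Rightarrow> real"
  let ?e = "\<lambda>k. if k = 0 then 1 else 0 :: real" and ?x = "\<lambda>k. if k \<le> m then x k else 0"
  have "mv d (\<lambda>i j. corr_root m s w j i) x i = s * (ip d w x * ?e i + ?x i)" if "i < d" for i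
  proof -
    have "mv d (\<lambda>i j. corr_root m s w j i) x i
        = (\<Sum>k<d. s * (?e i * (w k * x k) + (if k = i then ?x i else 0)))"
      unfolding mv_def by (intro sum.cong refl) (auto simp: corr_root_def algebra_simps)
    also have "\<dots> = s * (?e i * ip d w x + ?x i)"
      using that by (simp add: sum.distrib sum_distrib_left[symmetric] ip_def)
    finally show ?thesis by (simp add: mult.commute)
  qed
  then have "nrm d (mv d (\<lambda>i j. corr_root m s w j i) x) = nrm d (\<lambda>i. s * (ip d w x * ?e i + ?x i))"
    by (intro L2_set_cong) auto
  also have "\<dots> = s * nrm d (\<lambda>i. ip d w x * ?e i + ?x i)" using s by (simp only: nrm_scale abs_of_pos)
  also have "\<dots> \<le> s * (3/2 * nrm d x)"
  proof (rule mult_left_mono)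
    have "nrm d (\<lambda>i. ip d w x * ?e i + ?x i) \<le> nrm d (\<lambda>i. ip d w x * ?e i) + nrm d ?x" by (rule nrm_add)
    also have "nrm d (\<lambda>i. ip d w x * ?e i) = \<bar>ip d w x\<bar>" unfolding nrm_scale nrm_unit[OF d] by simp
    also have "\<bar>ip d w x\<bar> \<le> nrm d w * nrm d x" by (rule ip_le_nrm)
    also have "\<dots> \<le> 1/2 * nrm d x" by (rule mult_right_mono[OF w]) simp
    also have "nrm d ?x \<le> nrm d x"
      unfolding L2_set_def by (intro real_sqrt_le_mono sum_mono) auto
    finally show "nrm d (\<lambda>i. ip d w x * ?e i + ?x i) \<le> 3/2 * nrm d x" by simp
  qed (use s in simp)
  finally have "(nrm d (mv d (\<lambda>i j. corr_root m s w j i) x))\<^sup>2 \<le> (s * (3/2 * nrm d x))\<^sup>2"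
    by (intro power_mono) auto
  also have "\<dots> \<le> 3 * s\<^sup>2 * (nrm d x)\<^sup>2" by (simp add: power_mult_distrib power_divide)
  finally show "ip d x (mv d (entries (corr_cov d m s w)) x) \<le> 3 * s\<^sup>2 * (nrm d x)\<^sup>2"
    unfolding corr_cov_quad[OF d] .
qed

lemma measurable_truncate_scale:
  "(\<lambda>x. \<lambda>i\<in>{..<d}. if i \<le> m then s * x i else 0) \<in> measurable (gauss {..<d}) (borel_vec d)"
proof (rule measurable_restrict)
  fix i assume "i \<in> {..<d}"
  note [measurable] = borel_measurable_gauss_coord[OF this]
  show "(\<lambda>x. if i \<le> m then s * x i else 0) \<in> borel_measurable (gauss {..<d})" by measurable
qed

text \<open>The truncating and scaling map is the same for every \<open>w\<close>; only the density
  depends on it. All vertices of the cube are thus laws over one reference measure, also when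
  \<open>m + 1 < d\<close> makes them singular.\<close>

lemma centred_normal_corr:
  assumes d: "0 < d" and w0: "w 0 = 0" and wm: "\<And>i. m < i \<Longrightarrow> w i = 0"
  shows "centred_normal d (corr_cov d m s w)
    = distr (density (gauss {..<d}) (\<lambda>x. ennreal (shear_density d w x))) (borel_vec d)
        (\<lambda>x. \<lambda>i\<in>{..<d}. if i \<le> m then s * x i else 0)"
proof -
  let ?\<tau> = "\<lambda>x. \<lambda>i\<in>{..<d}. if i \<le> m then s * x i else 0" and ?h = "\<lambda>z. \<lambda>i\<in>{..<d}. z i + w i * z 0"
  note \<tau> = measurable_truncate_scale[where d = d and m = m and s = s]
  have "centred_normal d (corr_cov d m s w)
      = distr (gauss {..<d}) (borel_vec d) (\<lambda>z. \<lambda>i\<in>{..<d}. mv d (corr_root m s w) z i)"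
    by (rule centred_normal_eq[OF corr_cov_psd[OF d]]) (rule corr_root_mult[OF _ _ d])
  also have "(\<lambda>z. \<lambda>i\<in>{..<d}. mv d (corr_root m s w) z i) = ?\<tau> \<circ> ?h"
    using wm by (auto simp: fun_eq_iff mv_corr_root algebra_simps)
  also have "distr (gauss {..<d}) (borel_vec d) (?\<tau> \<circ> ?h)
      = distr (distr (gauss {..<d}) (gauss {..<d}) ?h) (borel_vec d) ?\<tau>"
    by (rule distr_distr[symmetric, OF \<tau> measurable_shear[OF d]])
  finally show ?thesis unfolding gauss_shear_law[where w = w, OF d w0] .
qed

text \<open>The vertex \<open>T\<close> of the hypercube as a sign vector of size \<open>e\<close>.
  Coordinate 0 carries no sign, being the one with which the others are correlated.\<close>

definition cube_corr :: "nat \<Rightarrow> real \<Rightarrow> nat set \<Rightarrow> nat \<Rightarrow> real" where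
  "cube_corr m e T i = (if i \<in> {1..m} then (if i \<in> T then e else - e) else 0)"

lemma nrm_cube_corr:
  assumes "m < d"
  shows "(\<Sum>i<d. (cube_corr m e T i)\<^sup>2) = real m * e\<^sup>2"
proof -
  have "(\<Sum>i<d. (cube_corr m e T i)\<^sup>2) = (\<Sum>i<d. if i \<in> {1..m} then e\<^sup>2 else 0)"
    by (intro sum.cong refl) (simp add: cube_corr_def)
  also have "\<dots> = (\<Sum>i\<in>{..<d} \<inter> {1..m}. e\<^sup>2)" by (rule sum.inter_restrict[symmetric]) simp
  also have "{..<d} \<inter> {1..m} = {1..m}" using assms by auto
  finally show ?thesis by simp
qed

text \<open>The trace is \<open>s\<^sup>2 (m e\<^sup>2 + m + 1)\<close>, while the diagonal entry at
  1 shows that the norm is at least \<open>s\<^sup>2 (1 + e\<^sup>2)\<close>. The quotient is at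
  most \<open>m + 1\<close>, with no constant lost.\<close>

lemma corr_cov_in_class:
  assumes m: "1 \<le> m" "m < d" and s: "0 < s" "3 * s\<^sup>2 = \<sigma>\<^sup>2" and e: "real m * e\<^sup>2 \<le> 1/4" and r: "real m + 1 \<le> r"
  shows "corr_cov d m s (cube_corr m e T) \<in> cov_class d \<sigma> r"
proof -
  let ?w = "cube_corr m e T" let ?S = "corr_cov d m s ?w"
  have d: "0 < d" using m by simp
  have car: "?S \<in> carrier_mat d d" by (simp add: corr_cov_def)
  have "nrm d ?w = sqrt (real m * e\<^sup>2)" using nrm_cube_corr[OF m(2)] by (simp add: L2_set_def)
  also have "\<dots> \<le> sqrt (1/4)" using e by (rule real_sqrt_le_mono)
  finally have "nrm d ?w \<le> 1/2" by (simp add: real_sqrt_divide)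
  then have op: "op_norm ?S \<le> \<sigma>\<^sup>2"
    using corr_cov_op_bound[OF d s(1)] s by (intro op_norm_le[OF car]) auto
  have w0: "?w 0 = 0" by (simp add: cube_corr_def)
  have "tr ?S = (\<Sum>i<d. s\<^sup>2 * ((?w i)\<^sup>2 + (if i \<in> {..m} then 1 else 0)))"
    unfolding tr_def using car w0 by (intro sum.cong) (auto simp: corr_cov_def power2_eq_square)
  also have "\<dots> = s\<^sup>2 * ((\<Sum>i<d. (?w i)\<^sup>2) + (\<Sum>i<d. if i \<in> {..m} then 1 else 0))"
    by (simp only: sum_distrib_left[symmetric] sum.distrib)
  also have "(\<Sum>i<d. if i \<in> {..m} then 1 else 0) = (\<Sum>i\<in>{..<d} \<inter> {..m}. 1 :: real)"
    by (rule sum.inter_restrict[symmetric]) simp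
  also have "{..<d} \<inter> {..m} = {..m}" using m by auto
  finally have tr: "tr ?S = s\<^sup>2 * (real m * e\<^sup>2 + (real m + 1))" unfolding nrm_cube_corr[OF m(2)] by simp
  have low: "s\<^sup>2 * (1 + e\<^sup>2) \<le> op_norm ?S"
  proof -
    have "s\<^sup>2 * (1 + e\<^sup>2) = \<bar>?S $$ (1, 1)\<bar>"
      using m by (simp add: corr_cov_def cube_corr_def power2_eq_square abs_mult)
    also have "\<dots> \<le> op_norm ?S" using op_bound_entry[OF op_bound_op_norm[OF car], of 1 1] m by simp
    finally show ?thesis .
  qed
  have s2: "0 < s\<^sup>2" using s by simp
  have pos: "0 < op_norm ?S" by (rule less_le_trans[OF _ low]) (use s2 in \<open>simp add: add_pos_nonneg\<close>)
  have "tr ?S \<le> (real m + 1) * (s\<^sup>2 * (1 + e\<^sup>2))"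
    unfolding tr using s2 by (simp add: algebra_simps)
  also have "\<dots> \<le> r * op_norm ?S" using r low s2 by (intro mult_mono) auto
  finally have "effective_rank ?S \<le> r" using pos by (simp add: effective_rank_def pos_divide_le_eq)
  then show ?thesis using op corr_cov_psd[OF d] by (simp add: cov_class_def)
qed

lemma open_in_pseudometric_borel:
  assumes "U \<subseteq> \<Theta>" "\<And>x. x \<in> U \<Longrightarrow> \<exists>e>0. \<forall>y\<in>\<Theta>. \<rho> x y < e \<longrightarrow> y \<in> U"
  shows "U \<in> sets (pseudometric_borel \<Theta> \<rho>)"
  unfolding pseudometric_borel_def using assms by (subst sets_measure_of) auto

text \<open>The signs of column 0 of the estimate are guesses of the signs of the vertex. Each wrong
  guess adds at least \<open>(s\<^sup>2 e)\<^sup>2\<close> to the squared norm of that column of the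
  error, so a small operator loss leaves fewer wrong guesses than Assouad's lemma permits.\<close>

lemma minimax_lower_bound_cube:
  fixes \<sigma> r \<delta> :: real
  assumes n: "0 < n" and m: "1 \<le> m" "m < d" "m \<le> n" and \<delta>: "0 < \<delta>" "\<delta> \<le> 1/4" and \<sigma>: "0 < \<sigma>"
    and r: "real m + 1 \<le> r"
  shows "ennreal (\<sigma>\<^sup>2 / 15 * sqrt (real m / (8 * real n)))
    \<le> minimax_quantile \<delta> (sample_space n d) (pseudometric_borel (cov_class d \<sigma> r) op_loss) (normal_family n d) op_loss"
proof (rule minimax_quantile_ge)
  let ?X = "sample_space n d" and ?\<Theta> = "cov_class d \<sigma> r" and ?J = "{1..m}"
  fix est assume estm: "est \<in> measurable ?X (pseudometric_borel ?\<Theta> op_loss)"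
  assume good: "\<And>\<theta> P. \<theta> \<in> space (pseudometric_borel ?\<Theta> op_loss) \<Longrightarrow> P \<in> normal_family n d \<theta> \<Longrightarrow>
      \<exists>t. 0 \<le> t \<and> t < \<sigma>\<^sup>2 / 15 * sqrt (real m / (8 * real n)) \<and> 1 - \<delta> \<le> measure P {x \<in> space ?X. op_loss (est x) \<theta> \<le> t}"
  have d: "0 < d" using m by simp
  have est: "est x \<in> ?\<Theta>" if "x \<in> space ?X" for x using that estm by (auto dest: measurable_space)
  have estc: "est x \<in> carrier_mat d d" if "x \<in> space ?X" for x
    using est[OF that] by (auto simp: cov_class_def psd_mats_iff)
  \<comment> \<open>Chosen so that \<open>n * e\<^sup>2 / 2 = 1/50\<close>: the affinity of
    neighbouring vertices is then at least \<open>49/50\<close>, and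
    \<open>1 - (49/50)\<^sup>2\<close> lies just below \<open>(1/5)\<^sup>2\<close>.\<close>
  define e where "e = 1 / (5 * sqrt (real n))"
  define s where "s = \<sigma> / sqrt 3"
  have e: "0 < e" "e\<^sup>2 = 1 / (25 * real n)" using n by (simp_all add: e_def power_divide power_mult_distrib)
  have s: "0 < s" "s\<^sup>2 = \<sigma>\<^sup>2 / 3" using \<sigma> by (simp_all add: s_def power_divide)
  define C where "C T = corr_cov d m s (cube_corr m e T)" for T
  have me: "real m * e\<^sup>2 \<le> 1/4" using m n by (simp add: e(2) field_simps)
  have C: "C T \<in> ?\<Theta>" for T
    unfolding C_def by (rule corr_cov_in_class[OF m(1,2) s(1) _ me r]) (simp add: s(2))
  have Cc: "C T \<in> carrier_mat d d" for T by (simp add: C_def corr_cov_def)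
  have C0: "C T $$ (i, 0) = s\<^sup>2 * cube_corr m e T i" if "i \<in> ?J" for T i
    using that m by (simp add: C_def corr_cov_def) (simp add: cube_corr_def)
  define P where "P T = PiM {..<n} (\<lambda>_. centred_normal d (C T))" for T
  have probP: "prob_space (P T)" for T unfolding P_def by (rule prob_space_PiM_centred_normal)
  have setsP: "sets (P T) = sets (borel_sample n d)" for T
    unfolding P_def by (rule sets_PiM_centred_normal)
  have spaceP: "space (P T) = space ?X" for T unfolding P_def by (rule space_PiM_centred_normal)
  \<comment> \<open>The event of guessing a positive sign. Its measurability follows because the
    matrices with a positive entry form an open subset of the parameter space.\<close>
  define E where "E j = {x \<in> space ?X. 0 < est x $$ (j, 0)}" for j
  have E: "E j \<in> sets (borel_sample n d)" if j: "j \<in> ?J" for j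
  proof -
    have "{\<Sigma> \<in> ?\<Theta>. 0 < \<Sigma> $$ (j, 0)} \<in> sets (pseudometric_borel ?\<Theta> op_loss)"
    proof (rule open_in_pseudometric_borel)
      fix A assume A: "A \<in> {\<Sigma> \<in> ?\<Theta>. 0 < \<Sigma> $$ (j, 0)}"
      have "0 < B $$ (j, 0)" if B: "B \<in> ?\<Theta>" "op_loss A B < A $$ (j, 0)" for B
      proof -
        have "\<bar>A $$ (j, 0) - B $$ (j, 0)\<bar> \<le> op_loss A B"
          by (rule op_loss_entry) (use A B j m in \<open>auto simp: cov_class_def psd_mats_iff\<close>)
        then show ?thesis using B by linarith
      qed
      then show "\<exists>e>0. \<forall>y\<in>?\<Theta>. op_loss A y < e \<longrightarrow> y \<in> {\<Sigma> \<in> ?\<Theta>. 0 < \<Sigma> $$ (j, 0)}"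
        using A by (intro exI[of _ "A $$ (j, 0)"]) auto
    qed auto
    from measurable_sets[OF estm this] have "est -` {\<Sigma> \<in> ?\<Theta>. 0 < \<Sigma> $$ (j, 0)} \<inter> space ?X \<in> sets ?X" .
    also have "est -` {\<Sigma> \<in> ?\<Theta>. 0 < \<Sigma> $$ (j, 0)} \<inter> space ?X = E j" using est by (auto simp: E_def)
    finally show ?thesis by (simp add: sets_sample_space)
  qed
  show False
  proof (rule assouad[of ?J "\<lambda>T j. measure (P T) (E j)"])
    show "?J \<noteq> {}" using m by simp
    fix j T assume j: "j \<in> ?J" and T: "T \<subseteq> ?J - {j}"
    define w where "w = (cube_corr m e T)(j := 0)"
    have w1: "cube_corr m e (insert j T) = w(j := e)" and w2: "cube_corr m e T = w(j := - e)"
      using j T by (auto simp: w_def cube_corr_def fun_eq_iff)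
    have z: "cube_corr m e T' 0 = 0" "m < i \<Longrightarrow> cube_corr m e T' i = 0" for T' i by (simp_all add: cube_corr_def)
    have e1: "e\<^sup>2 \<le> 1/25" using n by (simp add: e(2) field_simps)
    have "(measure (P (insert j T)) (E j) - measure (P T) (E j))\<^sup>2 \<le> 1 - ((1 - e\<^sup>2 / 2) ^ n)\<^sup>2"
      unfolding P_def C_def
    proof (rule testing_affinity_PiM)
      interpret G: prob_space "gauss {..<d} :: (nat \<Rightarrow> real) measure" by (rule prob_space_gauss)
      show "sigma_finite_measure (gauss {..<d} :: (nat \<Rightarrow> real) measure)" ..
      show "shear_density d (cube_corr m e (insert j T)) \<in> borel_measurable (gauss {..<d})"
        "shear_density d (cube_corr m e T) \<in> borel_measurable (gauss {..<d})"
        by (rule measurable_shear_density[OF d])+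
      show "centred_normal d (corr_cov d m s (cube_corr m e (insert j T)))
          = distr (density (gauss {..<d}) (\<lambda>x. ennreal (shear_density d (cube_corr m e (insert j T)) x))) (borel_vec d)
              (\<lambda>x. \<lambda>i\<in>{..<d}. if i \<le> m then s * x i else 0)"
        "centred_normal d (corr_cov d m s (cube_corr m e T))
          = distr (density (gauss {..<d}) (\<lambda>x. ennreal (shear_density d (cube_corr m e T) x))) (borel_vec d)
              (\<lambda>x. \<lambda>i\<in>{..<d}. if i \<le> m then s * x i else 0)"
        by (intro centred_normal_corr d z; assumption)+
      show "ennreal (1 - e\<^sup>2 / 2) \<le> (\<integral>\<^sup>+x. ennreal (sqrt (shear_density d (cube_corr m e (insert j T)) x
          * shear_density d (cube_corr m e T) x)) \<partial>gauss {..<d})"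
        unfolding w1 w2 by (rule shear_affinity[OF d]) (use j m z in \<open>auto simp: w_def\<close>)
      show "(\<lambda>x. \<lambda>i\<in>{..<d}. if i \<le> m then s * x i else 0) \<in> measurable (gauss {..<d}) (borel_vec d)"
        by (rule measurable_truncate_scale)
      show "0 \<le> 1 - e\<^sup>2 / 2" using e1 by simp
      show "E j \<in> sets (borel_sample n d)" by (rule E[OF j])
    qed (auto intro: prob_space_centred_normal simp: shear_density_def)
    also have "\<dots> \<le> (1/5)\<^sup>2"
    proof -
      have "1 + real n * (- (e\<^sup>2 / 2)) \<le> (1 + - (e\<^sup>2 / 2)) ^ n" by (rule Bernoulli_inequality) (use e1 in simp)
      moreover have "real n * (e\<^sup>2 / 2) = 1/50" using n by (simp add: e(2))
      ultimately have "49/50 \<le> (1 - e\<^sup>2 / 2) ^ n" by simp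
      then have "(49/50)\<^sup>2 \<le> ((1 - e\<^sup>2 / 2) ^ n)\<^sup>2" by (intro power_mono) auto
      then show ?thesis by (simp add: power2_eq_square)
    qed
    finally show "measure (P (insert j T)) (E j) - measure (P T) (E j) \<le> 1/5" by (rule power2_le_imp_le) simp
  next
    fix T assume T: "T \<subseteq> ?J"
    interpret P: prob_space "P T" by (rule probP)
    obtain t where t: "0 \<le> t" "t < \<sigma>\<^sup>2 / 15 * sqrt (real m / (8 * real n))"
      "1 - \<delta> \<le> measure (P T) {x \<in> space ?X. op_loss (est x) (C T) \<le> t}"
      using good[of "C T" "P T"] C by (auto simp: normal_family_def P_def)
    let ?A = "{x \<in> space ?X. op_loss (est x) (C T) \<le> t}"
    have A[measurable]: "?A \<in> sets (P T)" by (rule measure_pos_imp_sets) (use t(3) \<delta> in linarith)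
    define V where "V j = (if j \<in> T then space (P T) - E j else E j)" for j
    have V: "V j \<in> sets (P T)" if "j \<in> ?J" for j using E[OF that] unfolding V_def setsP[symmetric, of T] by auto
    have mV: "measure (P T) (V j) = (if j \<in> T then 1 - measure (P T) (E j) else measure (P T) (E j))" if "j \<in> ?J" for j
      using E[OF that] P.prob_compl[of "E j"] unfolding V_def setsP[symmetric, of T] by auto
    \<comment> \<open>On the good event at most one eighth of the signs are wrong, since
      \<open>(\<sigma>\<^sup>2 / 15)\<^sup>2 * m / (8 n)\<close> equals \<open>m / 8\<close> times
      \<open>(s\<^sup>2 e)\<^sup>2\<close>. Off it, all \<open>m\<close> may be wrong.\<close>
    have count: "(\<Sum>j\<in>?J. indicator (V j) x) \<le> real m / 8 + real m * indicator (space (P T) - ?A) x"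
      if x: "x \<in> space (P T)" for x
    proof (cases "x \<in> ?A")
      case False
      have "(\<Sum>j\<in>?J. indicator (V j) x :: real) \<le> (\<Sum>j\<in>?J. 1)" by (intro sum_mono) (auto simp: indicator_def)
      then show ?thesis using False x by (simp add: indicator_def)
    next
      case True
      then have xX: "x \<in> space ?X" and loss: "op_loss (est x) (C T) \<le> t" by auto
      let ?D = "est x - C T"
      have Dc: "?D \<in> carrier_mat d d" by (rule minus_carrier_mat[OF Cc])
      have col: "mv d (entries ?D) (\<lambda>k. if k = 0 then 1 else 0) i = est x $$ (i, 0) - s\<^sup>2 * cube_corr m e T i" if "i \<in> ?J" for i
      proof -
        have "mv d (entries ?D) (\<lambda>k. if k = 0 then 1 else 0) i = ?D $$ (i, 0)" by (rule mv_unit[OF d])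
        also have "\<dots> = est x $$ (i, 0) - C T $$ (i, 0)"
          by (rule index_minus_mat(1)) (use that m Cc[of T] d in auto)
        finally show ?thesis using C0[OF that] by simp
      qed
      have "(\<Sum>j\<in>?J. indicator (V j) x) * (s\<^sup>2 * e)\<^sup>2 = (\<Sum>j\<in>?J. indicator (V j) x * (s\<^sup>2 * e)\<^sup>2)"
        by (rule sum_distrib_right)
      also have "\<dots> \<le> (\<Sum>j\<in>?J. (mv d (entries ?D) (\<lambda>k. if k = 0 then 1 else 0) j)\<^sup>2)"
      proof (rule sum_mono)
        fix j assume j: "j \<in> ?J"
        show "indicator (V j) x * (s\<^sup>2 * e)\<^sup>2 \<le> (mv d (entries ?D) (\<lambda>k. if k = 0 then 1 else 0) j)\<^sup>2"
        proof (cases "x \<in> V j")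
          case True
          have se: "0 \<le> s\<^sup>2 * e" using e by simp
          have "s\<^sup>2 * e \<le> \<bar>est x $$ (j, 0) - s\<^sup>2 * cube_corr m e T j\<bar>"
          proof (cases "j \<in> T")
            case True
            then have "est x $$ (j, 0) \<le> 0" using \<open>x \<in> V j\<close> xX by (auto simp: V_def E_def)
            moreover have "cube_corr m e T j = e" using True j by (simp add: cube_corr_def)
            ultimately show ?thesis using se by simp
          next
            case False
            then have "0 < est x $$ (j, 0)" using \<open>x \<in> V j\<close> by (auto simp: V_def E_def)
            moreover have "cube_corr m e T j = - e" using False j by (simp add: cube_corr_def)
            ultimately show ?thesis using se by simp
          qed
          then have "(s\<^sup>2 * e)\<^sup>2 \<le> \<bar>est x $$ (j, 0) - s\<^sup>2 * cube_corr m e T j\<bar>\<^sup>2" using se by (intro power_mono) auto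
          then show ?thesis using True unfolding col[OF j] by simp
        qed simp
      qed
      also have "\<dots> \<le> (\<Sum>j<d. (mv d (entries ?D) (\<lambda>k. if k = 0 then 1 else 0) j)\<^sup>2)"
        by (rule sum_mono2) (use m in auto)
      also have "\<dots> = (nrm d (mv d (entries ?D) (\<lambda>k. if k = 0 then 1 else 0)))\<^sup>2"
        by (simp add: L2_set_def sum_nonneg)
      also have "\<dots> \<le> t\<^sup>2"
      proof (rule power_mono)
        have "nrm d (mv d (entries ?D) (\<lambda>k. if k = 0 then 1 else 0)) \<le> op_norm ?D"
          by (rule nrm_mv_le_op_norm[OF Dc]) (simp add: nrm_unit[OF d])
        then show "nrm d (mv d (entries ?D) (\<lambda>k. if k = 0 then 1 else 0)) \<le> t"
          using loss by (simp add: op_loss_def)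
      qed simp
      also have "\<dots> \<le> (\<sigma>\<^sup>2 / 15 * sqrt (real m / (8 * real n)))\<^sup>2" using t by (intro power_mono) auto
      also have "\<dots> = real m / 8 * (s\<^sup>2 * e)\<^sup>2"
        using n by (simp add: power_mult_distrib e(2) s(2) power_divide)
      finally have "(\<Sum>j\<in>?J. indicator (V j) x) \<le> real m / 8"
        by (rule mult_right_le_imp_le) (use s e in simp)
      then show ?thesis using True by simp
    qed
    have "(\<Sum>j\<in>?J. if j \<in> T then 1 - measure (P T) (E j) else measure (P T) (E j)) = (\<Sum>j\<in>?J. measure (P T) (V j))"
      by (intro sum.cong refl) (simp add: mV)
    also have "\<dots> = (\<Sum>j\<in>?J. \<integral>x. indicator (V j) x \<partial>P T)" using V by (intro sum.cong refl) simp
    also have "\<dots> = (\<integral>x. (\<Sum>j\<in>?J. indicator (V j) x) \<partial>P T)"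
      by (rule Bochner_Integration.integral_sum[symmetric]) (use V in \<open>auto simp: less_top[symmetric]\<close>)
    also have "\<dots> \<le> (\<integral>x. real m / 8 + real m * indicator (space (P T) - ?A) x \<partial>P T)"
      by (rule integral_mono) (use V count in \<open>auto simp: less_top[symmetric]\<close>)
    also have "\<dots> = real m / 8 + real m * measure (P T) (space (P T) - ?A)"
      by (subst Bochner_Integration.integral_add) (auto simp: P.prob_space less_top[symmetric])
    \<comment> \<open>The bad event has probability at most \<open>\<delta> \<le> 1/4\<close>, which
      gives the \<open>3/8\<close> of Assouad's lemma.\<close>
    also have "\<dots> \<le> real m / 8 + real m * (1/4)"
      using t(3) \<delta> P.prob_compl[OF A] by (intro add_left_mono mult_left_mono) auto
    finally show "(\<Sum>j\<in>?J. if j \<in> T then 1 - measure (P T) (E j) else measure (P T) (E j)) \<le> 3/8 * real (card ?J)"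
      by simp
  qed simp
qed

section \<open>Combination of the bounds\<close>

theorem proposition13:
  shows "\<exists>c C :: real. 0 < c \<and> 0 < C \<and>
    (\<forall>(n::nat) (d::nat) (\<delta>::real) (\<sigma>::real) (r::real).
       0 < n \<longrightarrow> 0 < d \<longrightarrow> 0 < \<delta> \<longrightarrow> \<delta> \<le> 1/4 \<longrightarrow> 0 < \<sigma> \<longrightarrow>
       1 \<le> r \<longrightarrow> r \<le> real (min n d) \<longrightarrow>
       (let \<Theta> = cov_class d \<sigma> r;
            M = minimax_quantile \<delta> (sample_space n d) (pseudometric_borel \<Theta> op_loss)
                  (normal_family n d) op_loss;
            b = min (\<sigma>\<^sup>2 * sqrt ((r + ln (1/\<delta>)) / real n)) (\<sigma>\<^sup>2)
        in ennreal (c * b) \<le> M \<and> M \<le> ennreal (C * b)))"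
proof (rule exI[of _ "1/150"], rule exI[of _ 288], intro conjI allI impI)
  fix n d :: nat and \<delta> \<sigma> r :: real
  assume n: "0 < n" and d: "0 < d" and \<delta>: "0 < \<delta>" "\<delta> \<le> 1/4" and \<sigma>: "0 < \<sigma>" and r: "1 \<le> r" "r \<le> real (min n d)"
  let ?M = "minimax_quantile \<delta> (sample_space n d) (pseudometric_borel (cov_class d \<sigma> r) op_loss) (normal_family n d) op_loss"
  let ?b = "min (\<sigma>\<^sup>2 * sqrt ((r + ln (1/\<delta>)) / real n)) (\<sigma>\<^sup>2)"
  define l where "l = ln (1 / \<delta>)"
  have l1: "1 \<le> l"
  proof -
    have "exp 1 \<le> (1 / \<delta> :: real)"
    proof -
      have "exp 1 \<le> (3 :: real)" by (rule exp_le)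
      also have "\<dots> \<le> 1 / \<delta>" using \<delta> by (simp add: field_simps)
      finally show ?thesis .
    qed
    then show ?thesis using \<delta> by (simp add: l_def ln_ge_iff)
  qed
  have up: "?M \<le> ennreal (288 * ?b)" by (rule minimax_upper_bound[OF n d \<delta> \<sigma> r(1)])
  have "ennreal (1/150 * ?b) \<le> ?M"
  \<comment> \<open>The cube needs room for at least one sign, hence \<open>r \<ge> 2\<close>, and
    pays off when \<open>r\<close> dominates. Otherwise \<open>r\<close> is at most
    \<open>2 * l\<close>, because \<open>l \<ge> 1\<close>, and the rank-one bound is of the right
    order.\<close>
  proof (cases "2 \<le> r \<and> l \<le> r")
    case True
    define N where "N = nat \<lfloor>r\<rfloor>"
    have fl: "real N \<le> r" "r < real N + 1" "2 \<le> N" using True unfolding N_def by linarith+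
    \<comment> \<open>One unit of effective rank is reserved for coordinate 0, so
      \<open>m + 1 \<le> r\<close>; together with \<open>r \<le> min n d\<close> this also gives
      \<open>m < d\<close> and \<open>m \<le> n\<close>.\<close>
    define m where "m = N - 1"
    have mr: "real m + 1 \<le> r" "1 \<le> m" "r < real m + 2" using fl by (auto simp: m_def)
    have mb: "m < d" "m \<le> n" using mr(1) r(2) by auto
    have "1/150 * ?b \<le> \<sigma>\<^sup>2 / 15 * sqrt (real m / (8 * real n))"
    proof -
      have "sqrt ((r + l) / real n) \<le> sqrt (100 * (real m / (8 * real n)))"
      proof (rule real_sqrt_le_mono)
        \<comment> \<open>Indeed \<open>r + l \<le> 2 r < 2 (m + 2) \<le> 6 m\<close>. The number
          100 is chosen for its integral square root, and \<open>15 * 10 = 150\<close> is the lower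
          constant.\<close>
        have "r + l \<le> 100 * real m / 8" using True mr by linarith
        then have "(r + l) / real n \<le> (100 * real m / 8) / real n" using n by (intro divide_right_mono) auto
        then show "(r + l) / real n \<le> 100 * (real m / (8 * real n))" by simp
      qed
      also have "\<dots> = 10 * sqrt (real m / (8 * real n))" unfolding real_sqrt_mult by simp
      finally have "\<sigma>\<^sup>2 * sqrt ((r + l) / real n) \<le> \<sigma>\<^sup>2 * (10 * sqrt (real m / (8 * real n)))"
        by (rule mult_left_mono) simp
      then show ?thesis unfolding l_def by (simp add: min.coboundedI1)
    qed
    then have "ennreal (1/150 * ?b) \<le> ennreal (\<sigma>\<^sup>2 / 15 * sqrt (real m / (8 * real n)))" by (rule ennreal_leI)
    also have "\<dots> \<le> ?M" by (rule minimax_lower_bound_cube[OF n mr(2) mb \<delta> \<sigma> mr(1)])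
    finally show ?thesis .
  next
    case False
    have "1/150 * ?b \<le> \<sigma>\<^sup>2 / 8 * min (sqrt (l / real n)) 1"
    proof -
      have "r + l \<le> 4 * l" using False l1 by linarith
      then have "sqrt ((r + l) / real n) \<le> sqrt (4 * (l / real n))"
        using n by (intro real_sqrt_le_mono) (simp add: field_simps)
      also have "\<dots> = 2 * sqrt (l / real n)" unfolding real_sqrt_mult by simp
      finally have a: "\<sigma>\<^sup>2 * sqrt ((r + l) / real n) \<le> \<sigma>\<^sup>2 * (2 * sqrt (l / real n))"
        by (rule mult_left_mono) simp
      show ?thesis
      proof (cases "sqrt (l / real n) \<le> 1")
        case True
        then have "min (sqrt (l / real n)) 1 = sqrt (l / real n)" by simp
        moreover have "?b \<le> \<sigma>\<^sup>2 * (2 * sqrt (l / real n))" using a unfolding l_def by (simp add: min.coboundedI1)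
        moreover have "0 \<le> \<sigma>\<^sup>2 * sqrt (l / real n)" using l1 by simp
        ultimately show ?thesis by (simp add: field_simps)
      next
        case False
        then have mn: "min (sqrt (l / real n)) 1 = 1" by simp
        have "?b \<le> \<sigma>\<^sup>2" "0 \<le> \<sigma>\<^sup>2" by simp_all
        then show ?thesis unfolding mn by linarith
      qed
    qed
    then have "ennreal (1/150 * ?b) \<le> ennreal (\<sigma>\<^sup>2 / 8 * min (sqrt (l / real n)) 1)" by (rule ennreal_leI)
    also have "\<dots> \<le> ?M" unfolding l_def by (rule minimax_lower_bound_rank1[OF n d \<delta> \<sigma> r(1)])
    finally show ?thesis .
  qed
  with up show "let \<Theta> = cov_class d \<sigma> r;
            M = minimax_quantile \<delta> (sample_space n d) (pseudometric_borel \<Theta> op_loss) (normal_family n d) op_loss;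
            b = min (\<sigma>\<^sup>2 * sqrt ((r + ln (1/\<delta>)) / real n)) (\<sigma>\<^sup>2)
        in ennreal (1/150 * b) \<le> M \<and> M \<le> ennreal (288 * b)"
    unfolding Let_def by blast
qed auto

end
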